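(* Let $R$ be a commutative ring with unit, let $(\mathfrak{g},[\cdot,\cdot])$ be a Lie algebra over $R$ and let $\sigma$ be a 2-cocycle in the trivial Lie algebra cohomology of $\mathfrak{g}$. Let $\operatorname{Sym}_\sigma(\mathfrak{g})=(\operatorname{Sym}(\mathfrak{g}),\{\cdot,\cdot\}_\sigma)$ be the associated modified Lie-Poisson algebra, let $\mathfrak{g}^+$ be the double of $\mathfrak{g}$ with its cocycle $\sigma^+$, and let $U_{Lie,\sigma^+}(\mathfrak{g}^+)$ be the corresponding modified Lie enveloping algebra, with canonical map $\iota:\mathfrak{g}^+\to U_{Lie,\sigma^+}(\mathfrak{g}^+)$. Let $\alpha':\operatorname{Sym}_\sigma(\mathfrak{g})\to U_{Lie,\sigma^+}(\mathfrak{g}^+)$ be the unique algebra morphism with $\alpha'(x)=\iota(x^0)$ for all $x\in\mathfrak{g}$, and let $\beta':\operatorname{Sym}_\sigma(\mathfrak{g})\to U_{Lie,\sigma^+}(\mathfrak{g}^+)$ be the unique $\alpha'$-derivation with $\beta'(x)=\iota(x^1)$ for all $x\in\mathfrak{g}$. Then $(U_{Lie,\sigma^+}(\mathfrak{g}^+),\alpha',\beta')$ is a Poisson enveloping algebra of the modified Lie-Poisson algebra $\operatorname{Sym}_\sigma(\mathfrak{g})$.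
   Context: All rings and associative algebras are unitary and morphisms preserve units; algebras are over $R$ and $\otimes=\otimes_R$. 2-cocycle: a skew-symmetric (alternating) $R$-bilinear form $\sigma:\mathfrak{g}\times\mathfrak{g}\to R$ with $\sigma([x,y],z)+\sigma([y,z],x)+\sigma([z,x],y)=0$ for all $x,y,z\in\mathfrak{g}$. The bracket $\{\cdot,\cdot\}_\sigma$ on the symmetric algebra $\operatorname{Sym}(\mathfrak{g})$ is the unique biderivation with $\{x,y\}_\sigma:=[x,y]+\sigma(x,y)$ for $x,y\in\mathfrak{g}$; it makes $\operatorname{Sym}(\mathfrak{g})$ into a Poisson algebra, the modified Lie-Poisson algebra $\operatorname{Sym}_\sigma(\mathfrak{g})$. The double: let $\mathfrak{g}^0$ be a copy of the $R$-module $\mathfrak{g}$ and $\mathfrak{g}^+:=\mathfrak{g}^0\oplus\mathfrak{g}$; for $x\in\mathfrak{g}$ write $x^0$ (resp. $x^1$) for its canonical image in the first (resp. second) summand. The Lie bracket on $\mathfrak{g}^+$ is given, for $y,z\in\mathfrak{g}$, by $[y^0,z^0]^+=0$, $[y^0,z^1]^+=[y,z]^0$, $[y^1,z^1]^+=[y,z]^1$. The cocycle $\sigma^+$ of $\mathfrak{g}^+$ is the bilinear form with $\sigma^+(x^0,y^0)=\sigma^+(x^1,y^1)=0$ and $\sigma^+(x^0,y^1)=\sigma^+(x^1,y^0)=\sigma(x,y)$ for $x,y\in\mathfrak{g}$. The modified Lie enveloping algebra (Sridharan algebra) is $U_{Lie,\sigma^+}(\mathfrak{g}^+):=T(\mathfrak{g}^+)/I_\sigma$,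 where $T(\mathfrak{g}^+)$ is the tensor algebra and $I_\sigma$ is its two-sided ideal generated by all elements $x^+\otimes y^+-y^+\otimes x^+-[x^+,y^+]^+-\sigma^+(x^+,y^+)\cdot1$ with $x^+,y^+\in\mathfrak{g}^+$. For an algebra morphism $\alpha:\mathcal{A}\to U$, with $\mathcal{A}$ commutative, an $\alpha$-derivation is an $R$-linear map $\beta:\mathcal{A}\to U$ with $\beta(ab)=\alpha(a)\beta(b)+\alpha(b)\beta(a)$ for all $a,b\in\mathcal{A}$. (The morphism $\alpha'$ above exists since the elements $\iota(x^0)$ commute pairwise; explicitly, $\beta'(x_1\cdots x_k)=\sum_j\alpha'(x_1\cdots\widehat{x_j}\cdots x_k)\,\iota(x_j^1)$.) A Poisson algebra over $R$ is an $R$-module $\mathcal{A}$ with a commutative (associative, unitary) $R$-algebra structure and an $R$-Lie algebra structure $\{\cdot,\cdot\}$ such that $\{a_1a_2,a_3\}=a_1\{a_2,a_3\}+a_2\{a_1,a_3\}$ for all $a_1,a_2,a_3$. For an algebra $U$, $U_L$ denotes $U$ viewed as a Lie algebra with the commutator bracket. A Poisson enveloping algebra of a Poisson algebra $\mathcal{A}$ is a triple $(U,\alpha,\beta)$ with $U$ an algebra, $\alpha:\mathcal{A}\to U$ an algebra morphism and $\beta:\mathcal{A}\to U_L$ a Lie algebra morphism such that for all $a_1,a_2\in\mathcal{A}$: $\alpha(\{a_1,a_2\})=\alpha(a_1)\beta(a_2)-\beta(a_2)\alpha(a_1)$ and $\beta(a_1a_2)=\alpha(a_1)\beta(a_2)+\alpha(a_2)\beta(a_1)$,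 and which is universal: for any algebra $U'$, algebra morphism $\alpha':\mathcal{A}\to U'$ and Lie algebra morphism $\beta':\mathcal{A}\to U'_L$ satisfying the same two identities, there is a unique algebra morphism $\gamma:U\to U'$ with $\gamma\circ\alpha=\alpha'$ and $\gamma\circ\beta=\beta'$. *)

theory Defs
  imports "HOL-Algebra.Algebra"
begin

definition linear_maps ::
  "('r, 'k) ring_scheme \<Rightarrow> ('r, 'a, 'm) module_scheme \<Rightarrow> ('r, 'b, 'n) module_scheme \<Rightarrow> ('a \<Rightarrow> 'b) set"
  where "linear_maps R M N =
    {f. f \<in> carrier M \<rightarrow> carrier N \<and>
        (\<forall>x\<in>carrier M. \<forall>y\<in>carrier M. f (x \<oplus>\<^bsub>M\<^esub> y) = f x \<oplus>\<^bsub>N\<^esub> f y) \<and>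
        (\<forall>r\<in>carrier R. \<forall>x\<in>carrier M. f (r \<odot>\<^bsub>M\<^esub> x) = r \<odot>\<^bsub>N\<^esub> f x)}"

definition bilinear_maps ::
  "('r, 'k) ring_scheme \<Rightarrow> ('r, 'a, 'm) module_scheme \<Rightarrow> ('r, 'b, 'n) module_scheme
    \<Rightarrow> ('a \<Rightarrow> 'a \<Rightarrow> 'b) set"
  where "bilinear_maps R M N =
    {f. (\<forall>x\<in>carrier M. (\<lambda>y. f x y) \<in> linear_maps R M N) \<and>
        (\<forall>y\<in>carrier M. (\<lambda>x. f x y) \<in> linear_maps R M N)}"

definition regular_module :: "('r, 'k) ring_scheme \<Rightarrow> ('r, 'r) module"
  where "regular_module R =
    \<lparr>carrier = carrier R, monoid.mult = monoid.mult R, monoid.one = monoid.one R,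
     ring.zero = ring.zero R, ring.add = ring.add R, smult = monoid.mult R\<rparr>"

text \<open>The library locale \<^locale>\<open>algebra\<close> is restricted to commutative algebras; this is its
  non-commutative counterpart.\<close>

locale assoc_algebra = module R A + ring A for R (structure) and A (structure) +
  assumes smult_mult_left:
      "\<lbrakk>r \<in> carrier R; x \<in> carrier A; y \<in> carrier A\<rbrakk>
        \<Longrightarrow> (r \<odot>\<^bsub>A\<^esub> x) \<otimes>\<^bsub>A\<^esub> y = r \<odot>\<^bsub>A\<^esub> (x \<otimes>\<^bsub>A\<^esub> y)"
    and smult_mult_right:
      "\<lbrakk>r \<in> carrier R; x \<in> carrier A; y \<in> carrier A\<rbrakk>
        \<Longrightarrow> x \<otimes>\<^bsub>A\<^esub> (r \<odot>\<^bsub>A\<^esub> y) = r \<odot>\<^bsub>A\<^esub> (x \<otimes>\<^bsub>A\<^esub> y)"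

definition alg_homs ::
  "('r, 'k) ring_scheme \<Rightarrow> ('r, 'a, 'm) module_scheme \<Rightarrow> ('r, 'b, 'n) module_scheme \<Rightarrow> ('a \<Rightarrow> 'b) set"
  where "alg_homs R A B = ring_hom A B \<inter> linear_maps R A B"

text \<open>\<open>I\<close> is meant to be a two-sided ideal of \<open>A\<close>, which is then automatically an \<open>R\<close>-submodule.
  The scalar multiplication on cosets follows the pattern of \<^const>\<open>rcoset_mult\<close>.\<close>

definition quotient_algebra :: "('r, 'a, 'm) module_scheme \<Rightarrow> 'a set \<Rightarrow> ('r, 'a set) module"
  where "quotient_algebra A I =
    \<lparr>carrier = carrier (A Quot I), monoid.mult = monoid.mult (A Quot I),
     monoid.one = monoid.one (A Quot I),
     ring.zero = ring.zero (A Quot I), ring.add = ring.add (A Quot I),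
     smult = (\<lambda>r C. \<Union>x\<in>C. I +>\<^bsub>A\<^esub> (r \<odot>\<^bsub>A\<^esub> x))\<rparr>"

text \<open>The free associative algebra on a set \<open>E\<close> of letters: finitely supported \<open>R\<close>-valued functions
  on words over \<open>E\<close>, with the convolution product for concatenation of words.\<close>

definition free_algebra :: "('r, 'k) ring_scheme \<Rightarrow> 'a set \<Rightarrow> ('r, 'a list \<Rightarrow> 'r) module"
  where "free_algebra R E =
    \<lparr>carrier = {f. (\<forall>w. f w \<in> carrier R) \<and> finite {w. f w \<noteq> \<zero>\<^bsub>R\<^esub>} \<and> {w. f w \<noteq> \<zero>\<^bsub>R\<^esub>} \<subseteq> lists E},
     monoid.mult = (\<lambda>f g w. \<Oplus>\<^bsub>R\<^esub>i\<in>{..length w}. f (take i w) \<otimes>\<^bsub>R\<^esub> g (drop i w)),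
     monoid.one = (\<lambda>w. if w = [] then \<one>\<^bsub>R\<^esub> else \<zero>\<^bsub>R\<^esub>),
     ring.zero = (\<lambda>w. \<zero>\<^bsub>R\<^esub>),
     ring.add = (\<lambda>f g w. f w \<oplus>\<^bsub>R\<^esub> g w),
     smult = (\<lambda>r f w. r \<otimes>\<^bsub>R\<^esub> f w)\<rparr>"

definition letter :: "('r, 'k) ring_scheme \<Rightarrow> 'a \<Rightarrow> 'a list \<Rightarrow> 'r"
  where "letter R x = (\<lambda>w. if w = [x] then \<one>\<^bsub>R\<^esub> else \<zero>\<^bsub>R\<^esub>)"

text \<open>The two-sided ideal generated by the linearity relations between letters is the \<open>R\<close>-span of
  the multilinearity relations between words. Hence the quotient of the span of the words of length
  \<open>n\<close> is the usual presentation of the \<open>n\<close>-th tensor power of \<open>M\<close>, and the whole quotient is the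
  direct sum of all tensor powers, with concatenation as product.\<close>

definition linearity_ideal ::
  "('r, 'k) ring_scheme \<Rightarrow> ('r, 'a, 'm) module_scheme \<Rightarrow> ('a list \<Rightarrow> 'r) set"
  where "linearity_ideal R M = (let F = free_algebra R (carrier M) in
    genideal F
     ({letter R (x \<oplus>\<^bsub>M\<^esub> y) \<ominus>\<^bsub>F\<^esub> (letter R x \<oplus>\<^bsub>F\<^esub> letter R y) |x y. x \<in> carrier M \<and> y \<in> carrier M} \<union>
      {letter R (r \<odot>\<^bsub>M\<^esub> x) \<ominus>\<^bsub>F\<^esub> r \<odot>\<^bsub>F\<^esub> letter R x |r x. r \<in> carrier R \<and> x \<in> carrier M}))"

definition tensor_algebra ::
  "('r, 'k) ring_scheme \<Rightarrow> ('r, 'a, 'm) module_scheme \<Rightarrow> ('r, ('a list \<Rightarrow> 'r) set) module"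
  where "tensor_algebra R M =
    quotient_algebra (free_algebra R (carrier M)) (linearity_ideal R M)"

definition tensor_inj ::
  "('r, 'k) ring_scheme \<Rightarrow> ('r, 'a, 'm) module_scheme \<Rightarrow> 'a \<Rightarrow> ('a list \<Rightarrow> 'r) set"
  where "tensor_inj R M x =
    linearity_ideal R M +>\<^bsub>free_algebra R (carrier M)\<^esub> letter R x"

definition commutativity_ideal ::
  "('r, 'k) ring_scheme \<Rightarrow> ('r, 'a, 'm) module_scheme \<Rightarrow> ('a list \<Rightarrow> 'r) set set"
  where "commutativity_ideal R M = (let T = tensor_algebra R M; t = tensor_inj R M in
    genideal T {t x \<otimes>\<^bsub>T\<^esub> t y \<ominus>\<^bsub>T\<^esub> t y \<otimes>\<^bsub>T\<^esub> t x |x y. x \<in> carrier M \<and> y \<in> carrier M})"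

definition sym_algebra ::
  "('r, 'k) ring_scheme \<Rightarrow> ('r, 'a, 'm) module_scheme \<Rightarrow> ('r, ('a list \<Rightarrow> 'r) set set) module"
  where "sym_algebra R M = quotient_algebra (tensor_algebra R M) (commutativity_ideal R M)"

definition sym_inj ::
  "('r, 'k) ring_scheme \<Rightarrow> ('r, 'a, 'm) module_scheme \<Rightarrow> 'a \<Rightarrow> ('a list \<Rightarrow> 'r) set set"
  where "sym_inj R M x = commutativity_ideal R M +>\<^bsub>tensor_algebra R M\<^esub> tensor_inj R M x"

locale lie_algebra = module R L
  for R :: "('r, 'k) ring_scheme" (structure) and L :: "('r, 'a, 'm) module_scheme" (structure) +
  fixes bracket :: "'a \<Rightarrow> 'a \<Rightarrow> 'a"
  assumes bracket_bilinear: "bracket \<in> bilinear_maps R L L"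
    and bracket_alternating: "x \<in> carrier L \<Longrightarrow> bracket x x = \<zero>\<^bsub>L\<^esub>"
    and bracket_jacobi: "\<lbrakk>x \<in> carrier L; y \<in> carrier L; z \<in> carrier L\<rbrakk> \<Longrightarrow>
      bracket (bracket x y) z \<oplus>\<^bsub>L\<^esub> bracket (bracket y z) x \<oplus>\<^bsub>L\<^esub> bracket (bracket z x) y = \<zero>\<^bsub>L\<^esub>"

definition lie_homs ::
  "('r, 'k) ring_scheme \<Rightarrow> ('r, 'a, 'm) module_scheme \<Rightarrow> ('a \<Rightarrow> 'a \<Rightarrow> 'a)
    \<Rightarrow> ('r, 'b, 'n) module_scheme \<Rightarrow> ('b \<Rightarrow> 'b \<Rightarrow> 'b) \<Rightarrow> ('a \<Rightarrow> 'b) set"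
  where "lie_homs R L br L' br' =
    {f \<in> linear_maps R L L'. \<forall>x\<in>carrier L. \<forall>y\<in>carrier L. f (br x y) = br' (f x) (f y)}"

definition commutator :: "('a, 'm) ring_scheme \<Rightarrow> 'a \<Rightarrow> 'a \<Rightarrow> 'a"
  where "commutator U x y = x \<otimes>\<^bsub>U\<^esub> y \<ominus>\<^bsub>U\<^esub> y \<otimes>\<^bsub>U\<^esub> x"

locale two_cocycle = lie_algebra R L bracket
  for R :: "('r, 'k) ring_scheme" (structure) and L :: "('r, 'a, 'm) module_scheme" (structure) and bracket +
  fixes \<sigma> :: "'a \<Rightarrow> 'a \<Rightarrow> 'r"
  assumes cocycle_bilinear: "\<sigma> \<in> bilinear_maps R L (regular_module R)"
    and cocycle_alternating: "x \<in> carrier L \<Longrightarrow> \<sigma> x x = \<zero>\<^bsub>R\<^esub>"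
    and cocycle_identity: "\<lbrakk>x \<in> carrier L; y \<in> carrier L; z \<in> carrier L\<rbrakk> \<Longrightarrow>
      \<sigma> (bracket x y) z \<oplus>\<^bsub>R\<^esub> \<sigma> (bracket y z) x \<oplus>\<^bsub>R\<^esub> \<sigma> (bracket z x) y = \<zero>\<^bsub>R\<^esub>"

locale poisson_algebra = algebra R A + lie_algebra R A pb
  for R :: "('r, 'k) ring_scheme" (structure)
    and A :: "('r, 'a, 'm) module_scheme" (structure) and pb +
  assumes leibniz: "\<lbrakk>a \<in> carrier A; b \<in> carrier A; c \<in> carrier A\<rbrakk> \<Longrightarrow>
    pb (a \<otimes>\<^bsub>A\<^esub> b) c = a \<otimes>\<^bsub>A\<^esub> pb b c \<oplus>\<^bsub>A\<^esub> b \<otimes>\<^bsub>A\<^esub> pb a c"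

text \<open>The data \<open>(U, \<alpha>, \<beta>)\<close> of a Poisson enveloping algebra without the universal property.\<close>

definition poisson_triple ::
  "('r, 'k) ring_scheme \<Rightarrow> ('r, 'a, 'm) module_scheme \<Rightarrow> ('a \<Rightarrow> 'a \<Rightarrow> 'a)
    \<Rightarrow> ('r, 'u, 'n) module_scheme \<Rightarrow> ('a \<Rightarrow> 'u) \<Rightarrow> ('a \<Rightarrow> 'u) \<Rightarrow> bool"
  where "poisson_triple R A pb U \<alpha> \<beta> \<longleftrightarrow>
    assoc_algebra R U \<and>
    \<alpha> \<in> alg_homs R A U \<and>
    \<beta> \<in> lie_homs R A pb U (commutator U) \<and>
    (\<forall>a\<in>carrier A. \<forall>b\<in>carrier A.
       \<alpha> (pb a b) = \<alpha> a \<otimes>\<^bsub>U\<^esub> \<beta> b \<ominus>\<^bsub>U\<^esub> \<beta> b \<otimes>\<^bsub>U\<^esub> \<alpha> a \<and>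
       \<beta> (a \<otimes>\<^bsub>A\<^esub> b) = \<alpha> a \<otimes>\<^bsub>U\<^esub> \<beta> b \<oplus>\<^bsub>U\<^esub> \<alpha> b \<otimes>\<^bsub>U\<^esub> \<beta> a)"

text \<open>HOL cannot quantify over types inside a formula, so the type \<open>'v\<close> of the elements of the test
  algebras \<open>V\<close> is a parameter, passed as \<open>TYPE('v)\<close>. A statement in which \<open>'v\<close> is a free type
  variable asserts the universal property with respect to test algebras over every type.
  The condition \<open>\<gamma> \<in> extensional (carrier U)\<close> only fixes the irrelevant values of \<open>\<gamma>\<close> outside the
  carrier, so that uniqueness means uniqueness on \<open>carrier U\<close>.\<close>

definition poisson_enveloping_algebra ::
  "'v itself \<Rightarrow> ('r, 'k) ring_scheme \<Rightarrow> ('r, 'a, 'm) module_scheme \<Rightarrow> ('a \<Rightarrow> 'a \<Rightarrow> 'a)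
    \<Rightarrow> ('r, 'u, 'n) module_scheme \<Rightarrow> ('a \<Rightarrow> 'u) \<Rightarrow> ('a \<Rightarrow> 'u) \<Rightarrow> bool"
  where "poisson_enveloping_algebra _ R A pb U \<alpha> \<beta> \<longleftrightarrow>
    poisson_algebra R A pb \<and>
    poisson_triple R A pb U \<alpha> \<beta> \<and>
    (\<forall>(V :: ('r, 'v) module) \<alpha>' \<beta>'. poisson_triple R A pb V \<alpha>' \<beta>' \<longrightarrow>
       (\<exists>!\<gamma>. \<gamma> \<in> alg_homs R U V \<and> \<gamma> \<in> extensional (carrier U) \<and>
          (\<forall>a\<in>carrier A. \<gamma> (\<alpha> a) = \<alpha>' a) \<and> (\<forall>a\<in>carrier A. \<gamma> (\<beta> a) = \<beta>' a)))"

definition biderivations :: "('r, 'k) ring_scheme \<Rightarrow> ('r, 'a, 'm) module_scheme \<Rightarrow> ('a \<Rightarrow> 'a \<Rightarrow> 'a) set"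
  where "biderivations R A =
    {p \<in> bilinear_maps R A A.
      \<forall>a\<in>carrier A. \<forall>b\<in>carrier A. \<forall>c\<in>carrier A.
        p (a \<otimes>\<^bsub>A\<^esub> b) c = a \<otimes>\<^bsub>A\<^esub> p b c \<oplus>\<^bsub>A\<^esub> b \<otimes>\<^bsub>A\<^esub> p a c \<and>
        p a (b \<otimes>\<^bsub>A\<^esub> c) = b \<otimes>\<^bsub>A\<^esub> p a c \<oplus>\<^bsub>A\<^esub> c \<otimes>\<^bsub>A\<^esub> p a b}"

text \<open>Maps introduced below as ``the unique map with ...'' are taken in an extensional function space
  so that they are unique as HOL functions and not merely on carriers.\<close>

definition sym_bracket ::
  "('r, 'k) ring_scheme \<Rightarrow> ('r, 'a, 'm) module_scheme \<Rightarrow> ('a \<Rightarrow> 'a \<Rightarrow> 'a) \<Rightarrow> ('a \<Rightarrow> 'a \<Rightarrow> 'r)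
    \<Rightarrow> ('a list \<Rightarrow> 'r) set set \<Rightarrow> ('a list \<Rightarrow> 'r) set set \<Rightarrow> ('a list \<Rightarrow> 'r) set set"
  where "sym_bracket R L br \<sigma> = (let S = sym_algebra R L; s = sym_inj R L in
    THE p. p \<in> carrier S \<rightarrow>\<^sub>E carrier S \<rightarrow>\<^sub>E carrier S \<and>
      p \<in> biderivations R S \<and>
      (\<forall>x\<in>carrier L. \<forall>y\<in>carrier L. p (s x) (s y) = s (br x y) \<oplus>\<^bsub>S\<^esub> \<sigma> x y \<odot>\<^bsub>S\<^esub> \<one>\<^bsub>S\<^esub>))"

text \<open>A pair \<open>(a, b)\<close> stands for \<open>a\<^sup>0 + b\<^sup>1\<close>. The fields \<open>mult\<close> and \<open>one\<close> of a
  \<^type>\<open>module_scheme\<close> record play no role for modules.\<close>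

definition double_module :: "('r, 'a, 'm) module_scheme \<Rightarrow> ('r, 'a \<times> 'a) module"
  where "double_module L =
    \<lparr>carrier = carrier L \<times> carrier L, monoid.mult = undefined, monoid.one = undefined,
     ring.zero = (\<zero>\<^bsub>L\<^esub>, \<zero>\<^bsub>L\<^esub>),
     ring.add = (\<lambda>(a, b) (c, d). (a \<oplus>\<^bsub>L\<^esub> c, b \<oplus>\<^bsub>L\<^esub> d)),
     smult = (\<lambda>r (a, b). (r \<odot>\<^bsub>L\<^esub> a, r \<odot>\<^bsub>L\<^esub> b))\<rparr>"

definition in0 :: "('r, 'a, 'm) module_scheme \<Rightarrow> 'a \<Rightarrow> 'a \<times> 'a"
  where "in0 L x = (x, \<zero>\<^bsub>L\<^esub>)"

definition in1 :: "('r, 'a, 'm) module_scheme \<Rightarrow> 'a \<Rightarrow> 'a \<times> 'a"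
  where "in1 L x = (\<zero>\<^bsub>L\<^esub>, x)"

text \<open>Bilinear extension of \<open>[y\<^sup>0, z\<^sup>0] = 0\<close>, \<open>[y\<^sup>0, z\<^sup>1] = [y, z]\<^sup>0\<close>, \<open>[y\<^sup>1, z\<^sup>1] = [y, z]\<^sup>1\<close>,
  where \<open>[y\<^sup>1, z\<^sup>0] = - [z, y]\<^sup>0 = [y, z]\<^sup>0\<close> by antisymmetry.\<close>

definition double_bracket ::
  "('r, 'a, 'm) module_scheme \<Rightarrow> ('a \<Rightarrow> 'a \<Rightarrow> 'a) \<Rightarrow> 'a \<times> 'a \<Rightarrow> 'a \<times> 'a \<Rightarrow> 'a \<times> 'a"
  where "double_bracket L br = (\<lambda>(a, b) (c, d). (br a d \<oplus>\<^bsub>L\<^esub> br b c, br b d))"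

definition double_cocycle ::
  "('r, 'k) ring_scheme \<Rightarrow> ('a \<Rightarrow> 'a \<Rightarrow> 'r) \<Rightarrow> 'a \<times> 'a \<Rightarrow> 'a \<times> 'a \<Rightarrow> 'r"
  where "double_cocycle R \<sigma> = (\<lambda>(a, b) (c, d). \<sigma> a d \<oplus>\<^bsub>R\<^esub> \<sigma> b c)"

definition sridharan_ideal ::
  "('r, 'k) ring_scheme \<Rightarrow> ('r, 'a, 'm) module_scheme \<Rightarrow> ('a \<Rightarrow> 'a \<Rightarrow> 'a) \<Rightarrow> ('a \<Rightarrow> 'a \<Rightarrow> 'r)
    \<Rightarrow> ('a list \<Rightarrow> 'r) set set"
  where "sridharan_ideal R L br \<sigma> = (let T = tensor_algebra R L; t = tensor_inj R L in
    genideal T {t x \<otimes>\<^bsub>T\<^esub> t y \<ominus>\<^bsub>T\<^esub> t y \<otimes>\<^bsub>T\<^esub> t x \<ominus>\<^bsub>T\<^esub> t (br x y) \<ominus>\<^bsub>T\<^esub> \<sigma> x y \<odot>\<^bsub>T\<^esub> \<one>\<^bsub>T\<^esub>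
      |x y. x \<in> carrier L \<and> y \<in> carrier L})"

definition modified_enveloping_algebra ::
  "('r, 'k) ring_scheme \<Rightarrow> ('r, 'a, 'm) module_scheme \<Rightarrow> ('a \<Rightarrow> 'a \<Rightarrow> 'a) \<Rightarrow> ('a \<Rightarrow> 'a \<Rightarrow> 'r)
    \<Rightarrow> ('r, ('a list \<Rightarrow> 'r) set set) module"
  where "modified_enveloping_algebra R L br \<sigma> =
    quotient_algebra (tensor_algebra R L) (sridharan_ideal R L br \<sigma>)"

definition modified_enveloping_map ::
  "('r, 'k) ring_scheme \<Rightarrow> ('r, 'a, 'm) module_scheme \<Rightarrow> ('a \<Rightarrow> 'a \<Rightarrow> 'a) \<Rightarrow> ('a \<Rightarrow> 'a \<Rightarrow> 'r)
    \<Rightarrow> 'a \<Rightarrow> ('a list \<Rightarrow> 'r) set set"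
  where "modified_enveloping_map R L br \<sigma> x =
    sridharan_ideal R L br \<sigma> +>\<^bsub>tensor_algebra R L\<^esub> tensor_inj R L x"

abbreviation double_enveloping_algebra
  where "double_enveloping_algebra R L br \<sigma> \<equiv>
    modified_enveloping_algebra R (double_module L) (double_bracket L br) (double_cocycle R \<sigma>)"

abbreviation double_enveloping_map
  where "double_enveloping_map R L br \<sigma> \<equiv>
    modified_enveloping_map R (double_module L) (double_bracket L br) (double_cocycle R \<sigma>)"

definition alpha_derivations ::
  "('r, 'k) ring_scheme \<Rightarrow> ('r, 'a, 'm) module_scheme \<Rightarrow> ('r, 'u, 'n) module_scheme
    \<Rightarrow> ('a \<Rightarrow> 'u) \<Rightarrow> ('a \<Rightarrow> 'u) set"
  where "alpha_derivations R A U \<alpha> =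
    {\<beta> \<in> linear_maps R A U.
      \<forall>a\<in>carrier A. \<forall>b\<in>carrier A. \<beta> (a \<otimes>\<^bsub>A\<^esub> b) = \<alpha> a \<otimes>\<^bsub>U\<^esub> \<beta> b \<oplus>\<^bsub>U\<^esub> \<alpha> b \<otimes>\<^bsub>U\<^esub> \<beta> a}"

definition alpha_map ::
  "('r, 'k) ring_scheme \<Rightarrow> ('r, 'a, 'm) module_scheme \<Rightarrow> ('a \<Rightarrow> 'a \<Rightarrow> 'a) \<Rightarrow> ('a \<Rightarrow> 'a \<Rightarrow> 'r)
    \<Rightarrow> ('a list \<Rightarrow> 'r) set set \<Rightarrow> (('a \<times> 'a) list \<Rightarrow> 'r) set set"
  where "alpha_map R L br \<sigma> =
    (let S = sym_algebra R L; U = double_enveloping_algebra R L br \<sigma> in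
     THE \<alpha>. \<alpha> \<in> alg_homs R S U \<and> \<alpha> \<in> extensional (carrier S) \<and>
       (\<forall>x\<in>carrier L. \<alpha> (sym_inj R L x) = double_enveloping_map R L br \<sigma> (in0 L x)))"

definition beta_map ::
  "('r, 'k) ring_scheme \<Rightarrow> ('r, 'a, 'm) module_scheme \<Rightarrow> ('a \<Rightarrow> 'a \<Rightarrow> 'a) \<Rightarrow> ('a \<Rightarrow> 'a \<Rightarrow> 'r)
    \<Rightarrow> ('a list \<Rightarrow> 'r) set set \<Rightarrow> (('a \<times> 'a) list \<Rightarrow> 'r) set set"
  where "beta_map R L br \<sigma> =
    (let S = sym_algebra R L; U = double_enveloping_algebra R L br \<sigma> in
     THE \<beta>. \<beta> \<in> alpha_derivations R S U (alpha_map R L br \<sigma>) \<and> \<beta> \<in> extensional (carrier S) \<and>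
       (\<forall>x\<in>carrier L. \<beta> (sym_inj R L x) = double_enveloping_map R L br \<sigma> (in1 L x)))"

end

theory Submission
  imports Defs
begin

text \<open>
  Write \<open>S\<close> for the symmetric algebra, \<open>U\<close> for the enveloping algebra of the double, \<open>s\<close> and
  \<open>\<iota>\<close> for the canonical maps into them. Everything rests on one principle: an algebra morphism is
  determined by its values on generators, a derivation along a morphism likewise, and each of them
  exists as soon as its values on generators respect the defining relations.

  For algebra morphisms this principle comes from the presentations. The tensor algebra is a quotient
  of the free algebra, and both \<open>S\<close> and \<open>U\<close> are quotients of tensor algebras by relations
  \<open>t x t y - t y t x = t [x, y] + \<sigma>(x, y)\<close>, with zero bracket and zero cocycle in the case of \<open>S\<close>. So
  linear maps that satisfy these relations extend uniquely (\<open>enveloping_lift\<close>, \<open>sym_lift\<close>).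
  Derivations are reduced to morphisms: a derivation \<open>\<beta>\<close> along \<open>\<alpha> : S \<rightarrow> U\<close> is the second component
  of a morphism \<open>a \<mapsto> (a, \<beta> a)\<close> from \<open>S\<close> to the square-zero extension of \<open>S\<close> by \<open>U\<close>
  (\<open>sym_derivation_exists\<close>).

  The Poisson bracket of \<open>S\<close> is obtained by extending \<open>(x, y) \<mapsto> [x, y] + \<sigma>(x, y)\<close> to a derivation
  first in one argument and then in the other. Failure of antisymmetry, of alternation and of the
  Jacobi identity are expressions for which vanishing on generators implies vanishing everywhere
  (\<open>poisson_algebra_from_generators\<close>), and on generators they vanish because \<open>[\<cdot>, \<cdot>]\<close> is a Lie
  bracket and \<open>\<sigma>\<close> is a cocycle. In the same way the two compatibility conditions between the
  bracket and a pair \<open>(\<alpha>, \<beta>)\<close> need only be tested on generators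
  (\<open>poisson_triple_from_generators\<close>). For the pair \<open>(\<alpha>', \<beta>')\<close> of the theorem they become the
  relations \<open>[x\<^sup>0, y\<^sup>1] = [x, y]\<^sup>0 + \<sigma>(x, y)\<close> and \<open>[x\<^sup>1, y\<^sup>1] = [x, y]\<^sup>1\<close> of \<open>U\<close>.

  For the universal property, a Poisson triple \<open>(V, \<alpha>, \<beta>)\<close> yields the linear map
  \<open>x\<^sup>0 + y\<^sup>1 \<mapsto> \<alpha>(s x) + \<beta>(s y)\<close> from the double to \<open>V\<close>. The axioms of a Poisson triple, evaluated
  on generators of \<open>S\<close>, are exactly the relations of \<open>U\<close>, so this map extends to \<open>\<gamma> : U \<rightarrow> V\<close>. Then
  \<open>\<gamma> \<circ> \<alpha>' = \<alpha>\<close> and \<open>\<gamma> \<circ> \<beta>' = \<beta>\<close> since both sides are morphisms, respectively derivations along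
  \<open>\<alpha>\<close>, that agree on generators; and \<open>\<gamma>\<close> is unique because the elements \<open>\<iota>(x\<^sup>0)\<close> and \<open>\<iota>(y\<^sup>1)\<close>
  generate \<open>U\<close>.
\<close>

section \<open>Generating sets of associative algebras\<close>

lemma assoc_algebraD:
  assumes "assoc_algebra R A"
  shows "cring R" "module R A" "ring A"
  using assms by (auto simp: assoc_algebra_def module_def)

lemma assoc_algebraI:
  assumes "module R A" "ring A"
    and "\<And>r x y. \<lbrakk>r \<in> carrier R; x \<in> carrier A; y \<in> carrier A\<rbrakk>
        \<Longrightarrow> (r \<odot>\<^bsub>A\<^esub> x) \<otimes>\<^bsub>A\<^esub> y = r \<odot>\<^bsub>A\<^esub> (x \<otimes>\<^bsub>A\<^esub> y)"
    and "\<And>r x y. \<lbrakk>r \<in> carrier R; x \<in> carrier A; y \<in> carrier A\<rbrakk>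
        \<Longrightarrow> x \<otimes>\<^bsub>A\<^esub> (r \<odot>\<^bsub>A\<^esub> y) = r \<odot>\<^bsub>A\<^esub> (x \<otimes>\<^bsub>A\<^esub> y)"
  shows "assoc_algebra R A"
  using assms by (intro assoc_algebra.intro assoc_algebra_axioms.intro) auto

lemma linear_mapsI:
  assumes "\<And>x. x \<in> carrier M \<Longrightarrow> f x \<in> carrier N"
    and "\<And>x y. \<lbrakk>x \<in> carrier M; y \<in> carrier M\<rbrakk> \<Longrightarrow> f (x \<oplus>\<^bsub>M\<^esub> y) = f x \<oplus>\<^bsub>N\<^esub> f y"
    and "\<And>r x. \<lbrakk>r \<in> carrier R; x \<in> carrier M\<rbrakk> \<Longrightarrow> f (r \<odot>\<^bsub>M\<^esub> x) = r \<odot>\<^bsub>N\<^esub> f x"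
  shows "f \<in> linear_maps R M N"
  using assms by (auto simp: linear_maps_def)

lemma linear_mapsD:
  assumes "f \<in> linear_maps R M N"
  shows "x \<in> carrier M \<Longrightarrow> f x \<in> carrier N"
    and "\<lbrakk>x \<in> carrier M; y \<in> carrier M\<rbrakk> \<Longrightarrow> f (x \<oplus>\<^bsub>M\<^esub> y) = f x \<oplus>\<^bsub>N\<^esub> f y"
    and "\<lbrakk>r \<in> carrier R; x \<in> carrier M\<rbrakk> \<Longrightarrow> f (r \<odot>\<^bsub>M\<^esub> x) = r \<odot>\<^bsub>N\<^esub> f x"
  using assms by (auto simp: linear_maps_def)

lemma bilinear_mapsD:
  assumes "f \<in> bilinear_maps R M N" and "x \<in> carrier M"
  shows "f x \<in> linear_maps R M N" "(\<lambda>y. f y x) \<in> linear_maps R M N"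
  using assms by (auto simp: bilinear_maps_def)

text \<open>Polarisation of \<open>f (x + y) (x + y) = 0\<close>.\<close>

lemma bilinear_maps_skew:
  assumes M: "module R M" and N: "module R N" and f: "f \<in> bilinear_maps R M N"
    and alt: "\<And>x. x \<in> carrier M \<Longrightarrow> f x x = \<zero>\<^bsub>N\<^esub>"
    and x: "x \<in> carrier M" and y: "y \<in> carrier M"
  shows "f x y \<oplus>\<^bsub>N\<^esub> f y x = \<zero>\<^bsub>N\<^esub>"
proof -
  interpret M: module R M by fact
  interpret N: module R N by fact
  note bl = bilinear_mapsD[OF f]
  have "\<zero>\<^bsub>N\<^esub> = f (x \<oplus>\<^bsub>M\<^esub> y) (x \<oplus>\<^bsub>M\<^esub> y)"
    using x y by (simp add: alt)
  also have "\<dots> = f x (x \<oplus>\<^bsub>M\<^esub> y) \<oplus>\<^bsub>N\<^esub> f y (x \<oplus>\<^bsub>M\<^esub> y)"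
    using linear_mapsD(2)[OF bl(2)] x y by simp
  also have "\<dots> = f x y \<oplus>\<^bsub>N\<^esub> f y x"
    using linear_mapsD(2)[OF bl(1)] x y linear_mapsD(1)[OF bl(1)] by (simp add: alt)
  finally show ?thesis ..
qed

lemma alg_homsI:
  assumes "f \<in> linear_maps R A B"
    and "\<And>x y. \<lbrakk>x \<in> carrier A; y \<in> carrier A\<rbrakk> \<Longrightarrow> f (x \<otimes>\<^bsub>A\<^esub> y) = f x \<otimes>\<^bsub>B\<^esub> f y"
    and "f \<one>\<^bsub>A\<^esub> = \<one>\<^bsub>B\<^esub>"
  shows "f \<in> alg_homs R A B"
  using assms by (auto simp: alg_homs_def linear_maps_def ring_hom_def)

lemma alg_homsD:
  assumes "f \<in> alg_homs R A B"
  shows "f \<in> linear_maps R A B"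
    and "\<lbrakk>x \<in> carrier A; y \<in> carrier A\<rbrakk> \<Longrightarrow> f (x \<otimes>\<^bsub>A\<^esub> y) = f x \<otimes>\<^bsub>B\<^esub> f y"
    and "f \<one>\<^bsub>A\<^esub> = \<one>\<^bsub>B\<^esub>"
  using assms by (auto simp: alg_homs_def linear_maps_def ring_hom_def)

lemma linear_maps_minus:
  assumes M: "module R M" and N: "module R N" and f: "f \<in> linear_maps R M N"
  shows "f \<zero>\<^bsub>M\<^esub> = \<zero>\<^bsub>N\<^esub>"
    and "x \<in> carrier M \<Longrightarrow> f (\<ominus>\<^bsub>M\<^esub> x) = \<ominus>\<^bsub>N\<^esub> f x"
    and "\<lbrakk>x \<in> carrier M; y \<in> carrier M\<rbrakk> \<Longrightarrow> f (x \<ominus>\<^bsub>M\<^esub> y) = f x \<ominus>\<^bsub>N\<^esub> f y"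
proof -
  interpret M: module R M by fact
  interpret N: module R N by fact
  note f = linear_mapsD[OF f]
  have "f (\<zero>\<^bsub>R\<^esub> \<odot>\<^bsub>M\<^esub> \<zero>\<^bsub>M\<^esub>) = \<zero>\<^bsub>R\<^esub> \<odot>\<^bsub>N\<^esub> f \<zero>\<^bsub>M\<^esub>"
    by (rule f) simp_all
  thus zero: "f \<zero>\<^bsub>M\<^esub> = \<zero>\<^bsub>N\<^esub>"
    using f(1)[of "\<zero>\<^bsub>M\<^esub>"] by simp
  show neg: "f (\<ominus>\<^bsub>M\<^esub> u) = \<ominus>\<^bsub>N\<^esub> f u" if "u \<in> carrier M" for u
  proof -
    have "f (\<ominus>\<^bsub>M\<^esub> u) \<oplus>\<^bsub>N\<^esub> f u = \<zero>\<^bsub>N\<^esub>"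
      using that f(2)[of "\<ominus>\<^bsub>M\<^esub> u" u] zero by (simp add: M.M.l_neg)
    thus ?thesis
      using that f(1) N.M.minus_equality[of "f (\<ominus>\<^bsub>M\<^esub> u)" "f u"] by simp
  qed
  show "f (x \<ominus>\<^bsub>M\<^esub> y) = f x \<ominus>\<^bsub>N\<^esub> f y" if "x \<in> carrier M" "y \<in> carrier M"
    using that neg f(2)[of x "\<ominus>\<^bsub>M\<^esub> y"] by (simp add: a_minus_def)
qed

text \<open>Closure under additive inverses is implied by closure under scalars, as \<open>- a = (- 1) a\<close>.\<close>

definition generates ::
  "('r, 'k) ring_scheme \<Rightarrow> ('r, 'a, 'm) module_scheme \<Rightarrow> 'a set \<Rightarrow> bool"
  where "generates R A G \<longleftrightarrow> G \<subseteq> carrier A \<and>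
    (\<forall>B. G \<subseteq> B \<and> B \<subseteq> carrier A \<and> \<one>\<^bsub>A\<^esub> \<in> B \<and>
      (\<forall>a\<in>B. \<forall>b\<in>B. a \<oplus>\<^bsub>A\<^esub> b \<in> B \<and> a \<otimes>\<^bsub>A\<^esub> b \<in> B) \<and>
      (\<forall>r\<in>carrier R. \<forall>a\<in>B. r \<odot>\<^bsub>A\<^esub> a \<in> B) \<longrightarrow> B = carrier A)"

lemma generates_induct [consumes 3, case_names one gen add mult smult]:
  assumes gen: "generates R A G" and A: "assoc_algebra R A" and a: "a \<in> carrier A"
    and "P \<one>\<^bsub>A\<^esub>"
    and "\<And>x. x \<in> G \<Longrightarrow> P x"
    and "\<And>a b. \<lbrakk>a \<in> carrier A; b \<in> carrier A; P a; P b\<rbrakk> \<Longrightarrow> P (a \<oplus>\<^bsub>A\<^esub> b)"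
    and "\<And>a b. \<lbrakk>a \<in> carrier A; b \<in> carrier A; P a; P b\<rbrakk> \<Longrightarrow> P (a \<otimes>\<^bsub>A\<^esub> b)"
    and "\<And>r a. \<lbrakk>r \<in> carrier R; a \<in> carrier A; P a\<rbrakk> \<Longrightarrow> P (r \<odot>\<^bsub>A\<^esub> a)"
  shows "P a"
proof -
  interpret A: module R A using A by (rule assoc_algebraD)
  interpret A: ring A using A by (rule assoc_algebraD)
  let ?B = "{a \<in> carrier A. P a}"
  have "G \<subseteq> ?B \<and> ?B \<subseteq> carrier A \<and> \<one>\<^bsub>A\<^esub> \<in> ?B \<and>
      (\<forall>a\<in>?B. \<forall>b\<in>?B. a \<oplus>\<^bsub>A\<^esub> b \<in> ?B \<and> a \<otimes>\<^bsub>A\<^esub> b \<in> ?B) \<and>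
      (\<forall>r\<in>carrier R. \<forall>a\<in>?B. r \<odot>\<^bsub>A\<^esub> a \<in> ?B)"
    using gen assms(4-) by (auto simp: generates_def)
  hence "?B = carrier A"
    using gen unfolding generates_def by blast
  thus ?thesis using a by blast
qed

lemma alg_homs_eq_on_generators:
  assumes gen: "generates R A G" and A: "assoc_algebra R A"
    and f: "f \<in> alg_homs R A V" and g: "g \<in> alg_homs R A V"
    and eq: "\<And>x. x \<in> G \<Longrightarrow> f x = g x" and a: "a \<in> carrier A"
  shows "f a = g a"
  using gen A a
proof (induction rule: generates_induct)
  case one show ?case using alg_homsD(3)[OF f] alg_homsD(3)[OF g] by simp
next
  case (gen x) thus ?case by (rule eq)
qed (simp_all add: alg_homsD(2)[OF f] alg_homsD(2)[OF g]
      linear_mapsD(2,3)[OF alg_homsD(1)[OF f]] linear_mapsD(2,3)[OF alg_homsD(1)[OF g]])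

lemma generates_surjective_image:
  assumes gen: "generates R A G" and A: "assoc_algebra R A"
    and h: "h \<in> alg_homs R A B" and surj: "h ` carrier A = carrier B"
  shows "generates R B (h ` G)"
  unfolding generates_def
proof (intro conjI allI impI)
  show "h ` G \<subseteq> carrier B"
    using gen surj by (auto simp: generates_def)
  fix C
  assume C: "h ` G \<subseteq> C \<and> C \<subseteq> carrier B \<and> \<one>\<^bsub>B\<^esub> \<in> C \<and>
      (\<forall>a\<in>C. \<forall>b\<in>C. a \<oplus>\<^bsub>B\<^esub> b \<in> C \<and> a \<otimes>\<^bsub>B\<^esub> b \<in> C) \<and>
      (\<forall>r\<in>carrier R. \<forall>a\<in>C. r \<odot>\<^bsub>B\<^esub> a \<in> C)"
  have im: "h a \<in> C" if "a \<in> carrier A" for a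
    using gen A that
  proof (induction rule: generates_induct)
    case one show ?case using alg_homsD(3)[OF h] C by simp
  next
    case (gen x) thus ?case using C by blast
  qed (use C in \<open>simp_all add: alg_homsD(2)[OF h] linear_mapsD(2,3)[OF alg_homsD(1)[OF h]]\<close>)
  have "h ` carrier A \<subseteq> C"
    using im by (rule image_subsetI)
  moreover have "C \<subseteq> carrier B" using C by (elim conjE)
  ultimately show "C = carrier B"
    unfolding surj by (rule subset_antisym[rotated])
qed

text \<open>The centraliser of an element is a subalgebra. The centraliser of a generator therefore is the
  whole algebra, and then so is that of an arbitrary element, which now contains the generators.\<close>

lemma generates_commute:
  assumes gen: "generates R A Y" and A: "assoc_algebra R A"
    and comm: "\<And>x y. \<lbrakk>x \<in> Y; y \<in> Y\<rbrakk> \<Longrightarrow> x \<otimes>\<^bsub>A\<^esub> y = y \<otimes>\<^bsub>A\<^esub> x"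
    and a: "a \<in> carrier A" and b: "b \<in> carrier A"
  shows "a \<otimes>\<^bsub>A\<^esub> b = b \<otimes>\<^bsub>A\<^esub> a"
proof -
  interpret A: assoc_algebra R A by fact
  have Y: "y \<in> carrier A" if "y \<in> Y" for y using gen that by (auto simp: generates_def)
  note simps = A.l_distr A.r_distr A.smult_mult_left A.smult_mult_right
  have 1: "a \<otimes>\<^bsub>A\<^esub> y = y \<otimes>\<^bsub>A\<^esub> a" if y: "y \<in> Y" and "a \<in> carrier A" for a y
    using gen A that(2)
  proof (induction rule: generates_induct)
    case (mult a b)
    thus ?case using Y[OF y] by (metis A.m_assoc)
  qed (use Y[OF y] comm y in \<open>simp_all add: simps\<close>)
  show ?thesis
    using gen A b
  proof (induction rule: generates_induct)
    case (mult b c)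
    thus ?case using a by (metis A.m_assoc)
  qed (use a 1 in \<open>simp_all add: simps\<close>)
qed

section \<open>The free associative algebra\<close>

context cring
begin

text \<open>Convolution obeys a recursion on the word, in which \<open>\<lambda>v. f (x # v)\<close> is the left derivative of
  \<open>f\<close> with respect to the letter \<open>x\<close>. This recursion replaces the manipulation of nested sums by
  induction on words. The identities are stated for noncommutative power series, so that supports
  only have to be tracked in the closure properties of the free algebra.\<close>

lemma free_mult_Nil:
  assumes "f \<in> UNIV \<rightarrow> carrier R" "g \<in> UNIV \<rightarrow> carrier R"
  shows "(f \<otimes>\<^bsub>free_algebra R E\<^esub> g) [] = f [] \<otimes> g []"
proof -
  have "f [] \<in> carrier R" "g [] \<in> carrier R" using assms by auto
  thus ?thesis by (simp add: free_algebra_def finsum_0)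
qed

lemma free_mult_Cons:
  assumes f: "f \<in> UNIV \<rightarrow> carrier R" and g: "g \<in> UNIV \<rightarrow> carrier R"
  shows "(f \<otimes>\<^bsub>free_algebra R E\<^esub> g) (x # w) =
    f [] \<otimes> g (x # w) \<oplus> ((\<lambda>v. f (x # v)) \<otimes>\<^bsub>free_algebra R E\<^esub> g) w"
proof -
  have c: "\<And>v. f v \<in> carrier R" "\<And>v. g v \<in> carrier R" using f g by auto
  let ?t = "\<lambda>i. f (take i (x # w)) \<otimes> g (drop i (x # w))"
  have "(\<Oplus>i\<in>{..Suc (length w)}. ?t i) = (\<Oplus>i\<in>{..length w}. ?t (Suc i)) \<oplus> ?t 0"
    by (rule finsum_Suc2) (simp add: c)
  thus ?thesis
    by (simp add: free_algebra_def a_comm finsum_closed c)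
qed

lemma free_mult_closed_UNIV:
  assumes "f \<in> UNIV \<rightarrow> carrier R" "g \<in> UNIV \<rightarrow> carrier R"
  shows "(f \<otimes>\<^bsub>free_algebra R E\<^esub> g) w \<in> carrier R"
proof -
  have "\<And>v. f v \<in> carrier R" "\<And>v. g v \<in> carrier R" using assms by auto
  thus ?thesis by (simp add: free_algebra_def finsum_closed)
qed

lemma free_mult_add_left:
  assumes f: "f \<in> UNIV \<rightarrow> carrier R" and f': "f' \<in> UNIV \<rightarrow> carrier R"
    and g: "g \<in> UNIV \<rightarrow> carrier R"
  shows "((\<lambda>v. f v \<oplus> f' v) \<otimes>\<^bsub>free_algebra R E\<^esub> g) w =
    (f \<otimes>\<^bsub>free_algebra R E\<^esub> g) w \<oplus> (f' \<otimes>\<^bsub>free_algebra R E\<^esub> g) w"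
proof -
  have c: "\<And>v. f v \<in> carrier R" "\<And>v. f' v \<in> carrier R" "\<And>v. g v \<in> carrier R"
    using f f' g by auto
  show ?thesis
    by (simp add: free_algebra_def c l_distr finsum_addf Pi_def)
qed

lemma free_mult_add_right:
  assumes f: "f \<in> UNIV \<rightarrow> carrier R" and g': "g' \<in> UNIV \<rightarrow> carrier R"
    and g: "g \<in> UNIV \<rightarrow> carrier R"
  shows "(f \<otimes>\<^bsub>free_algebra R E\<^esub> (\<lambda>v. g v \<oplus> g' v)) w =
    (f \<otimes>\<^bsub>free_algebra R E\<^esub> g) w \<oplus> (f \<otimes>\<^bsub>free_algebra R E\<^esub> g') w"
proof -
  have c: "\<And>v. f v \<in> carrier R" "\<And>v. g' v \<in> carrier R" "\<And>v. g v \<in> carrier R"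
    using f g' g by auto
  show ?thesis
    by (simp add: free_algebra_def c r_distr finsum_addf Pi_def)
qed

lemma free_mult_smult_left:
  assumes r: "r \<in> carrier R" and f: "f \<in> UNIV \<rightarrow> carrier R" and g: "g \<in> UNIV \<rightarrow> carrier R"
  shows "((\<lambda>v. r \<otimes> f v) \<otimes>\<^bsub>free_algebra R E\<^esub> g) w = r \<otimes> (f \<otimes>\<^bsub>free_algebra R E\<^esub> g) w"
proof -
  have c: "\<And>v. f v \<in> carrier R" "\<And>v. g v \<in> carrier R"
    using f g by auto
  show ?thesis
    by (simp add: free_algebra_def c r m_assoc finsum_rdistr Pi_def)
qed

lemma free_mult_smult_right:
  assumes r: "r \<in> carrier R" and f: "f \<in> UNIV \<rightarrow> carrier R" and g: "g \<in> UNIV \<rightarrow> carrier R"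
  shows "(f \<otimes>\<^bsub>free_algebra R E\<^esub> (\<lambda>v. r \<otimes> g v)) w = r \<otimes> (f \<otimes>\<^bsub>free_algebra R E\<^esub> g) w"
proof -
  have c: "\<And>v. f v \<in> carrier R" "\<And>v. g v \<in> carrier R"
    using f g by auto
  show ?thesis
    by (simp add: free_algebra_def c r m_lcomm finsum_rdistr Pi_def)
qed

text \<open>The left derivative of a product is \<open>(f g)' = f [] g' + f' g\<close>; so associativity at the word
  \<open>x # w\<close> reduces to associativity for \<open>f'\<close>, \<open>g\<close> and \<open>h\<close> at the shorter word \<open>w\<close>.\<close>

lemma free_mult_assoc:
  assumes "f \<in> UNIV \<rightarrow> carrier R" "g \<in> UNIV \<rightarrow> carrier R" "h \<in> UNIV \<rightarrow> carrier R"
  shows "((f \<otimes>\<^bsub>free_algebra R E\<^esub> g) \<otimes>\<^bsub>free_algebra R E\<^esub> h) w =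
    (f \<otimes>\<^bsub>free_algebra R E\<^esub> (g \<otimes>\<^bsub>free_algebra R E\<^esub> h)) w"
  using assms
proof (induction w arbitrary: f g)
  case Nil
  note c = Nil
  have "(f \<otimes>\<^bsub>free_algebra R E\<^esub> g) \<in> UNIV \<rightarrow> carrier R" "(g \<otimes>\<^bsub>free_algebra R E\<^esub> h) \<in> UNIV \<rightarrow> carrier R"
    using c free_mult_closed_UNIV by auto
  moreover have "f [] \<in> carrier R" "g [] \<in> carrier R" "h [] \<in> carrier R"
    using c by auto
  ultimately show ?case
    using c by (simp add: free_mult_Nil m_assoc)
next
  case (Cons x w)
  note c = Cons.prems
  let ?df = "\<lambda>v. f (x # v)" and ?dg = "\<lambda>v. g (x # v)"
  have d: "?df \<in> UNIV \<rightarrow> carrier R" "?dg \<in> UNIV \<rightarrow> carrier R"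
    using c by auto
  have p: "(f \<otimes>\<^bsub>free_algebra R E\<^esub> g) \<in> UNIV \<rightarrow> carrier R" "(g \<otimes>\<^bsub>free_algebra R E\<^esub> h) \<in> UNIV \<rightarrow> carrier R"
     "(?df \<otimes>\<^bsub>free_algebra R E\<^esub> g) \<in> UNIV \<rightarrow> carrier R"
    using c d free_mult_closed_UNIV by blast+
  have e: "f [] \<in> carrier R" "g [] \<in> carrier R" "h (x # w) \<in> carrier R"
    "(\<lambda>v. f [] \<otimes> ?dg v) \<in> UNIV \<rightarrow> carrier R"
    using c by auto
  have k: "(?dg \<otimes>\<^bsub>free_algebra R E\<^esub> h) w \<in> carrier R"
     "(?df \<otimes>\<^bsub>free_algebra R E\<^esub> (g \<otimes>\<^bsub>free_algebra R E\<^esub> h)) w \<in> carrier R"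
    using c d p by (blast intro: free_mult_closed_UNIV)+
  have "((f \<otimes>\<^bsub>free_algebra R E\<^esub> g) \<otimes>\<^bsub>free_algebra R E\<^esub> h) (x # w) =
    (f [] \<otimes> g []) \<otimes> h (x # w) \<oplus>
      ((\<lambda>v. (f [] \<otimes> ?dg v) \<oplus> (?df \<otimes>\<^bsub>free_algebra R E\<^esub> g) v) \<otimes>\<^bsub>free_algebra R E\<^esub> h) w"
    by (simp add: free_mult_Cons[OF p(1) c(3)] free_mult_Nil c free_mult_Cons[OF c(1,2)])
  also have "\<dots> = (f [] \<otimes> g []) \<otimes> h (x # w) \<oplus>
      (f [] \<otimes> (?dg \<otimes>\<^bsub>free_algebra R E\<^esub> h) w \<oplus>
       (?df \<otimes>\<^bsub>free_algebra R E\<^esub> (g \<otimes>\<^bsub>free_algebra R E\<^esub> h)) w)"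
    by (simp add: free_mult_add_left[OF e(4) p(3) c(3)] free_mult_smult_left[OF e(1) d(2) c(3)]
        Cons.IH[OF d(1) c(2,3)])
  also have "\<dots> = f [] \<otimes> (g [] \<otimes> h (x # w) \<oplus> (?dg \<otimes>\<^bsub>free_algebra R E\<^esub> h) w) \<oplus>
       (?df \<otimes>\<^bsub>free_algebra R E\<^esub> (g \<otimes>\<^bsub>free_algebra R E\<^esub> h)) w"
    using e(1-3) k by (simp add: m_assoc r_distr a_assoc)
  also have "\<dots> = (f \<otimes>\<^bsub>free_algebra R E\<^esub> (g \<otimes>\<^bsub>free_algebra R E\<^esub> h)) (x # w)"
    by (simp add: free_mult_Cons[OF c(1) p(2)] free_mult_Cons[OF c(2,3)])
  finally show ?case .
qed

definition monomial :: "'w list \<Rightarrow> 'w list \<Rightarrow> 'a"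
  where "monomial w = (\<lambda>v. if v = w then \<one> else \<zero>)"

lemma letter_eq_monomial: "letter R x = monomial [x]"
  by (simp add: letter_def monomial_def)

lemma monomial_closed_UNIV: "monomial w \<in> UNIV \<rightarrow> carrier R"
  by (simp add: monomial_def)

lemma zero_mult_free:
  assumes "g \<in> UNIV \<rightarrow> carrier R"
  shows "((\<lambda>v. \<zero>) \<otimes>\<^bsub>free_algebra R E\<^esub> g) w = \<zero>"
proof -
  have "\<And>v. g v \<in> carrier R" using assms by auto
  thus ?thesis by (simp add: free_algebra_def)
qed

lemma monomial_Nil_mult:
  assumes g: "g \<in> UNIV \<rightarrow> carrier R"
  shows "(monomial [] \<otimes>\<^bsub>free_algebra R E\<^esub> g) w = g w"
proof (cases w)
  case Nil
  have "g [] \<in> carrier R" using g by auto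
  with Nil show ?thesis
    using g by (simp add: free_mult_Nil[OF monomial_closed_UNIV g]) (simp add: monomial_def)
next
  case (Cons x v)
  have "g w \<in> carrier R" using g by auto
  with Cons show ?thesis
    using g by (simp add: free_mult_Cons[OF monomial_closed_UNIV g])
      (simp add: monomial_def zero_mult_free)
qed

lemma monomial_Cons_mult:
  assumes g: "g \<in> UNIV \<rightarrow> carrier R"
  shows "(monomial (x # u) \<otimes>\<^bsub>free_algebra R E\<^esub> g) w =
    (case w of [] \<Rightarrow> \<zero> | y # v \<Rightarrow> if y = x then (monomial u \<otimes>\<^bsub>free_algebra R E\<^esub> g) v else \<zero>)"
proof (cases w)
  case Nil
  have "g [] \<in> carrier R" using g by auto
  with Nil show ?thesis
    using g by (simp add: free_mult_Nil[OF monomial_closed_UNIV g]) (simp add: monomial_def)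
next
  case (Cons y v)
  have c: "g w \<in> carrier R" using g by auto
  have "(\<lambda>v. monomial (x # u) (y # v)) = (if y = x then monomial u else (\<lambda>v. \<zero>))"
    by (auto simp: monomial_def)
  moreover have "monomial (x # u) [] = \<zero>" by (simp add: monomial_def)
  moreover have "(monomial u \<otimes>\<^bsub>free_algebra R E\<^esub> g) v \<in> carrier R"
    by (rule free_mult_closed_UNIV[OF monomial_closed_UNIV g])
  ultimately show ?thesis
    using c g Cons by (simp add: free_mult_Cons[OF monomial_closed_UNIV g] zero_mult_free)
qed

lemma monomial_mult: "monomial u \<otimes>\<^bsub>free_algebra R E\<^esub> monomial v = monomial (u @ v)"
proof
  show "(monomial u \<otimes>\<^bsub>free_algebra R E\<^esub> monomial v) w = monomial (u @ v) w" for w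
  proof (induction u arbitrary: w)
    case Nil show ?case by (simp add: monomial_Nil_mult monomial_closed_UNIV)
  next
    case (Cons x u)
    have "monomial (x # u @ v) w =
        (case w of [] \<Rightarrow> \<zero> | y # w' \<Rightarrow> if y = x then monomial (u @ v) w' else \<zero>)"
      by (cases w) (auto simp: monomial_def)
    thus ?case
      by (cases w) (simp_all add: monomial_Cons_mult[OF monomial_closed_UNIV] Cons.IH)
  qed
qed

lemma free_mult_one:
  assumes g: "g \<in> UNIV \<rightarrow> carrier R"
  shows "(g \<otimes>\<^bsub>free_algebra R E\<^esub> monomial []) w = g w"
  using g
proof (induction w arbitrary: g)
  case Nil
  have "g [] \<in> carrier R" using Nil by auto
  thus ?case using Nil by (simp add: free_mult_Nil[OF _ monomial_closed_UNIV]) (simp add: monomial_def)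
next
  case (Cons x w)
  hence d: "(\<lambda>v. g (x # v)) \<in> UNIV \<rightarrow> carrier R" by auto
  have c: "g [] \<in> carrier R" "g (x # w) \<in> carrier R" using Cons.prems by auto
  show ?case
    unfolding free_mult_Cons[OF Cons.prems monomial_closed_UNIV] Cons.IH[OF d]
    using c by (simp add: monomial_def)
qed

lemma free_carrierD:
  assumes "f \<in> carrier (free_algebra R E)"
  shows "f \<in> UNIV \<rightarrow> carrier R" "f w \<in> carrier R" "finite {w. f w \<noteq> \<zero>}" "f w \<noteq> \<zero> \<Longrightarrow> w \<in> lists E"
  using assms by (auto simp: free_algebra_def)

lemma free_carrierI:
  assumes "\<And>w. f w \<in> carrier R" "finite A" "{w. f w \<noteq> \<zero>} \<subseteq> A" "{w. f w \<noteq> \<zero>} \<subseteq> lists E"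
  shows "f \<in> carrier (free_algebra R E)"
  using assms by (auto simp: free_algebra_def intro: finite_subset)

lemma monomial_closed: "w \<in> lists E \<Longrightarrow> monomial w \<in> carrier (free_algebra R E)"
  by (rule free_carrierI[of _ "{w}"]) (auto simp: monomial_def)

lemma free_mult_closed:
  assumes f: "f \<in> carrier (free_algebra R E)" and g: "g \<in> carrier (free_algebra R E)"
  shows "f \<otimes>\<^bsub>free_algebra R E\<^esub> g \<in> carrier (free_algebra R E)"
proof -
  note F = free_carrierD[OF f] and G = free_carrierD[OF g]
  let ?W = "(\<lambda>(u, v). u @ v) ` ({u. f u \<noteq> \<zero>} \<times> {v. g v \<noteq> \<zero>})"
  have sub: "w \<in> ?W" if "(f \<otimes>\<^bsub>free_algebra R E\<^esub> g) w \<noteq> \<zero>" for w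
  proof (rule ccontr)
    assume *: "w \<notin> ?W"
    have "f (take i w) \<otimes> g (drop i w) = \<zero>" for i
    proof (rule ccontr)
      assume "f (take i w) \<otimes> g (drop i w) \<noteq> \<zero>"
      hence "f (take i w) \<noteq> \<zero>" "g (drop i w) \<noteq> \<zero>"
        using F(2) G(2) by auto
      hence "(\<lambda>(u, v). u @ v) (take i w, drop i w) \<in> ?W"
        by blast
      thus False using * by simp
    qed
    hence "(f \<otimes>\<^bsub>free_algebra R E\<^esub> g) w = \<zero>"
      by (simp add: free_algebra_def finsum_zero)
    thus False using that by blast
  qed
  show ?thesis
  proof (rule free_carrierI)
    show "(f \<otimes>\<^bsub>free_algebra R E\<^esub> g) w \<in> carrier R" for w
      using F(1) G(1) by (rule free_mult_closed_UNIV)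
    show "finite ?W" using F(3) G(3) by simp
    show "{w. (f \<otimes>\<^bsub>free_algebra R E\<^esub> g) w \<noteq> \<zero>} \<subseteq> ?W" using sub by blast
    show "{w. (f \<otimes>\<^bsub>free_algebra R E\<^esub> g) w \<noteq> \<zero>} \<subseteq> lists E"
      using sub F(4) G(4) by fastforce
  qed
qed

lemma free_add_closed:
  assumes f: "f \<in> carrier (free_algebra R E)" and g: "g \<in> carrier (free_algebra R E)"
  shows "(\<lambda>w. f w \<oplus> g w) \<in> carrier (free_algebra R E)"
proof (rule free_carrierI)
  note F = free_carrierD[OF f] and G = free_carrierD[OF g]
  show "finite ({w. f w \<noteq> \<zero>} \<union> {w. g w \<noteq> \<zero>})" using F G by simp
  show sub: "{w. f w \<oplus> g w \<noteq> \<zero>} \<subseteq> {w. f w \<noteq> \<zero>} \<union> {w. g w \<noteq> \<zero>}"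
    by (auto simp: F G)
  show "{w. f w \<oplus> g w \<noteq> \<zero>} \<subseteq> lists E"
    using sub F(4) G(4) by fastforce
qed (use free_carrierD(2)[OF f] free_carrierD(2)[OF g] in auto)

lemma free_smult_closed:
  assumes r: "r \<in> carrier R" and f: "f \<in> carrier (free_algebra R E)"
  shows "(\<lambda>w. r \<otimes> f w) \<in> carrier (free_algebra R E)"
proof (rule free_carrierI)
  note F = free_carrierD[OF f]
  show "finite {w. f w \<noteq> \<zero>}" using F by simp
  show sub: "{w. r \<otimes> f w \<noteq> \<zero>} \<subseteq> {w. f w \<noteq> \<zero>}"
    using r by auto
  show "{w. r \<otimes> f w \<noteq> \<zero>} \<subseteq> lists E"
    using sub F(4) by fastforce
qed (use free_carrierD(2)[OF f] r in auto)

lemma free_algebra_simps: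
  "\<one>\<^bsub>free_algebra R E\<^esub> = monomial []"
  "\<zero>\<^bsub>free_algebra R E\<^esub> = (\<lambda>w. \<zero>)"
  "f \<oplus>\<^bsub>free_algebra R E\<^esub> g = (\<lambda>w. f w \<oplus> g w)"
  "r \<odot>\<^bsub>free_algebra R E\<^esub> f = (\<lambda>w. r \<otimes> f w)"
  by (simp_all add: free_algebra_def monomial_def)

lemma free_algebra_assoc_algebra: "assoc_algebra R (free_algebra R E)"
proof -
  let ?F = "free_algebra R E"
  note c = free_carrierD(1)
  note cl = free_carrierD(2)
  have ab: "abelian_group ?F"
  proof (rule abelian_groupI)
    fix f assume f: "f \<in> carrier ?F"
    show "\<exists>g\<in>carrier ?F. g \<oplus>\<^bsub>?F\<^esub> f = \<zero>\<^bsub>?F\<^esub>"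
    proof
      show "(\<lambda>w. \<ominus> \<one> \<otimes> f w) \<in> carrier ?F"
        by (rule free_smult_closed) (use f in auto)
      have "\<ominus> \<one> \<otimes> f w \<oplus> f w = \<zero>" for w
        using cl[OF f] by (simp add: l_minus l_neg)
      thus "(\<lambda>w. \<ominus> \<one> \<otimes> f w) \<oplus>\<^bsub>?F\<^esub> f = \<zero>\<^bsub>?F\<^esub>"
        by (simp add: free_algebra_simps)
    qed
    show "\<zero>\<^bsub>?F\<^esub> \<oplus>\<^bsub>?F\<^esub> f = f" using cl[OF f] by (simp add: free_algebra_simps)
    fix g assume g: "g \<in> carrier ?F"
    show "f \<oplus>\<^bsub>?F\<^esub> g \<in> carrier ?F" using free_add_closed[OF f g] by (simp add: free_algebra_simps)
    show "f \<oplus>\<^bsub>?F\<^esub> g = g \<oplus>\<^bsub>?F\<^esub> f"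
      using cl[OF f] cl[OF g] by (simp add: free_algebra_simps a_comm)
    fix h assume h: "h \<in> carrier ?F"
    show "f \<oplus>\<^bsub>?F\<^esub> g \<oplus>\<^bsub>?F\<^esub> h = f \<oplus>\<^bsub>?F\<^esub> (g \<oplus>\<^bsub>?F\<^esub> h)"
      using cl[OF f] cl[OF g] cl[OF h] by (simp add: free_algebra_simps a_assoc)
  next
    show "\<zero>\<^bsub>?F\<^esub> \<in> carrier ?F" by (simp add: free_algebra_def)
  qed
  have mon: "Group.monoid ?F"
  proof (rule monoidI)
    show "\<one>\<^bsub>?F\<^esub> \<in> carrier ?F"
      by (simp add: free_algebra_simps monomial_closed)
  qed (simp_all add: free_mult_closed free_algebra_simps fun_eq_iff monomial_Nil_mult free_mult_one
      free_mult_assoc c)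
  have ri: "ring ?F"
    using ab mon
    by (rule ringI) (simp_all add: free_algebra_simps fun_eq_iff free_mult_add_left
        free_mult_add_right c)
  have mo: "module R ?F"
    by (rule moduleI[OF is_cring ab])
      (simp_all add: free_algebra_simps fun_eq_iff free_smult_closed l_distr r_distr m_assoc cl)
  show ?thesis
    using mo ri by (rule assoc_algebraI)
      (simp_all add: free_algebra_simps fun_eq_iff free_mult_smult_left free_mult_smult_right c)
qed

text \<open>The support is finite, and its words are split off one at a time.\<close>

lemma free_algebra_induct [consumes 1, case_names zero step]:
  assumes f: "f \<in> carrier (free_algebra R E)"
    and z: "P \<zero>\<^bsub>free_algebra R E\<^esub>"
    and s: "\<And>r w g. \<lbrakk>r \<in> carrier R; w \<in> lists E; g \<in> carrier (free_algebra R E); P g\<rbrakk> \<Longrightarrow>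
      P (r \<odot>\<^bsub>free_algebra R E\<^esub> monomial w \<oplus>\<^bsub>free_algebra R E\<^esub> g)"
  shows "P f"
proof -
  have "P f" if "finite A" "{w. f w \<noteq> \<zero>} \<subseteq> A" "f \<in> carrier (free_algebra R E)" for A f
    using that
  proof (induction A arbitrary: f)
    case empty
    hence "f = \<zero>\<^bsub>free_algebra R E\<^esub>"
      by (auto simp: free_algebra_simps)
    thus ?case using z by simp
  next
    case (insert u A)
    note F = free_carrierD[OF insert.prems(2)]
    let ?g = "f(u := \<zero>)"
    have g: "?g \<in> carrier (free_algebra R E)"
      by (rule free_carrierI[of _ "{w. f w \<noteq> \<zero>}"]) (use F in auto)
    have "P ?g"
      by (rule insert.IH[OF _ g]) (use insert.prems(1) in auto)
    show ?case
    proof (cases "f u = \<zero>")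
      case True
      hence "?g = f" by auto
      thus ?thesis using \<open>P ?g\<close> by simp
    next
      case False
      have "f = (f u) \<odot>\<^bsub>free_algebra R E\<^esub> monomial u \<oplus>\<^bsub>free_algebra R E\<^esub> ?g"
        using F(2) by (auto simp: free_algebra_simps monomial_def fun_eq_iff)
      from this[symmetric] show ?thesis
        by (rule subst[where P = P]) (rule s[OF F(2) F(4)[OF False] g \<open>P ?g\<close>])
    qed
  qed
  thus ?thesis using free_carrierD(3)[OF f] f by blast
qed

lemma letter_closed: "x \<in> E \<Longrightarrow> letter R x \<in> carrier (free_algebra R E)"
  by (simp add: letter_eq_monomial monomial_closed)

lemma free_algebra_generates: "generates R (free_algebra R E) (letter R ` E)"
  unfolding generates_def
proof (intro conjI allI impI)
  let ?F = "free_algebra R E"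
  interpret F: module R ?F using free_algebra_assoc_algebra by (rule assoc_algebraD)
  show "letter R ` E \<subseteq> carrier ?F"
    by (auto simp: letter_eq_monomial intro!: monomial_closed)
  fix B
  assume B: "letter R ` E \<subseteq> B \<and> B \<subseteq> carrier ?F \<and> \<one>\<^bsub>?F\<^esub> \<in> B \<and>
      (\<forall>a\<in>B. \<forall>b\<in>B. a \<oplus>\<^bsub>?F\<^esub> b \<in> B \<and> a \<otimes>\<^bsub>?F\<^esub> b \<in> B) \<and>
      (\<forall>r\<in>carrier R. \<forall>a\<in>B. r \<odot>\<^bsub>?F\<^esub> a \<in> B)"
  have mono: "monomial w \<in> B" if "w \<in> lists E" for w
    using that
  proof (induction w)
    case Nil
    thus ?case using B by (simp add: free_algebra_simps)
  next
    case (Cons x w)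
    have "monomial (x # w) = letter R x \<otimes>\<^bsub>?F\<^esub> monomial w"
      by (simp add: letter_eq_monomial monomial_mult)
    thus ?case using B Cons by auto
  qed
  have "f \<in> B" if "f \<in> carrier ?F" for f
    using that
  proof (induction rule: free_algebra_induct)
    case zero
    have "\<zero> \<odot>\<^bsub>?F\<^esub> \<one>\<^bsub>?F\<^esub> \<in> B" "\<one>\<^bsub>?F\<^esub> \<in> carrier ?F" using B by blast+
    thus ?case by simp
  next
    case (step r w g)
    thus ?case using B mono by blast
  qed
  thus "B = carrier ?F" using B by blast
qed

end

text \<open>A word is sent to the product of the images of its letters, and an element to the corresponding
  linear combination. Multiplicativity is bilinear in both factors and clear for words.\<close>

lemma free_algebra_lift:
  fixes V :: "('r, 'v, 'n) module_scheme" (structure)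
  assumes V: "assoc_algebra R V" and \<phi>: "\<phi> \<in> E \<rightarrow> carrier V"
  obtains h where "h \<in> alg_homs R (free_algebra R E) V" "\<And>x. x \<in> E \<Longrightarrow> h (letter R x) = \<phi> x"
proof -
  interpret R: cring R using V by (rule assoc_algebraD)
  interpret V: assoc_algebra R V by fact
  let ?F = "free_algebra R E"
  interpret F: assoc_algebra R ?F by (rule R.free_algebra_assoc_algebra)
  define m where "m = (\<lambda>w. foldr (\<lambda>x a. \<phi> x \<otimes>\<^bsub>V\<^esub> a) w \<one>\<^bsub>V\<^esub>)"
  \<comment> \<open>The value zero on foreign words makes every summand an element of \<open>V\<close>, so that the sum may
    be taken over any finite set containing the support.\<close>
  define t where "t = (\<lambda>f w. if w \<in> lists E then f w \<odot>\<^bsub>V\<^esub> m w else \<zero>\<^bsub>V\<^esub>)"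
  define h where "h = (\<lambda>f. \<Oplus>\<^bsub>V\<^esub>w\<in>{w. f w \<noteq> \<zero>\<^bsub>R\<^esub>}. t f w)"
  have m: "m w \<in> carrier V" if "w \<in> lists E" for w
    using that \<phi> by (induction w) (auto simp: m_def)
  have m_app: "m (u @ v) = m u \<otimes>\<^bsub>V\<^esub> m v" if "u \<in> lists E" "v \<in> lists E" for u v
    using that(1)
  proof (induction u)
    case Nil thus ?case using m[OF that(2)] by (simp add: m_def)
  next
    case (Cons x u)
    moreover have "\<phi> x \<in> carrier V" using Cons \<phi> by auto
    ultimately show ?case using m[OF that(2)] m[of u] by (simp add: m_def V.m_assoc)
  qed
  have t: "t f w \<in> carrier V" if "f \<in> carrier ?F" for f w
    using m R.free_carrierD(2)[OF that] by (simp add: t_def)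
  have h_eq: "h f = (\<Oplus>\<^bsub>V\<^esub>w\<in>A. t f w)" if "f \<in> carrier ?F" "finite A" "{w. f w \<noteq> \<zero>\<^bsub>R\<^esub>} \<subseteq> A" for f A
    unfolding h_def
    by (rule V.add.finprod_mono_neutral_cong_left)
       (use that t m in \<open>auto simp: t_def\<close>)
  have h_cl: "h f \<in> carrier V" if "f \<in> carrier ?F" for f
    unfolding h_def by (rule V.finsum_closed) (use t that in auto)
  have h_add: "h (f \<oplus>\<^bsub>?F\<^esub> g) = h f \<oplus>\<^bsub>V\<^esub> h g" if f: "f \<in> carrier ?F" and g: "g \<in> carrier ?F" for f g
  proof -
    let ?A = "{w. f w \<noteq> \<zero>\<^bsub>R\<^esub>} \<union> {w. g w \<noteq> \<zero>\<^bsub>R\<^esub>}"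
    have fin: "finite ?A" using R.free_carrierD(3)[OF f] R.free_carrierD(3)[OF g] by simp
    have "h (f \<oplus>\<^bsub>?F\<^esub> g) = (\<Oplus>\<^bsub>V\<^esub>w\<in>?A. t (f \<oplus>\<^bsub>?F\<^esub> g) w)"
      by (rule h_eq) (use f g fin in \<open>auto simp: R.free_algebra_simps R.free_add_closed\<close>)
    also have "\<dots> = (\<Oplus>\<^bsub>V\<^esub>w\<in>?A. t f w \<oplus>\<^bsub>V\<^esub> t g w)"
      by (rule V.finsum_cong')
        (use m R.free_carrierD(2)[OF f] R.free_carrierD(2)[OF g] in
          \<open>auto simp: t_def R.free_algebra_simps V.smult_l_distr\<close>)
    also have "\<dots> = (\<Oplus>\<^bsub>V\<^esub>w\<in>?A. t f w) \<oplus>\<^bsub>V\<^esub> (\<Oplus>\<^bsub>V\<^esub>w\<in>?A. t g w)"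
      by (rule V.finsum_addf) (use t f g in auto)
    also have "\<dots> = h f \<oplus>\<^bsub>V\<^esub> h g"
      using h_eq[OF f fin] h_eq[OF g fin] by auto
    finally show ?thesis .
  qed
  have h_smult: "h (r \<odot>\<^bsub>?F\<^esub> f) = r \<odot>\<^bsub>V\<^esub> h f" if r: "r \<in> carrier R" and f: "f \<in> carrier ?F" for r f
  proof -
    let ?A = "{w. f w \<noteq> \<zero>\<^bsub>R\<^esub>}"
    have fin: "finite ?A" using R.free_carrierD(3)[OF f] by simp
    have "h (r \<odot>\<^bsub>?F\<^esub> f) = (\<Oplus>\<^bsub>V\<^esub>w\<in>?A. t (r \<odot>\<^bsub>?F\<^esub> f) w)"
      by (rule h_eq) (use f r fin in \<open>auto simp: R.free_algebra_simps R.free_smult_closed\<close>)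
    also have "\<dots> = (\<Oplus>\<^bsub>V\<^esub>w\<in>?A. r \<odot>\<^bsub>V\<^esub> t f w)"
      by (rule V.finsum_cong')
        (use m R.free_carrierD(2)[OF f] r in
          \<open>auto simp: t_def R.free_algebra_simps V.smult_assoc1\<close>)
    also have "\<dots> = r \<odot>\<^bsub>V\<^esub> h f"
      unfolding h_def by (rule V.finsum_smult_ldistr[symmetric]) (use t f r fin in auto)
    finally show ?thesis .
  qed
  have h_mono: "h (R.monomial w) = m w" if "w \<in> lists E" for w
  proof -
    have "h (R.monomial w) = (\<Oplus>\<^bsub>V\<^esub>v\<in>{w}. t (R.monomial w) v)"
      by (rule h_eq) (use R.monomial_closed[OF that] in \<open>auto simp: R.monomial_def\<close>)
    thus ?thesis using m that by (simp add: V.finsum_insert t_def R.monomial_def)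
  qed
  have lin: "h \<in> linear_maps R ?F V"
    using h_cl h_add h_smult by (intro linear_mapsI) auto
  note lm = linear_mapsD[OF lin]
  have h0: "h \<zero>\<^bsub>?F\<^esub> = \<zero>\<^bsub>V\<^esub>"
    by (rule linear_maps_minus(1)[OF F.module_axioms V.module_axioms lin])
  have mono_mult: "h (R.monomial u \<otimes>\<^bsub>?F\<^esub> g) = m u \<otimes>\<^bsub>V\<^esub> h g"
    if u: "u \<in> lists E" and g: "g \<in> carrier ?F" for u g
    using g
  proof (induction rule: R.free_algebra_induct)
    case zero
    show ?case using h0 m[OF u] R.monomial_closed[OF u] by simp
  next
    case (step r w g)
    note M = R.monomial_closed[OF u] R.monomial_closed[OF step(2)]
    have "R.monomial u \<otimes>\<^bsub>?F\<^esub> (r \<odot>\<^bsub>?F\<^esub> R.monomial w \<oplus>\<^bsub>?F\<^esub> g) =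
      r \<odot>\<^bsub>?F\<^esub> R.monomial (u @ w) \<oplus>\<^bsub>?F\<^esub> R.monomial u \<otimes>\<^bsub>?F\<^esub> g"
      using M step by (simp add: F.r_distr F.smult_mult_right R.monomial_mult)
    thus ?case
      using M step u m[OF u] m[OF step(2)] lm R.monomial_closed[of "u @ w" E]
      by (simp add: V.smult_mult_right h_mono m_app V.r_distr)
  qed
  have mult: "h (f \<otimes>\<^bsub>?F\<^esub> g) = h f \<otimes>\<^bsub>V\<^esub> h g" if f: "f \<in> carrier ?F" and g: "g \<in> carrier ?F" for f g
    using f
  proof (induction rule: R.free_algebra_induct)
    case zero
    show ?case using h0 h_cl g by simp
  next
    case (step r w f)
    note M = R.monomial_closed[OF step(2)]
    have "(r \<odot>\<^bsub>?F\<^esub> R.monomial w \<oplus>\<^bsub>?F\<^esub> f) \<otimes>\<^bsub>?F\<^esub> g =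
      r \<odot>\<^bsub>?F\<^esub> (R.monomial w \<otimes>\<^bsub>?F\<^esub> g) \<oplus>\<^bsub>?F\<^esub> f \<otimes>\<^bsub>?F\<^esub> g"
      using M step g by (simp add: F.l_distr F.smult_mult_left)
    thus ?case
      using M step m[OF step(2)] lm g
        mono_mult[OF step(2) g]
      by (simp add: V.smult_mult_left h_mono V.l_distr)
  qed
  have "h \<in> alg_homs R ?F V"
    using lin mult h_mono[of "[]"] by (intro alg_homsI) (auto simp: R.free_algebra_simps m_def)
  moreover have "h (letter R x) = \<phi> x" if "x \<in> E" for x
    using h_mono[of "[x]"] that funcset_mem[OF \<phi> that] by (simp add: R.letter_eq_monomial m_def)
  ultimately show thesis by (rule that)
qed

section \<open>Quotients by ideals\<close>

lemma quotient_algebra_simps: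
  "carrier (quotient_algebra A I) = a_rcosets\<^bsub>A\<^esub> I"
  "\<one>\<^bsub>quotient_algebra A I\<^esub> = I +>\<^bsub>A\<^esub> \<one>\<^bsub>A\<^esub>"
  "\<zero>\<^bsub>quotient_algebra A I\<^esub> = I"
  by (simp_all add: quotient_algebra_def FactRing_def)

lemma quotient_algebra_coset_cases:
  assumes "C \<in> carrier (quotient_algebra A I)"
  obtains a where "a \<in> carrier A" "C = I +>\<^bsub>A\<^esub> a"
  using assms by (auto simp: quotient_algebra_simps A_RCOSETS_defs a_r_coset_def[symmetric])

lemma quotient_algebra_coset_closed:
  "a \<in> carrier A \<Longrightarrow> I +>\<^bsub>A\<^esub> a \<in> carrier (quotient_algebra A I)"
  by (auto simp: quotient_algebra_simps A_RCOSETS_defs a_r_coset_def[symmetric])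

text \<open>A two-sided ideal absorbs scalars because \<open>r \<odot> x = (r \<odot> \<one>) \<otimes> x\<close>.\<close>

lemma ideal_smult_closed:
  assumes A: "assoc_algebra R A" and I: "ideal I A" and r: "r \<in> carrier R" and x: "x \<in> I"
  shows "r \<odot>\<^bsub>A\<^esub> x \<in> I"
proof -
  interpret A: assoc_algebra R A by fact
  interpret I: ideal I A by fact
  have "r \<odot>\<^bsub>A\<^esub> x = (r \<odot>\<^bsub>A\<^esub> \<one>\<^bsub>A\<^esub>) \<otimes>\<^bsub>A\<^esub> x"
    using A.smult_mult_left[OF r, of "\<one>\<^bsub>A\<^esub>" x] x I.a_Hcarr[OF x] by simp
  thus ?thesis using I.I_l_closed[OF x] r by simp
qed

lemma (in ideal) coset_eq_iff:
  assumes a: "a \<in> carrier R" and b: "b \<in> carrier R"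
  shows "I +> a = I +> b \<longleftrightarrow> a \<ominus> b \<in> I"
proof -
  have "a \<in> I +> b \<longleftrightarrow> a \<ominus> b \<in> I"
    using a_rcos_module[OF b a] a b by (simp add: minus_eq)
  moreover have "a \<in> I +> b \<longleftrightarrow> I +> a = I +> b"
    using a_repr_independence'[OF _ b, of a] a_rcos_self[OF a] by auto
  ultimately show ?thesis by simp
qed

text \<open>The operations on cosets are computed on representatives. For the scalar multiplication the union
  in its definition is over one and the same coset, because the ideal is an \<open>R\<close>-submodule.\<close>

lemma quotient_algebra_ops:
  assumes A: "assoc_algebra R A" and I: "ideal I A"
    and a: "a \<in> carrier A"
  shows "b \<in> carrier A \<Longrightarrow> (I +>\<^bsub>A\<^esub> a) \<oplus>\<^bsub>quotient_algebra A I\<^esub> (I +>\<^bsub>A\<^esub> b) = I +>\<^bsub>A\<^esub> (a \<oplus>\<^bsub>A\<^esub> b)"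
    and "b \<in> carrier A \<Longrightarrow> (I +>\<^bsub>A\<^esub> a) \<otimes>\<^bsub>quotient_algebra A I\<^esub> (I +>\<^bsub>A\<^esub> b) = I +>\<^bsub>A\<^esub> (a \<otimes>\<^bsub>A\<^esub> b)"
    and "r \<in> carrier R \<Longrightarrow> r \<odot>\<^bsub>quotient_algebra A I\<^esub> (I +>\<^bsub>A\<^esub> a) = I +>\<^bsub>A\<^esub> (r \<odot>\<^bsub>A\<^esub> a)"
proof -
  interpret A: assoc_algebra R A by fact
  interpret I: ideal I A by fact
  show "(I +>\<^bsub>A\<^esub> a) \<oplus>\<^bsub>quotient_algebra A I\<^esub> (I +>\<^bsub>A\<^esub> b) = I +>\<^bsub>A\<^esub> (a \<oplus>\<^bsub>A\<^esub> b)"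
    if b: "b \<in> carrier A"
    using a b by (simp add: quotient_algebra_def FactRing_def I.a_rcos_sum)
  show "(I +>\<^bsub>A\<^esub> a) \<otimes>\<^bsub>quotient_algebra A I\<^esub> (I +>\<^bsub>A\<^esub> b) = I +>\<^bsub>A\<^esub> (a \<otimes>\<^bsub>A\<^esub> b)"
    if b: "b \<in> carrier A"
    using a b by (simp add: quotient_algebra_def FactRing_def I.rcoset_mult_add)
  show "r \<odot>\<^bsub>quotient_algebra A I\<^esub> (I +>\<^bsub>A\<^esub> a) = I +>\<^bsub>A\<^esub> (r \<odot>\<^bsub>A\<^esub> a)" if r: "r \<in> carrier R"
  proof -
    have eq: "I +>\<^bsub>A\<^esub> (r \<odot>\<^bsub>A\<^esub> x) = I +>\<^bsub>A\<^esub> (r \<odot>\<^bsub>A\<^esub> a)" if x: "x \<in> I +>\<^bsub>A\<^esub> a" for x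
    proof -
      from x obtain i where i: "i \<in> I" "x = i \<oplus>\<^bsub>A\<^esub> a"
        by (auto simp: a_r_coset_def r_coset_def)
      have ic: "i \<in> carrier A" "r \<odot>\<^bsub>A\<^esub> i \<in> I"
        using i ideal_smult_closed[OF A I r] I.a_Hcarr by auto
      have "r \<odot>\<^bsub>A\<^esub> x = r \<odot>\<^bsub>A\<^esub> i \<oplus>\<^bsub>A\<^esub> r \<odot>\<^bsub>A\<^esub> a"
        using i ic a r by (simp add: A.smult_r_distr)
      hence "r \<odot>\<^bsub>A\<^esub> x \<in> I +>\<^bsub>A\<^esub> (r \<odot>\<^bsub>A\<^esub> a)"
        using ic by (auto simp: a_r_coset_def r_coset_def)
      thus ?thesis
        using r a by (intro I.a_repr_independence'[symmetric]) simp_all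
    qed
    have "(\<Union>x\<in>I +>\<^bsub>A\<^esub> a. I +>\<^bsub>A\<^esub> (r \<odot>\<^bsub>A\<^esub> x)) = I +>\<^bsub>A\<^esub> (r \<odot>\<^bsub>A\<^esub> a)"
      using I.a_rcos_self[OF a] by (rule UN_constant_eq) (intro ballI eq)
    thus ?thesis
      by (simp add: quotient_algebra_def)
  qed
qed

lemma quotient_algebra_assoc_algebra:
  assumes A: "assoc_algebra R A" and I: "ideal I A"
  shows "assoc_algebra R (quotient_algebra A I)"
proof -
  interpret A: assoc_algebra R A by fact
  interpret I: ideal I A by fact
  let ?Q = "quotient_algebra A I"
  note ops = quotient_algebra_ops[OF A I]
  interpret Q: ring "A Quot I" by (rule I.quotient_is_ring)
  note qs = quotient_algebra_def
  have ab: "abelian_group ?Q"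
    by (rule abelian_groupI)
      (use Q.a_closed Q.zero_closed Q.a_assoc Q.a_comm Q.l_zero Q.add.l_inv_ex in \<open>simp_all add: qs\<close>)
  have "Group.monoid ?Q"
    by (rule Group.monoidI)
      (use Q.m_closed Q.one_closed Q.m_assoc Q.l_one Q.r_one in \<open>simp_all add: qs\<close>)
  with ab have ri: "ring ?Q"
    by (rule ringI) (use Q.l_distr Q.r_distr in \<open>simp_all add: qs\<close>)
  have mo: "module R ?Q"
    by (rule moduleI[OF A.R.is_cring ab]; (elim quotient_algebra_coset_cases)?)
      (simp_all add: ops A.smult_l_distr A.smult_r_distr A.smult_assoc1 quotient_algebra_coset_closed)
  show ?thesis
    by (rule assoc_algebraI[OF mo ri]; elim quotient_algebra_coset_cases)
      (simp_all add: ops A.smult_mult_left A.smult_mult_right)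
qed

lemma quotient_algebra_proj:
  assumes A: "assoc_algebra R A" and I: "ideal I A"
  shows "(+>\<^bsub>A\<^esub>) I \<in> alg_homs R A (quotient_algebra A I)"
    and "(+>\<^bsub>A\<^esub>) I ` carrier A = carrier (quotient_algebra A I)"
  by (auto intro!: alg_homsI linear_mapsI quotient_algebra_coset_closed
      elim!: quotient_algebra_coset_cases
      simp: quotient_algebra_ops[OF A I] quotient_algebra_simps(2))

text \<open>The kernel of \<open>h\<close> is an ideal that contains \<open>Y\<close>, hence the ideal generated by \<open>Y\<close>; so \<open>h\<close> is
  constant on cosets and its value on a coset is the only element of the image.\<close>

lemma quotient_algebra_lift:
  assumes A: "assoc_algebra R A" and V: "assoc_algebra R V" and Y: "Y \<subseteq> carrier A"
    and h: "h \<in> alg_homs R A V" and ann: "\<And>x. x \<in> Y \<Longrightarrow> h x = \<zero>\<^bsub>V\<^esub>"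
  obtains h' where "h' \<in> alg_homs R (quotient_algebra A (genideal A Y)) V"
    "\<And>a. a \<in> carrier A \<Longrightarrow> h' (genideal A Y +>\<^bsub>A\<^esub> a) = h a"
proof -
  interpret A: assoc_algebra R A by fact
  interpret V: assoc_algebra R V by fact
  let ?I = "genideal A Y"
  interpret I: ideal ?I A using Y by (rule A.genideal_ideal)
  note H = alg_homsD[OF h] note L = linear_mapsD[OF H(1)]
  have "h \<in> ring_hom A V"
    using h by (simp add: alg_homs_def)
  then interpret hom: ring_hom_ring A V h
    by (intro ring_hom_ringI2 A.ring_axioms V.ring_axioms)
  have ker: "?I \<subseteq> a_kernel A V h"
  proof (rule A.genideal_minimal[OF hom.kernel_is_ideal])
    show "Y \<subseteq> a_kernel A V h"
      unfolding a_kernel_def' using Y ann by blast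
  qed
  define h' where "h' = (\<lambda>C. the_elem (h ` C))"
  have h': "h' (?I +>\<^bsub>A\<^esub> a) = h a" if a: "a \<in> carrier A" for a
  proof -
    have eq: "h x \<in> {h a}" if "x \<in> ?I +>\<^bsub>A\<^esub> a" for x
    proof -
      from that obtain i where i: "i \<in> ?I" "x = i \<oplus>\<^bsub>A\<^esub> a"
        by (auto simp: a_r_coset_def r_coset_def)
      from ker i(1) have "i \<in> a_kernel A V h" by (rule subsetD)
      hence "i \<in> carrier A" "h i = \<zero>\<^bsub>V\<^esub>"
        unfolding a_kernel_def' by blast+
      thus ?thesis using i a L by simp
    qed
    have "h ` (?I +>\<^bsub>A\<^esub> a) = {h a}"
    proof (rule subset_antisym)
      show "h ` (?I +>\<^bsub>A\<^esub> a) \<subseteq> {h a}"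
        by (rule image_subsetI) (rule eq)
      show "{h a} \<subseteq> h ` (?I +>\<^bsub>A\<^esub> a)"
        using imageI[OF I.a_rcos_self[OF a], of h] by (simp only: insert_subset empty_subsetI simp_thms)
    qed
    thus ?thesis by (simp add: h'_def)
  qed
  have "h' \<in> alg_homs R (quotient_algebra A ?I) V"
    by (intro alg_homsI linear_mapsI; (elim quotient_algebra_coset_cases)?)
      (simp_all add: h' H(2,3) L quotient_algebra_ops[OF A I.ideal_axioms] quotient_algebra_simps(2))
  thus thesis using h' by (rule that)
qed

section \<open>Tensor, symmetric and Sridharan algebras as universal algebras\<close>

text \<open>The generators of the linearity ideal, named separately because the universal property of the
  quotient is a statement about generators of the ideal.\<close>

definition linearity_relations ::
  "('r, 'k) ring_scheme \<Rightarrow> ('r, 'a, 'm) module_scheme \<Rightarrow> ('a list \<Rightarrow> 'r) set"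
  where "linearity_relations R M = (let F = free_algebra R (carrier M) in
     ({letter R (x \<oplus>\<^bsub>M\<^esub> y) \<ominus>\<^bsub>F\<^esub> (letter R x \<oplus>\<^bsub>F\<^esub> letter R y) |x y. x \<in> carrier M \<and> y \<in> carrier M} \<union>
      {letter R (r \<odot>\<^bsub>M\<^esub> x) \<ominus>\<^bsub>F\<^esub> r \<odot>\<^bsub>F\<^esub> letter R x |r x. r \<in> carrier R \<and> x \<in> carrier M}))"

lemma linearity_ideal_eq:
  "linearity_ideal R M = genideal (free_algebra R (carrier M)) (linearity_relations R M)"
  by (simp add: linearity_ideal_def linearity_relations_def Let_def)

lemma linearity_relations_closed:
  assumes M: "module R M"
  shows "linearity_relations R M \<subseteq> carrier (free_algebra R (carrier M))"
proof -
  interpret M: module R M by fact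
  interpret F: assoc_algebra R "free_algebra R (carrier M)"
    by (rule M.R.free_algebra_assoc_algebra)
  show ?thesis
    by (auto simp: linearity_relations_def Let_def M.R.letter_closed)
qed

lemma linearity_ideal_ideal:
  assumes M: "module R M"
  shows "ideal (linearity_ideal R M) (free_algebra R (carrier M))"
proof -
  interpret M: module R M by fact
  show ?thesis
    unfolding linearity_ideal_eq
    by (intro ring.genideal_ideal assoc_algebraD(3)[OF M.R.free_algebra_assoc_algebra]
        linearity_relations_closed M)
qed

lemma tensor_algebra_assoc_algebra:
  assumes M: "module R M"
  shows "assoc_algebra R (tensor_algebra R M)"
proof -
  interpret M: module R M by fact
  show ?thesis
    unfolding tensor_algebra_def
    by (intro quotient_algebra_assoc_algebra M.R.free_algebra_assoc_algebra linearity_ideal_ideal M)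
qed

lemma tensor_inj_linear:
  assumes M: "module R M"
  shows "tensor_inj R M \<in> linear_maps R M (tensor_algebra R M)"
proof -
  interpret M: module R M by fact
  let ?F = "free_algebra R (carrier M)" and ?I = "linearity_ideal R M"
  have F: "assoc_algebra R ?F" by (rule M.R.free_algebra_assoc_algebra)
  interpret F: assoc_algebra R ?F by fact
  interpret I: ideal ?I ?F using M by (rule linearity_ideal_ideal)
  note [simp] = M.R.letter_closed
  have rel: "a \<in> ?I" if "a \<in> linearity_relations R M" for a
    using F.genideal_self[OF linearity_relations_closed[OF M]] that
    by (auto simp: linearity_ideal_eq)
  show ?thesis
  proof (rule linear_mapsI)
    fix x assume x: "x \<in> carrier M"
    show "tensor_inj R M x \<in> carrier (tensor_algebra R M)"
      using x by (simp add: tensor_inj_def tensor_algebra_def quotient_algebra_coset_closed)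
    show "tensor_inj R M (r \<odot>\<^bsub>M\<^esub> x) = r \<odot>\<^bsub>tensor_algebra R M\<^esub> tensor_inj R M x"
      if r: "r \<in> carrier R" for r
    proof -
      have "letter R (r \<odot>\<^bsub>M\<^esub> x) \<ominus>\<^bsub>?F\<^esub> r \<odot>\<^bsub>?F\<^esub> letter R x \<in> ?I"
        using r x by (intro rel) (auto simp: linearity_relations_def Let_def)
      hence "?I +>\<^bsub>?F\<^esub> letter R (r \<odot>\<^bsub>M\<^esub> x) = ?I +>\<^bsub>?F\<^esub> (r \<odot>\<^bsub>?F\<^esub> letter R x)"
        using r x by (simp add: I.coset_eq_iff)
      thus ?thesis
        using r x by (simp add: tensor_inj_def tensor_algebra_def quotient_algebra_ops[OF F I.ideal_axioms])
    qed
    fix y assume y: "y \<in> carrier M"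
    have "letter R (x \<oplus>\<^bsub>M\<^esub> y) \<ominus>\<^bsub>?F\<^esub> (letter R x \<oplus>\<^bsub>?F\<^esub> letter R y) \<in> ?I"
      using y x by (intro rel) (auto simp: linearity_relations_def Let_def)
    hence "?I +>\<^bsub>?F\<^esub> letter R (x \<oplus>\<^bsub>M\<^esub> y) = ?I +>\<^bsub>?F\<^esub> (letter R x \<oplus>\<^bsub>?F\<^esub> letter R y)"
      using y x by (simp add: I.coset_eq_iff)
    thus "tensor_inj R M (x \<oplus>\<^bsub>M\<^esub> y) = tensor_inj R M x \<oplus>\<^bsub>tensor_algebra R M\<^esub> tensor_inj R M y"
      using y x by (simp add: tensor_inj_def tensor_algebra_def quotient_algebra_ops[OF F I.ideal_axioms])
  qed
qed

lemma tensor_algebra_generates: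
  assumes M: "module R M"
  shows "generates R (tensor_algebra R M) (tensor_inj R M ` carrier M)"
proof -
  interpret M: module R M by fact
  let ?F = "free_algebra R (carrier M)" and ?I = "linearity_ideal R M"
  have F: "assoc_algebra R ?F" by (rule M.R.free_algebra_assoc_algebra)
  have "generates R (tensor_algebra R M) ((+>\<^bsub>?F\<^esub>) ?I ` letter R ` carrier M)"
    unfolding tensor_algebra_def
    by (rule generates_surjective_image[OF M.R.free_algebra_generates F]
        quotient_algebra_proj[OF F] linearity_ideal_ideal[OF M])+
  thus ?thesis by (simp add: image_image tensor_inj_def)
qed

lemma tensor_algebra_lift:
  assumes M: "module R M" and V: "assoc_algebra R V" and g: "g \<in> linear_maps R M V"
  obtains h where "h \<in> alg_homs R (tensor_algebra R M) V"
    "\<And>x. x \<in> carrier M \<Longrightarrow> h (tensor_inj R M x) = g x"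
proof -
  interpret M: module R M by fact
  interpret V: assoc_algebra R V by fact
  let ?F = "free_algebra R (carrier M)" and ?I = "linearity_ideal R M"
  have F: "assoc_algebra R ?F" by (rule M.R.free_algebra_assoc_algebra)
  interpret F: assoc_algebra R ?F by fact
  note [simp] = M.R.letter_closed
  note G = linear_mapsD[OF g]
  obtain f where f: "f \<in> alg_homs R ?F V" and fx: "\<And>x. x \<in> carrier M \<Longrightarrow> f (letter R x) = g x"
    using free_algebra_lift[OF V, of g "carrier M"] G(1) by auto
  note L = linear_mapsD[OF alg_homsD(1)[OF f]]
    linear_maps_minus[OF F.module_axioms V.module_axioms alg_homsD(1)[OF f]]
  have "f u = \<zero>\<^bsub>V\<^esub>" if "u \<in> linearity_relations R M" for u
    using that unfolding linearity_relations_def Let_def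
    by (elim UnE) (auto simp: L fx G V.r_neg V.minus_eq)
  from quotient_algebra_lift[OF F V linearity_relations_closed[OF M] f this]
  obtain h where h: "h \<in> alg_homs R (tensor_algebra R M) V"
    and "\<And>a. a \<in> carrier ?F \<Longrightarrow> h (?I +>\<^bsub>?F\<^esub> a) = f a"
    by (auto simp: tensor_algebra_def linearity_ideal_eq)
  hence "h (tensor_inj R M x) = g x" if "x \<in> carrier M" for x
    using that fx by (simp add: tensor_inj_def)
  with h show thesis by (rule that)
qed

text \<open>What the symmetric and the Sridharan algebras inherit from being quotients of a tensor algebra,
  for an arbitrary set \<open>Y\<close> of relations.\<close>

lemma tensor_quotient:
  assumes M: "module R M" and Y: "Y \<subseteq> carrier (tensor_algebra R M)"
    and I: "I = genideal (tensor_algebra R M) Y"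
  shows "assoc_algebra R (quotient_algebra (tensor_algebra R M) I)"
    and "(+>\<^bsub>tensor_algebra R M\<^esub>) I \<in> alg_homs R (tensor_algebra R M) (quotient_algebra (tensor_algebra R M) I)"
    and "(\<lambda>x. I +>\<^bsub>tensor_algebra R M\<^esub> tensor_inj R M x) \<in>
      linear_maps R M (quotient_algebra (tensor_algebra R M) I)"
    and "generates R (quotient_algebra (tensor_algebra R M) I)
      ((\<lambda>x. I +>\<^bsub>tensor_algebra R M\<^esub> tensor_inj R M x) ` carrier M)"
    and "y \<in> Y \<Longrightarrow> I +>\<^bsub>tensor_algebra R M\<^esub> y = \<zero>\<^bsub>quotient_algebra (tensor_algebra R M) I\<^esub>"
proof -
  let ?T = "tensor_algebra R M"
  have T: "assoc_algebra R ?T" using M by (rule tensor_algebra_assoc_algebra)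
  interpret T: assoc_algebra R ?T by fact
  interpret I: ideal I ?T unfolding I using Y by (rule T.genideal_ideal)
  note Id = I.ideal_axioms
  show "assoc_algebra R (quotient_algebra ?T I)"
    using T Id by (rule quotient_algebra_assoc_algebra)
  show proj: "(+>\<^bsub>?T\<^esub>) I \<in> alg_homs R ?T (quotient_algebra ?T I)"
    using T Id by (rule quotient_algebra_proj)
  show "(\<lambda>x. I +>\<^bsub>?T\<^esub> tensor_inj R M x) \<in> linear_maps R M (quotient_algebra ?T I)"
    using linear_mapsD[OF alg_homsD(1)[OF proj]] linear_mapsD[OF tensor_inj_linear[OF M]]
    by (intro linear_mapsI) auto
  have "generates R (quotient_algebra ?T I) ((+>\<^bsub>?T\<^esub>) I ` tensor_inj R M ` carrier M)"
    using tensor_algebra_generates[OF M] T proj quotient_algebra_proj(2)[OF T Id]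
    by (rule generates_surjective_image)
  thus "generates R (quotient_algebra ?T I) ((\<lambda>x. I +>\<^bsub>?T\<^esub> tensor_inj R M x) ` carrier M)"
    by (simp add: image_image)
  show "I +>\<^bsub>?T\<^esub> y = \<zero>\<^bsub>quotient_algebra ?T I\<^esub>" if "y \<in> Y"
  proof -
    have "y \<in> I" using that T.genideal_self[OF Y] I by auto
    thus ?thesis by (simp add: quotient_algebra_simps I.a_rcos_const)
  qed
qed

definition sridharan_relations ::
  "('r, 'k) ring_scheme \<Rightarrow> ('r, 'a, 'm) module_scheme \<Rightarrow> ('a \<Rightarrow> 'a \<Rightarrow> 'a) \<Rightarrow> ('a \<Rightarrow> 'a \<Rightarrow> 'r)
    \<Rightarrow> ('a list \<Rightarrow> 'r) set set"
  where "sridharan_relations R L br \<sigma> = (let T = tensor_algebra R L; t = tensor_inj R L in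
    {t x \<otimes>\<^bsub>T\<^esub> t y \<ominus>\<^bsub>T\<^esub> t y \<otimes>\<^bsub>T\<^esub> t x \<ominus>\<^bsub>T\<^esub> t (br x y) \<ominus>\<^bsub>T\<^esub> \<sigma> x y \<odot>\<^bsub>T\<^esub> \<one>\<^bsub>T\<^esub>
      |x y. x \<in> carrier L \<and> y \<in> carrier L})"

lemma sridharan_ideal_eq:
  "sridharan_ideal R L br \<sigma> = genideal (tensor_algebra R L) (sridharan_relations R L br \<sigma>)"
  by (simp add: sridharan_ideal_def sridharan_relations_def Let_def)

lemma commutator_relation_iff:
  assumes A: "assoc_algebra R A" and "a \<in> carrier A" "b \<in> carrier A" "c \<in> carrier A" "d \<in> carrier A"
  shows "a \<otimes>\<^bsub>A\<^esub> b \<ominus>\<^bsub>A\<^esub> b \<otimes>\<^bsub>A\<^esub> a \<ominus>\<^bsub>A\<^esub> c \<ominus>\<^bsub>A\<^esub> d = \<zero>\<^bsub>A\<^esub> \<longleftrightarrow> commutator A a b = c \<oplus>\<^bsub>A\<^esub> d"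
proof -
  interpret A: ring A using A by (rule assoc_algebraD)
  have *: "u \<ominus>\<^bsub>A\<^esub> c \<ominus>\<^bsub>A\<^esub> d = u \<ominus>\<^bsub>A\<^esub> (c \<oplus>\<^bsub>A\<^esub> d)" if "u \<in> carrier A" for u
    using assms that by (simp add: A.minus_eq A.minus_add A.a_assoc)
  show ?thesis
    using assms by (simp add: commutator_def * A.r_right_minus_eq)
qed

text \<open>Any two operations \<open>br\<close> and \<open>\<sigma>\<close> define an algebra that is universal for the relation
  \<open>[g x, g y] = g (br x y) + \<sigma>(x, y)\<close>. At this generality the zero operations are an instance,
  and they give the symmetric algebra.\<close>

locale sridharan_data = module R L
  for R :: "('r, 'k) ring_scheme" (structure) and L :: "('r, 'a, 'm) module_scheme" (structure) +
  fixes br :: "'a \<Rightarrow> 'a \<Rightarrow> 'a" and \<sigma> :: "'a \<Rightarrow> 'a \<Rightarrow> 'r"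
  assumes br_closed: "\<lbrakk>x \<in> carrier L; y \<in> carrier L\<rbrakk> \<Longrightarrow> br x y \<in> carrier L"
    and sigma_closed: "\<lbrakk>x \<in> carrier L; y \<in> carrier L\<rbrakk> \<Longrightarrow> \<sigma> x y \<in> carrier R"
begin

lemma relations_closed: "sridharan_relations R L br \<sigma> \<subseteq> carrier (tensor_algebra R L)"
proof -
  interpret T: assoc_algebra R "tensor_algebra R L"
    using module_axioms by (rule tensor_algebra_assoc_algebra)
  show ?thesis
    using linear_mapsD(1)[OF tensor_inj_linear[OF module_axioms]]
    by (auto simp: sridharan_relations_def Let_def br_closed sigma_closed)
qed

lemmas quotient_facts =
  tensor_quotient[OF module_axioms relations_closed sridharan_ideal_eq,
    folded modified_enveloping_algebra_def]

lemma enveloping_assoc_algebra: "assoc_algebra R (modified_enveloping_algebra R L br \<sigma>)"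
  by (rule quotient_facts(1))

lemma enveloping_map_linear:
  "modified_enveloping_map R L br \<sigma> \<in> linear_maps R L (modified_enveloping_algebra R L br \<sigma>)"
  using quotient_facts(3) by (simp add: modified_enveloping_map_def[abs_def])

lemma enveloping_generates:
  "generates R (modified_enveloping_algebra R L br \<sigma>) (modified_enveloping_map R L br \<sigma> ` carrier L)"
  using quotient_facts(4) by (simp add: modified_enveloping_map_def[abs_def])

lemma enveloping_map_commutator:
  assumes x: "x \<in> carrier L" and y: "y \<in> carrier L"
  defines "U \<equiv> modified_enveloping_algebra R L br \<sigma>" and "\<iota> \<equiv> modified_enveloping_map R L br \<sigma>"
  shows "commutator U (\<iota> x) (\<iota> y) = \<iota> (br x y) \<oplus>\<^bsub>U\<^esub> \<sigma> x y \<odot>\<^bsub>U\<^esub> \<one>\<^bsub>U\<^esub>"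
proof -
  let ?T = "tensor_algebra R L" and ?t = "tensor_inj R L" and ?p = "(+>\<^bsub>tensor_algebra R L\<^esub>) (sridharan_ideal R L br \<sigma>)"
  have U: "assoc_algebra R U" unfolding U_def by (rule enveloping_assoc_algebra)
  interpret U: assoc_algebra R U by fact
  interpret T: assoc_algebra R ?T
    using module_axioms by (rule tensor_algebra_assoc_algebra)
  have p: "?p \<in> alg_homs R ?T U" unfolding U_def by (rule quotient_facts(2))
  note L = linear_mapsD[OF alg_homsD(1)[OF p]] alg_homsD(2,3)[OF p]
    linear_maps_minus[OF T.module_axioms U.module_axioms alg_homsD(1)[OF p]]
  note [simp] = linear_mapsD(1)[OF tensor_inj_linear[OF module_axioms]]
  have i: "\<iota> z = ?p (?t z)" for z by (simp add: \<iota>_def modified_enveloping_map_def)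
  have "?p (?t x \<otimes>\<^bsub>?T\<^esub> ?t y \<ominus>\<^bsub>?T\<^esub> ?t y \<otimes>\<^bsub>?T\<^esub> ?t x \<ominus>\<^bsub>?T\<^esub> ?t (br x y) \<ominus>\<^bsub>?T\<^esub> \<sigma> x y \<odot>\<^bsub>?T\<^esub> \<one>\<^bsub>?T\<^esub>) = \<zero>\<^bsub>U\<^esub>"
    unfolding U_def
    by (rule quotient_facts(5)) (use x y in \<open>auto simp: sridharan_relations_def Let_def\<close>)
  hence "?p (?t x) \<otimes>\<^bsub>U\<^esub> ?p (?t y) \<ominus>\<^bsub>U\<^esub> ?p (?t y) \<otimes>\<^bsub>U\<^esub> ?p (?t x) \<ominus>\<^bsub>U\<^esub> ?p (?t (br x y)) \<ominus>\<^bsub>U\<^esub> \<sigma> x y \<odot>\<^bsub>U\<^esub> \<one>\<^bsub>U\<^esub> = \<zero>\<^bsub>U\<^esub>"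
    using x y by (simp add: L br_closed sigma_closed)
  thus ?thesis
    unfolding i using x y
    by (subst (asm) commutator_relation_iff[OF U]) (simp_all add: L br_closed sigma_closed)
qed

lemma enveloping_lift:
  assumes V: "assoc_algebra R V" and g: "g \<in> linear_maps R L V"
    and rel: "\<And>x y. \<lbrakk>x \<in> carrier L; y \<in> carrier L\<rbrakk> \<Longrightarrow>
      commutator V (g x) (g y) = g (br x y) \<oplus>\<^bsub>V\<^esub> \<sigma> x y \<odot>\<^bsub>V\<^esub> \<one>\<^bsub>V\<^esub>"
  obtains h where "h \<in> alg_homs R (modified_enveloping_algebra R L br \<sigma>) V"
    "\<And>x. x \<in> carrier L \<Longrightarrow> h (modified_enveloping_map R L br \<sigma> x) = g x"
proof -
  let ?T = "tensor_algebra R L" and ?t = "tensor_inj R L"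
  interpret V: assoc_algebra R V by fact
  have T: "assoc_algebra R ?T"
    using module_axioms by (rule tensor_algebra_assoc_algebra)
  interpret T: assoc_algebra R ?T by fact
  obtain f where f: "f \<in> alg_homs R ?T V" and ft: "\<And>x. x \<in> carrier L \<Longrightarrow> f (?t x) = g x"
    using tensor_algebra_lift[OF module_axioms V g] by blast
  note L = linear_mapsD[OF alg_homsD(1)[OF f]] alg_homsD(2,3)[OF f]
    linear_maps_minus[OF T.module_axioms V.module_axioms alg_homsD(1)[OF f]]
  note [simp] = linear_mapsD(1)[OF tensor_inj_linear[OF module_axioms]] linear_mapsD(1)[OF g]
  have "f u = \<zero>\<^bsub>V\<^esub>" if u: "u \<in> sridharan_relations R L br \<sigma>" for u
  proof -
    from u obtain x y where xy: "x \<in> carrier L" "y \<in> carrier L" and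
      ueq: "u = ?t x \<otimes>\<^bsub>?T\<^esub> ?t y \<ominus>\<^bsub>?T\<^esub> ?t y \<otimes>\<^bsub>?T\<^esub> ?t x \<ominus>\<^bsub>?T\<^esub> ?t (br x y) \<ominus>\<^bsub>?T\<^esub> \<sigma> x y \<odot>\<^bsub>?T\<^esub> \<one>\<^bsub>?T\<^esub>"
      by (auto simp: sridharan_relations_def Let_def)
    have "f u = g x \<otimes>\<^bsub>V\<^esub> g y \<ominus>\<^bsub>V\<^esub> g y \<otimes>\<^bsub>V\<^esub> g x \<ominus>\<^bsub>V\<^esub> g (br x y) \<ominus>\<^bsub>V\<^esub> \<sigma> x y \<odot>\<^bsub>V\<^esub> \<one>\<^bsub>V\<^esub>"
      unfolding ueq using xy by (simp add: L ft br_closed sigma_closed)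
    also have "\<dots> = \<zero>\<^bsub>V\<^esub>"
      using xy by (subst commutator_relation_iff[OF V]) (simp_all add: rel br_closed sigma_closed)
    finally show ?thesis .
  qed
  from quotient_algebra_lift[OF T V relations_closed f this]
  obtain h where h: "h \<in> alg_homs R (modified_enveloping_algebra R L br \<sigma>) V"
    and "\<And>a. a \<in> carrier ?T \<Longrightarrow> h (sridharan_ideal R L br \<sigma> +>\<^bsub>?T\<^esub> a) = f a"
    by (auto simp: modified_enveloping_algebra_def sridharan_ideal_eq)
  hence "h (modified_enveloping_map R L br \<sigma> x) = g x" if "x \<in> carrier L" for x
    using that ft by (simp add: modified_enveloping_map_def)
  with h show thesis by (rule that)
qed

end

text \<open>For the zero operations the last two terms of every Sridharan relation vanish. This makes the
  symmetric algebra an instance of the general construction.\<close>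

lemma commutativity_ideal_eq:
  assumes M: "module R M"
  shows "commutativity_ideal R M = sridharan_ideal R M (\<lambda>_ _. \<zero>\<^bsub>M\<^esub>) (\<lambda>_ _. \<zero>\<^bsub>R\<^esub>)"
proof -
  let ?T = "tensor_algebra R M" and ?t = "tensor_inj R M"
  interpret M: module R M by fact
  interpret T: assoc_algebra R ?T using M by (rule tensor_algebra_assoc_algebra)
  note tl = tensor_inj_linear[OF M]
  have z: "?t \<zero>\<^bsub>M\<^esub> = \<zero>\<^bsub>?T\<^esub>"
    by (rule linear_maps_minus(1)[OF M T.module_axioms tl])
  have "?t x \<otimes>\<^bsub>?T\<^esub> ?t y \<ominus>\<^bsub>?T\<^esub> ?t y \<otimes>\<^bsub>?T\<^esub> ?t x \<ominus>\<^bsub>?T\<^esub> \<zero>\<^bsub>?T\<^esub> \<ominus>\<^bsub>?T\<^esub> \<zero>\<^bsub>R\<^esub> \<odot>\<^bsub>?T\<^esub> \<one>\<^bsub>?T\<^esub>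
      = ?t x \<otimes>\<^bsub>?T\<^esub> ?t y \<ominus>\<^bsub>?T\<^esub> ?t y \<otimes>\<^bsub>?T\<^esub> ?t x" if "x \<in> carrier M" "y \<in> carrier M" for x y
    using that linear_mapsD(1)[OF tl] by (simp add: T.minus_eq)
  hence "{?t x \<otimes>\<^bsub>?T\<^esub> ?t y \<ominus>\<^bsub>?T\<^esub> ?t y \<otimes>\<^bsub>?T\<^esub> ?t x |x y. x \<in> carrier M \<and> y \<in> carrier M} =
    {?t x \<otimes>\<^bsub>?T\<^esub> ?t y \<ominus>\<^bsub>?T\<^esub> ?t y \<otimes>\<^bsub>?T\<^esub> ?t x \<ominus>\<^bsub>?T\<^esub> \<zero>\<^bsub>?T\<^esub> \<ominus>\<^bsub>?T\<^esub> \<zero>\<^bsub>R\<^esub> \<odot>\<^bsub>?T\<^esub> \<one>\<^bsub>?T\<^esub> |x y. x \<in> carrier M \<and> y \<in> carrier M}"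
    by (intro Collect_cong ex_cong1 iffI; elim conjE; simp)
  thus ?thesis
    by (simp only: commutativity_ideal_def sridharan_ideal_def Let_def z)
qed

context module
begin

lemma sym_algebra_eq: "sym_algebra R M = modified_enveloping_algebra R M (\<lambda>_ _. \<zero>\<^bsub>M\<^esub>) (\<lambda>_ _. \<zero>)"
  by (simp add: sym_algebra_def modified_enveloping_algebra_def commutativity_ideal_eq[OF module_axioms])

lemma sym_inj_eq: "sym_inj R M = modified_enveloping_map R M (\<lambda>_ _. \<zero>\<^bsub>M\<^esub>) (\<lambda>_ _. \<zero>)"
  by (simp add: fun_eq_iff sym_inj_def modified_enveloping_map_def commutativity_ideal_eq[OF module_axioms])

lemma abelian_sridharan_data: "sridharan_data R M (\<lambda>_ _. \<zero>\<^bsub>M\<^esub>) (\<lambda>_ _. \<zero>)"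
  by unfold_locales simp_all

lemma sym_assoc_algebra: "assoc_algebra R (sym_algebra R M)"
  unfolding sym_algebra_eq by (rule sridharan_data.enveloping_assoc_algebra[OF abelian_sridharan_data])

lemma sym_inj_linear: "sym_inj R M \<in> linear_maps R M (sym_algebra R M)"
  unfolding sym_algebra_eq sym_inj_eq
  by (rule sridharan_data.enveloping_map_linear[OF abelian_sridharan_data])

lemma sym_generates: "generates R (sym_algebra R M) (sym_inj R M ` carrier M)"
  unfolding sym_algebra_eq sym_inj_eq
  by (rule sridharan_data.enveloping_generates[OF abelian_sridharan_data])

lemma sym_lift:
  assumes V: "assoc_algebra R V" and g: "g \<in> linear_maps R M V"
    and comm: "\<And>x y. \<lbrakk>x \<in> carrier M; y \<in> carrier M\<rbrakk> \<Longrightarrow> g x \<otimes>\<^bsub>V\<^esub> g y = g y \<otimes>\<^bsub>V\<^esub> g x"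
  obtains h where "h \<in> alg_homs R (sym_algebra R M) V"
    "\<And>x. x \<in> carrier M \<Longrightarrow> h (sym_inj R M x) = g x"
proof -
  interpret V: assoc_algebra R V by fact
  have "g \<zero>\<^bsub>M\<^esub> = \<zero>\<^bsub>V\<^esub>"
    by (rule linear_maps_minus(1)[OF module_axioms V.module_axioms g])
  hence "commutator V (g x) (g y) = g \<zero>\<^bsub>M\<^esub> \<oplus>\<^bsub>V\<^esub> \<zero> \<odot>\<^bsub>V\<^esub> \<one>\<^bsub>V\<^esub>"
    if "x \<in> carrier M" "y \<in> carrier M" for x y
    using that comm[OF that] linear_mapsD(1)[OF g]
    by (simp add: commutator_def V.minus_eq V.r_neg)
  from sridharan_data.enveloping_lift[OF abelian_sridharan_data V g this] that
  show thesis unfolding sym_algebra_eq sym_inj_eq by blast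
qed

end

lemma (in module) sym_algebra_algebra: "algebra R (sym_algebra R M)"
proof -
  let ?S = "sym_algebra R M" and ?s = "sym_inj R M"
  interpret S: assoc_algebra R ?S by (rule sym_assoc_algebra)
  have s: "?s x \<in> carrier ?S" if "x \<in> carrier M" for x
    using sym_inj_linear that by (rule linear_mapsD)
  have z: "?s \<zero>\<^bsub>M\<^esub> = \<zero>\<^bsub>?S\<^esub>"
    by (rule linear_maps_minus(1)[OF module_axioms S.module_axioms sym_inj_linear])
  have gens: "?s x \<otimes>\<^bsub>?S\<^esub> ?s y = ?s y \<otimes>\<^bsub>?S\<^esub> ?s x" if "x \<in> carrier M" "y \<in> carrier M" for x y
  proof -
    have "commutator ?S (?s x) (?s y) = ?s \<zero>\<^bsub>M\<^esub> \<oplus>\<^bsub>?S\<^esub> \<zero> \<odot>\<^bsub>?S\<^esub> \<one>\<^bsub>?S\<^esub>"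
      unfolding sym_algebra_eq sym_inj_eq
      by (rule sridharan_data.enveloping_map_commutator[OF abelian_sridharan_data that])
    thus ?thesis using s that z by (simp add: commutator_def S.r_right_minus_eq)
  qed
  have "a \<otimes>\<^bsub>?S\<^esub> b = b \<otimes>\<^bsub>?S\<^esub> a" if "a \<in> carrier ?S" "b \<in> carrier ?S" for a b
    using sym_generates sym_assoc_algebra _ that
    by (rule generates_commute) (auto simp: gens)
  hence "cring ?S"
    by (intro cring.intro comm_monoid.intro comm_monoid_axioms.intro S.ring_axioms S.is_monoid)
  thus ?thesis
    by (intro algebra.intro algebra_axioms.intro S.module_axioms S.smult_mult_left)
qed

section \<open>Derivations along a morphism\<close>

lemma algebra_assoc_algebra:
  assumes "algebra R A"
  shows "assoc_algebra R A"
proof -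
  interpret A: algebra R A by fact
  show ?thesis
  proof (rule assoc_algebraI[OF A.module_axioms A.ring_axioms A.smult_assoc2])
    show "x \<otimes>\<^bsub>A\<^esub> (r \<odot>\<^bsub>A\<^esub> y) = r \<odot>\<^bsub>A\<^esub> (x \<otimes>\<^bsub>A\<^esub> y)"
      if "r \<in> carrier R" "x \<in> carrier A" "y \<in> carrier A" for r x y
      using that A.smult_assoc2[of r y x] by (simp add: A.m_comm)
  qed
qed

lemma alpha_derivationsD:
  assumes "\<beta> \<in> alpha_derivations R A U \<alpha>"
  shows "\<beta> \<in> linear_maps R A U"
    and "\<lbrakk>a \<in> carrier A; b \<in> carrier A\<rbrakk> \<Longrightarrow> \<beta> (a \<otimes>\<^bsub>A\<^esub> b) = \<alpha> a \<otimes>\<^bsub>U\<^esub> \<beta> b \<oplus>\<^bsub>U\<^esub> \<alpha> b \<otimes>\<^bsub>U\<^esub> \<beta> a"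
  using assms by (auto simp: alpha_derivations_def)

lemma alpha_derivation_one:
  assumes A: "assoc_algebra R A" and U: "assoc_algebra R U" and \<alpha>: "\<alpha> \<in> alg_homs R A U"
    and \<beta>: "\<beta> \<in> alpha_derivations R A U \<alpha>"
  shows "\<beta> \<one>\<^bsub>A\<^esub> = \<zero>\<^bsub>U\<^esub>"
proof -
  interpret A: assoc_algebra R A by fact
  interpret U: assoc_algebra R U by fact
  have c: "\<beta> \<one>\<^bsub>A\<^esub> \<in> carrier U"
    using alpha_derivationsD(1)[OF \<beta>] by (rule linear_mapsD) simp
  have "\<beta> \<one>\<^bsub>A\<^esub> = \<beta> \<one>\<^bsub>A\<^esub> \<oplus>\<^bsub>U\<^esub> \<beta> \<one>\<^bsub>A\<^esub>"
    using alpha_derivationsD(2)[OF \<beta>, of "\<one>\<^bsub>A\<^esub>" "\<one>\<^bsub>A\<^esub>"] alg_homsD(3)[OF \<alpha>] c by simp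
  thus ?thesis using c by (metis U.add.r_cancel_one')
qed

lemma alpha_derivations_eq_on_generators:
  assumes gen: "generates R A Y" and A: "assoc_algebra R A" and U: "assoc_algebra R U"
    and \<alpha>: "\<alpha> \<in> alg_homs R A U"
    and f: "f \<in> alpha_derivations R A U \<alpha>" and g: "g \<in> alpha_derivations R A U \<alpha>"
    and eq: "\<And>x. x \<in> Y \<Longrightarrow> f x = g x" and a: "a \<in> carrier A"
  shows "f a = g a"
  using gen A a
proof (induction rule: generates_induct)
  case one show ?case by (simp add: alpha_derivation_one[OF A U \<alpha> f] alpha_derivation_one[OF A U \<alpha> g])
next
  case (gen x) thus ?case by (rule eq)
qed (simp_all add: alpha_derivationsD(2)[OF f] alpha_derivationsD(2)[OF g]
      linear_mapsD(2,3)[OF alpha_derivationsD(1)[OF f]] linear_mapsD(2,3)[OF alpha_derivationsD(1)[OF g]])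

text \<open>The sum \<open>A \<oplus> U\<close> in which \<open>U\<close> is an ideal of square zero on which \<open>A\<close> acts from both sides by
  \<open>a \<cdot> u = u \<cdot> a = \<alpha>(a) u\<close>. A map \<open>a \<mapsto> (a, \<beta> a)\<close> into it is multiplicative if and only if
  \<open>\<beta>\<close> satisfies the Leibniz rule of an \<open>\<alpha>\<close>-derivation.\<close>

definition square_zero_extension ::
  "('r, 'a, 'm) module_scheme \<Rightarrow> ('r, 'u, 'n) module_scheme \<Rightarrow> ('a \<Rightarrow> 'u) \<Rightarrow> ('r, 'a \<times> 'u) module"
  where "square_zero_extension A U \<alpha> =
    \<lparr>carrier = carrier A \<times> carrier U,
     monoid.mult = (\<lambda>(a, u) (b, v). (a \<otimes>\<^bsub>A\<^esub> b, \<alpha> a \<otimes>\<^bsub>U\<^esub> v \<oplus>\<^bsub>U\<^esub> \<alpha> b \<otimes>\<^bsub>U\<^esub> u)),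
     monoid.one = (\<one>\<^bsub>A\<^esub>, \<zero>\<^bsub>U\<^esub>),
     ring.zero = (\<zero>\<^bsub>A\<^esub>, \<zero>\<^bsub>U\<^esub>),
     ring.add = (\<lambda>(a, u) (b, v). (a \<oplus>\<^bsub>A\<^esub> b, u \<oplus>\<^bsub>U\<^esub> v)),
     smult = (\<lambda>r (a, u). (r \<odot>\<^bsub>A\<^esub> a, r \<odot>\<^bsub>U\<^esub> u))\<rparr>"

text \<open>In the product of \<open>(a, u)\<close>, \<open>(b, v)\<close> and \<open>(c, w)\<close> one bracketing contributes \<open>\<alpha>(c) \<alpha>(a) v\<close>
  and the other one \<open>\<alpha>(a) \<alpha>(c) v\<close>; these agree because \<open>A\<close> is commutative.\<close>

lemma square_zero_extension_assoc_algebra: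
  assumes A: "algebra R A" and U: "assoc_algebra R U" and \<alpha>: "\<alpha> \<in> alg_homs R A U"
  shows "assoc_algebra R (square_zero_extension A U \<alpha>)"
proof -
  interpret A: algebra R A by fact
  interpret A': assoc_algebra R A using A by (rule algebra_assoc_algebra)
  interpret U: assoc_algebra R U by fact
  let ?E = "square_zero_extension A U \<alpha>"
  note H = alg_homsD[OF \<alpha>]
  note L = linear_mapsD[OF H(1)] H(2,3)
    linear_maps_minus(1)[OF A.module_axioms U.module_axioms H(1)]
  have ab: "abelian_group ?E"
  proof (rule abelian_groupI)
    fix x assume "x \<in> carrier ?E"
    thus "\<exists>y\<in>carrier ?E. y \<oplus>\<^bsub>?E\<^esub> x = \<zero>\<^bsub>?E\<^esub>"
      by (intro bexI[of _ "(\<ominus>\<^bsub>A\<^esub> fst x, \<ominus>\<^bsub>U\<^esub> snd x)"])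
        (auto simp: square_zero_extension_def A.M.l_neg U.M.l_neg)
  qed (auto simp: square_zero_extension_def A.M.a_assoc A.M.a_comm A.M.a_lcomm U.a_assoc U.a_comm U.a_lcomm)
  have comm: "\<alpha> a \<otimes>\<^bsub>U\<^esub> (\<alpha> b \<otimes>\<^bsub>U\<^esub> u) = \<alpha> b \<otimes>\<^bsub>U\<^esub> (\<alpha> a \<otimes>\<^bsub>U\<^esub> u)"
    if "a \<in> carrier A" "b \<in> carrier A" "u \<in> carrier U" for a b u
    using that H(2)[of a b] H(2)[of b a] L(1) by (simp add: A.m_comm flip: U.m_assoc)
  have mon: "Group.monoid ?E"
  proof (rule Group.monoidI)
    fix x y z assume "x \<in> carrier ?E" "y \<in> carrier ?E" "z \<in> carrier ?E"
    thus "x \<otimes>\<^bsub>?E\<^esub> y \<otimes>\<^bsub>?E\<^esub> z = x \<otimes>\<^bsub>?E\<^esub> (y \<otimes>\<^bsub>?E\<^esub> z)"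
      by (auto simp: square_zero_extension_def L A.m_assoc U.m_assoc U.r_distr U.a_assoc comm)
  qed (auto simp: square_zero_extension_def L)
  have ri: "ring ?E"
    using ab mon
    by (rule ringI)
      (auto simp: square_zero_extension_def L A.l_distr A.r_distr U.l_distr U.r_distr
        U.a_assoc U.a_lcomm)
  have mo: "module R ?E"
    by (rule moduleI[OF A.R.is_cring ab])
      (auto simp: square_zero_extension_def A.smult_l_distr A.smult_r_distr A.smult_assoc1
        U.smult_l_distr U.smult_r_distr U.smult_assoc1)
  show ?thesis
    by (rule assoc_algebraI[OF mo ri])
      (auto simp: square_zero_extension_def L A'.smult_mult_left A'.smult_mult_right
        U.smult_mult_left U.smult_mult_right U.smult_r_distr)
qed

text \<open>The elements \<open>(s x, g x)\<close> of the square-zero extension commute pairwise, so \<open>x \<mapsto> (s x, g x)\<close>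
  extends to a morphism from the symmetric algebra. Its first component is the identity, since it is
  the identity on generators; its second component is the derivation.\<close>

lemma (in module) sym_derivation_exists:
  assumes U: "assoc_algebra R U" and \<alpha>: "\<alpha> \<in> alg_homs R (sym_algebra R M) U"
    and g: "g \<in> linear_maps R M U"
  obtains \<beta> where "\<beta> \<in> alpha_derivations R (sym_algebra R M) U \<alpha>"
    "\<And>x. x \<in> carrier M \<Longrightarrow> \<beta> (sym_inj R M x) = g x"
proof -
  let ?S = "sym_algebra R M" and ?s = "sym_inj R M"
  let ?E = "square_zero_extension ?S U \<alpha>"
  interpret S: algebra R ?S by (rule sym_algebra_algebra)
  interpret U: assoc_algebra R U by fact
  note s = linear_mapsD[OF sym_inj_linear] and g = linear_mapsD[OF g]
  have E: "assoc_algebra R ?E"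
    by (rule square_zero_extension_assoc_algebra[OF sym_algebra_algebra U \<alpha>])
  have lin: "(\<lambda>x. (?s x, g x)) \<in> linear_maps R M ?E"
    by (intro linear_mapsI) (simp_all add: square_zero_extension_def s g)
  have comm: "(?s x, g x) \<otimes>\<^bsub>?E\<^esub> (?s y, g y) = (?s y, g y) \<otimes>\<^bsub>?E\<^esub> (?s x, g x)"
    if "x \<in> carrier M" "y \<in> carrier M" for x y
    using that by (simp add: square_zero_extension_def s g S.m_comm U.a_comm
        linear_mapsD(1)[OF alg_homsD(1)[OF \<alpha>]])
  obtain h where h: "h \<in> alg_homs R ?S ?E" and hs: "\<And>x. x \<in> carrier M \<Longrightarrow> h (?s x) = (?s x, g x)"
    using sym_lift[OF E lin comm] by blast
  note H = alg_homsD(2,3)[OF h] linear_mapsD[OF alg_homsD(1)[OF h]]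
  have hc: "fst (h a) \<in> carrier ?S" "snd (h a) \<in> carrier U" if "a \<in> carrier ?S" for a
    using H(3)[OF that] by (auto simp: square_zero_extension_def)
  have ops:
    "fst (x \<otimes>\<^bsub>?E\<^esub> y) = fst x \<otimes>\<^bsub>?S\<^esub> fst y" "fst (x \<oplus>\<^bsub>?E\<^esub> y) = fst x \<oplus>\<^bsub>?S\<^esub> fst y"
    "fst (r \<odot>\<^bsub>?E\<^esub> x) = r \<odot>\<^bsub>?S\<^esub> fst x" "fst \<one>\<^bsub>?E\<^esub> = \<one>\<^bsub>?S\<^esub>"
    "snd (x \<oplus>\<^bsub>?E\<^esub> y) = snd x \<oplus>\<^bsub>U\<^esub> snd y" "snd (r \<odot>\<^bsub>?E\<^esub> x) = r \<odot>\<^bsub>U\<^esub> snd x"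
    "snd (x \<otimes>\<^bsub>?E\<^esub> y) = \<alpha> (fst x) \<otimes>\<^bsub>U\<^esub> snd y \<oplus>\<^bsub>U\<^esub> \<alpha> (fst y) \<otimes>\<^bsub>U\<^esub> snd x" for x y r
    by (simp_all add: square_zero_extension_def split_beta)
  have "(\<lambda>a. fst (h a)) \<in> alg_homs R ?S ?S"
    by (intro alg_homsI linear_mapsI) (simp_all add: ops H hc)
  moreover have "(\<lambda>a. a) \<in> alg_homs R ?S ?S"
    by (intro alg_homsI linear_mapsI) simp_all
  ultimately have fst_h: "fst (h a) = a" if "a \<in> carrier ?S" for a
    by (rule alg_homs_eq_on_generators[OF sym_generates sym_assoc_algebra _ _ _ that])
      (auto simp: hs)
  have "(\<lambda>a. snd (h a)) \<in> alpha_derivations R ?S U \<alpha>"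
    unfolding alpha_derivations_def
    by (intro CollectI conjI linear_mapsI ballI) (simp_all add: ops H hc fst_h)
  moreover have "snd (h (?s x)) = g x" if "x \<in> carrier M" for x
    using hs that by simp
  ultimately show thesis by (rule that)
qed

section \<open>Poisson brackets are determined and tested on generators\<close>

locale biderivation_algebra = algebra R A for R (structure) and A (structure) +
  fixes p
  assumes biderivation: "p \<in> biderivations R A"
begin

lemma bideriv_closed [simp, intro]: "\<lbrakk>a \<in> carrier A; b \<in> carrier A\<rbrakk> \<Longrightarrow> p a b \<in> carrier A"
  and bideriv_add_left: "\<lbrakk>a \<in> carrier A; b \<in> carrier A; c \<in> carrier A\<rbrakk> \<Longrightarrow> p (a \<oplus>\<^bsub>A\<^esub> b) c = p a c \<oplus>\<^bsub>A\<^esub> p b c"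
  and bideriv_add_right: "\<lbrakk>a \<in> carrier A; b \<in> carrier A; c \<in> carrier A\<rbrakk> \<Longrightarrow> p a (b \<oplus>\<^bsub>A\<^esub> c) = p a b \<oplus>\<^bsub>A\<^esub> p a c"
  and bideriv_smult_left: "\<lbrakk>r \<in> carrier R; a \<in> carrier A; b \<in> carrier A\<rbrakk> \<Longrightarrow> p (r \<odot>\<^bsub>A\<^esub> a) b = r \<odot>\<^bsub>A\<^esub> p a b"
  and bideriv_smult_right: "\<lbrakk>r \<in> carrier R; a \<in> carrier A; b \<in> carrier A\<rbrakk> \<Longrightarrow> p a (r \<odot>\<^bsub>A\<^esub> b) = r \<odot>\<^bsub>A\<^esub> p a b"
  and bideriv_mult_left: "\<lbrakk>a \<in> carrier A; b \<in> carrier A; c \<in> carrier A\<rbrakk> \<Longrightarrow>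
      p (a \<otimes>\<^bsub>A\<^esub> b) c = a \<otimes>\<^bsub>A\<^esub> p b c \<oplus>\<^bsub>A\<^esub> b \<otimes>\<^bsub>A\<^esub> p a c"
  and bideriv_mult_right: "\<lbrakk>a \<in> carrier A; b \<in> carrier A; c \<in> carrier A\<rbrakk> \<Longrightarrow>
      p a (b \<otimes>\<^bsub>A\<^esub> c) = b \<otimes>\<^bsub>A\<^esub> p a c \<oplus>\<^bsub>A\<^esub> c \<otimes>\<^bsub>A\<^esub> p a b"
  using biderivation by (auto simp: biderivations_def bilinear_maps_def linear_maps_def)

lemma id_alg_hom: "(\<lambda>a. a) \<in> alg_homs R A A"
  by (intro alg_homsI linear_mapsI) simp_all

lemma derivation_left: "c \<in> carrier A \<Longrightarrow> (\<lambda>a. p a c) \<in> alpha_derivations R A A (\<lambda>a. a)"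
  and derivation_right: "c \<in> carrier A \<Longrightarrow> p c \<in> alpha_derivations R A A (\<lambda>a. a)"
  by (auto simp: alpha_derivations_def bideriv_mult_left bideriv_mult_right
      bideriv_add_left bideriv_add_right bideriv_smult_left bideriv_smult_right intro!: linear_mapsI)

lemma bideriv_one_left: "c \<in> carrier A \<Longrightarrow> p \<one>\<^bsub>A\<^esub> c = \<zero>\<^bsub>A\<^esub>"
  and bideriv_one_right: "c \<in> carrier A \<Longrightarrow> p c \<one>\<^bsub>A\<^esub> = \<zero>\<^bsub>A\<^esub>"
  using alpha_derivation_one[OF _ _ id_alg_hom derivation_left]
    alpha_derivation_one[OF _ _ id_alg_hom derivation_right]
    algebra_assoc_algebra[OF algebra_axioms] by blast+

lemma bideriv_zero_left: "c \<in> carrier A \<Longrightarrow> p \<zero>\<^bsub>A\<^esub> c = \<zero>\<^bsub>A\<^esub>"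
  using bideriv_smult_left[of \<zero> "\<one>\<^bsub>A\<^esub>" c] by simp

end

lemma biderivations_eq_on_generators:
  assumes gen: "generates R A Y" and A: "algebra R A"
    and p: "p \<in> biderivations R A" and q: "q \<in> biderivations R A"
    and eq: "\<And>x y. \<lbrakk>x \<in> Y; y \<in> Y\<rbrakk> \<Longrightarrow> p x y = q x y" and a: "a \<in> carrier A" and b: "b \<in> carrier A"
  shows "p a b = q a b"
proof -
  interpret p: biderivation_algebra R A p
    using A p by (intro biderivation_algebra.intro biderivation_algebra_axioms.intro)
  interpret q: biderivation_algebra R A q
    using A q by (intro biderivation_algebra.intro biderivation_algebra_axioms.intro)
  have A': "assoc_algebra R A" using A by (rule algebra_assoc_algebra)
  have Y: "y \<in> carrier A" if "y \<in> Y" for y using gen that by (auto simp: generates_def)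
  have 1: "p x b = q x b" if "x \<in> Y" for x
    using gen A' A' p.id_alg_hom p.derivation_right[OF Y[OF that]] q.derivation_right[OF Y[OF that]]
      eq[OF that] b by (rule alpha_derivations_eq_on_generators)
  show ?thesis
    using gen A' A' p.id_alg_hom p.derivation_left[OF b] q.derivation_left[OF b] 1 a
    by (rule alpha_derivations_eq_on_generators)
qed

text \<open>The expansion of the jacobiator of a product, with \<open>t, u, v, w\<close> standing for the brackets
  \<open>{b, d}, {b, c}, {a, d}, {a, c}\<close>: the products of two brackets cancel by antisymmetry, and what
  remains is the Leibniz rule for the jacobiator.\<close>

lemma (in cring) jacobi_product_identity:
  assumes "a \<in> carrier R" "b \<in> carrier R" "x1 \<in> carrier R" "x2 \<in> carrier R" "x3 \<in> carrier R"
    "y1 \<in> carrier R" "y2 \<in> carrier R" "y3 \<in> carrier R"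
    "t \<in> carrier R" "u \<in> carrier R" "v \<in> carrier R" "w \<in> carrier R"
  shows "((a \<otimes> x1 \<oplus> u \<otimes> v) \<oplus> (b \<otimes> y1 \<oplus> w \<otimes> t)) \<oplus> (a \<otimes> x2 \<oplus> b \<otimes> y2) \<oplus>
      ((a \<otimes> x3 \<oplus> (\<ominus> t) \<otimes> w) \<oplus> (b \<otimes> y3 \<oplus> (\<ominus> v) \<otimes> u)) =
    a \<otimes> (x1 \<oplus> x2 \<oplus> x3) \<oplus> b \<otimes> (y1 \<oplus> y2 \<oplus> y3)"
  using assms by algebra

context biderivation_algebra
begin

definition jacobiator where "jacobiator a b c = p (p a b) c \<oplus>\<^bsub>A\<^esub> p (p b c) a \<oplus>\<^bsub>A\<^esub> p (p c a) b"

lemma jacobiator_cyclic: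
  "\<lbrakk>a \<in> carrier A; b \<in> carrier A; c \<in> carrier A\<rbrakk> \<Longrightarrow> jacobiator a b c = jacobiator b c a"
  by (simp add: jacobiator_def M.a_assoc M.a_comm M.a_lcomm)

text \<open>The symmetrisation \<open>p a b + p b a\<close> is a derivation in each argument.\<close>

lemma antisymmetric_from_generators:
  assumes gen: "generates R A Y"
    and anti: "\<And>x y. \<lbrakk>x \<in> Y; y \<in> Y\<rbrakk> \<Longrightarrow> p x y \<oplus>\<^bsub>A\<^esub> p y x = \<zero>\<^bsub>A\<^esub>"
    and a: "a \<in> carrier A" and b: "b \<in> carrier A"
  shows "p a b \<oplus>\<^bsub>A\<^esub> p b a = \<zero>\<^bsub>A\<^esub>"
proof -
  have A': "assoc_algebra R A" using algebra_axioms by (rule algebra_assoc_algebra)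
  have Y: "y \<in> carrier A" if "y \<in> Y" for y using gen that by (auto simp: generates_def)
  have step: "p a c \<oplus>\<^bsub>A\<^esub> p c a = \<zero>\<^bsub>A\<^esub>"
    if c: "c \<in> carrier A" and base: "\<And>y. y \<in> Y \<Longrightarrow> p y c \<oplus>\<^bsub>A\<^esub> p c y = \<zero>\<^bsub>A\<^esub>" and a: "a \<in> carrier A" for a c
    using gen A' a
  proof (induction rule: generates_induct)
    case one thus ?case using c by (simp add: bideriv_one_left bideriv_one_right)
  next
    case (gen x) thus ?case by (rule base)
  next
    case (add a b)
    have "p (a \<oplus>\<^bsub>A\<^esub> b) c \<oplus>\<^bsub>A\<^esub> p c (a \<oplus>\<^bsub>A\<^esub> b) = (p a c \<oplus>\<^bsub>A\<^esub> p c a) \<oplus>\<^bsub>A\<^esub> (p b c \<oplus>\<^bsub>A\<^esub> p c b)"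
      using add(1,2) c by (simp add: bideriv_add_left bideriv_add_right M.a_assoc M.a_lcomm)
    thus ?case using add by simp
  next
    case (mult a b)
    have "p (a \<otimes>\<^bsub>A\<^esub> b) c \<oplus>\<^bsub>A\<^esub> p c (a \<otimes>\<^bsub>A\<^esub> b) =
        a \<otimes>\<^bsub>A\<^esub> (p b c \<oplus>\<^bsub>A\<^esub> p c b) \<oplus>\<^bsub>A\<^esub> b \<otimes>\<^bsub>A\<^esub> (p a c \<oplus>\<^bsub>A\<^esub> p c a)"
      using mult(1,2) c by (simp add: bideriv_mult_left bideriv_mult_right M.a_assoc M.a_lcomm r_distr)
    thus ?case using mult by simp
  next
    case (smult r a)
    have "p (r \<odot>\<^bsub>A\<^esub> a) c \<oplus>\<^bsub>A\<^esub> p c (r \<odot>\<^bsub>A\<^esub> a) = r \<odot>\<^bsub>A\<^esub> (p a c \<oplus>\<^bsub>A\<^esub> p c a)"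
      using smult(1,2) c by (simp add: bideriv_smult_left bideriv_smult_right smult_r_distr)
    thus ?case using smult by simp
  qed
  have "p x b \<oplus>\<^bsub>A\<^esub> p b x = \<zero>\<^bsub>A\<^esub>" if "x \<in> Y" for x
    using step[of x b] Y[OF that] b anti[OF that] anti[OF _ that] M.a_comm by auto
  thus ?thesis using step[OF b _ a] by blast
qed

text \<open>Over a ring in which \<open>2\<close> may be a zero divisor, \<open>p a a = 0\<close> does not follow from
  antisymmetry. But \<open>a \<mapsto> p a a\<close> is quadratic, and its polarisation vanishes by antisymmetry, so
  \<open>p (a b) (a b)\<close> reduces to \<open>a\<^sup>2 p b b + b\<^sup>2 p a a\<close>.\<close>

lemma alternating_from_generators:
  assumes gen: "generates R A Y"
    and anti: "\<And>x y. \<lbrakk>x \<in> Y; y \<in> Y\<rbrakk> \<Longrightarrow> p x y \<oplus>\<^bsub>A\<^esub> p y x = \<zero>\<^bsub>A\<^esub>"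
    and alt: "\<And>x. x \<in> Y \<Longrightarrow> p x x = \<zero>\<^bsub>A\<^esub>"
    and a: "a \<in> carrier A"
  shows "p a a = \<zero>\<^bsub>A\<^esub>"
proof -
  note skew = antisymmetric_from_generators[OF gen anti]
  have A': "assoc_algebra R A" using algebra_axioms by (rule algebra_assoc_algebra)
  show ?thesis
    using gen A' a
  proof (induction rule: generates_induct)
    case one thus ?case by (simp add: bideriv_one_left)
  next
    case (gen x) thus ?case by (rule alt)
  next
    case (add a b)
    thus ?case using skew[of b a] by (simp add: bideriv_add_left bideriv_add_right)
  next
    case (mult a b)
    have "p (a \<otimes>\<^bsub>A\<^esub> b) (a \<otimes>\<^bsub>A\<^esub> b) =
       (a \<otimes>\<^bsub>A\<^esub> b) \<otimes>\<^bsub>A\<^esub> (p a b \<oplus>\<^bsub>A\<^esub> p b a) \<oplus>\<^bsub>A\<^esub> ((a \<otimes>\<^bsub>A\<^esub> a) \<otimes>\<^bsub>A\<^esub> p b b \<oplus>\<^bsub>A\<^esub> (b \<otimes>\<^bsub>A\<^esub> b) \<otimes>\<^bsub>A\<^esub> p a a)"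
      using mult(1,2)
      by (simp add: bideriv_mult_left bideriv_mult_right r_distr m_assoc m_lcomm M.a_assoc M.a_lcomm M.a_comm)
    thus ?case using mult skew[of a b] skew[of b a] by simp
  next
    case (smult r a)
    thus ?case by (simp add: bideriv_smult_left bideriv_smult_right)
  qed
qed

text \<open>Given antisymmetry, the jacobiator is a derivation in its first argument, and it is invariant under
  cyclic permutations. This allows the generators to be replaced by arbitrary elements in one
  argument after the other.\<close>

lemma jacobi_from_generators:
  assumes gen: "generates R A Y"
    and skew: "\<And>a b. \<lbrakk>a \<in> carrier A; b \<in> carrier A\<rbrakk> \<Longrightarrow> p a b \<oplus>\<^bsub>A\<^esub> p b a = \<zero>\<^bsub>A\<^esub>"
    and jac: "\<And>x y z. \<lbrakk>x \<in> Y; y \<in> Y; z \<in> Y\<rbrakk> \<Longrightarrow> jacobiator x y z = \<zero>\<^bsub>A\<^esub>"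
    and a: "a \<in> carrier A" and b: "b \<in> carrier A" and c: "c \<in> carrier A"
  shows "jacobiator a b c = \<zero>\<^bsub>A\<^esub>"
proof -
  have A': "assoc_algebra R A" using algebra_axioms by (rule algebra_assoc_algebra)
  have Y: "y \<in> carrier A" if "y \<in> Y" for y using gen that by (auto simp: generates_def)
  have neg: "p b a = \<ominus>\<^bsub>A\<^esub> p a b" if "a \<in> carrier A" "b \<in> carrier A" for a b
    using that skew[of b a] M.minus_equality[of "p b a" "p a b"] by simp
  have step: "jacobiator a c d = \<zero>\<^bsub>A\<^esub>"
    if c: "c \<in> carrier A" and d: "d \<in> carrier A"
      and base: "\<And>y. y \<in> Y \<Longrightarrow> jacobiator y c d = \<zero>\<^bsub>A\<^esub>" and a: "a \<in> carrier A" for a c d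
    using gen A' a
  proof (induction rule: generates_induct)
    case one thus ?case using c d
      by (simp add: jacobiator_def bideriv_one_left bideriv_one_right bideriv_zero_left)
  next
    case (gen x) thus ?case by (rule base)
  next
    case (add a b)
    have "jacobiator (a \<oplus>\<^bsub>A\<^esub> b) c d = jacobiator a c d \<oplus>\<^bsub>A\<^esub> jacobiator b c d"
      using add(1,2) c d
      by (simp add: jacobiator_def bideriv_add_left bideriv_add_right M.a_assoc M.a_lcomm M.a_comm)
    thus ?case using add by simp
  next
    case (mult a b)
    have "jacobiator (a \<otimes>\<^bsub>A\<^esub> b) c d =
      ((a \<otimes>\<^bsub>A\<^esub> p (p b c) d \<oplus>\<^bsub>A\<^esub> p b c \<otimes>\<^bsub>A\<^esub> p a d) \<oplus>\<^bsub>A\<^esub> (b \<otimes>\<^bsub>A\<^esub> p (p a c) d \<oplus>\<^bsub>A\<^esub> p a c \<otimes>\<^bsub>A\<^esub> p b d)) \<oplus>\<^bsub>A\<^esub>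
      (a \<otimes>\<^bsub>A\<^esub> p (p c d) b \<oplus>\<^bsub>A\<^esub> b \<otimes>\<^bsub>A\<^esub> p (p c d) a) \<oplus>\<^bsub>A\<^esub>
      ((a \<otimes>\<^bsub>A\<^esub> p (p d b) c \<oplus>\<^bsub>A\<^esub> p d b \<otimes>\<^bsub>A\<^esub> p a c) \<oplus>\<^bsub>A\<^esub> (b \<otimes>\<^bsub>A\<^esub> p (p d a) c \<oplus>\<^bsub>A\<^esub> p d a \<otimes>\<^bsub>A\<^esub> p b c))"
      using mult(1,2) c d
      by (simp add: jacobiator_def bideriv_add_left bideriv_mult_left bideriv_mult_right)
    also have "\<dots> =
      ((a \<otimes>\<^bsub>A\<^esub> p (p b c) d \<oplus>\<^bsub>A\<^esub> p b c \<otimes>\<^bsub>A\<^esub> p a d) \<oplus>\<^bsub>A\<^esub> (b \<otimes>\<^bsub>A\<^esub> p (p a c) d \<oplus>\<^bsub>A\<^esub> p a c \<otimes>\<^bsub>A\<^esub> p b d)) \<oplus>\<^bsub>A\<^esub>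
      (a \<otimes>\<^bsub>A\<^esub> p (p c d) b \<oplus>\<^bsub>A\<^esub> b \<otimes>\<^bsub>A\<^esub> p (p c d) a) \<oplus>\<^bsub>A\<^esub>
      ((a \<otimes>\<^bsub>A\<^esub> p (p d b) c \<oplus>\<^bsub>A\<^esub> (\<ominus>\<^bsub>A\<^esub> p b d) \<otimes>\<^bsub>A\<^esub> p a c) \<oplus>\<^bsub>A\<^esub>
       (b \<otimes>\<^bsub>A\<^esub> p (p d a) c \<oplus>\<^bsub>A\<^esub> (\<ominus>\<^bsub>A\<^esub> p a d) \<otimes>\<^bsub>A\<^esub> p b c))"
      by (simp only: neg[OF mult(2) d, symmetric] neg[OF mult(1) d, symmetric])
    also have "\<dots> = a \<otimes>\<^bsub>A\<^esub> jacobiator b c d \<oplus>\<^bsub>A\<^esub> b \<otimes>\<^bsub>A\<^esub> jacobiator a c d"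
      unfolding jacobiator_def
      by (rule jacobi_product_identity) (use mult(1,2) c d in auto)
    finally show ?case using mult by simp
  next
    case (smult r a)
    have "jacobiator (r \<odot>\<^bsub>A\<^esub> a) c d = r \<odot>\<^bsub>A\<^esub> jacobiator a c d"
      using smult(1,2) c d
      by (simp add: jacobiator_def bideriv_smult_left bideriv_smult_right smult_r_distr)
    thus ?case using smult by simp
  qed
  have 1: "jacobiator u y z = \<zero>\<^bsub>A\<^esub>" if "u \<in> carrier A" "y \<in> Y" "z \<in> Y" for u y z
    using step[OF Y Y] that jac by blast
  have 2: "jacobiator u v z = \<zero>\<^bsub>A\<^esub>" if "u \<in> carrier A" "v \<in> carrier A" "z \<in> Y" for u v z
  proof -
    have "jacobiator y z u = \<zero>\<^bsub>A\<^esub>" if "y \<in> Y" for y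
      using 1[OF \<open>u \<in> carrier A\<close> that \<open>z \<in> Y\<close>] jacobiator_cyclic[OF \<open>u \<in> carrier A\<close> Y[OF that] Y[OF \<open>z \<in> Y\<close>]]
      by simp
    hence "jacobiator v z u = \<zero>\<^bsub>A\<^esub>"
      using step[OF Y[OF \<open>z \<in> Y\<close>] \<open>u \<in> carrier A\<close> _ \<open>v \<in> carrier A\<close>]
      by blast
    thus ?thesis using jacobiator_cyclic[OF that(1,2) Y[OF that(3)]] by simp
  qed
  have "jacobiator y b c = \<zero>\<^bsub>A\<^esub>" if "y \<in> Y" for y
    using 2[OF b c that] jacobiator_cyclic[OF Y[OF that] b c] by simp
  from step[OF b c this a] show ?thesis .
qed

lemma poisson_algebra_from_generators:
  assumes gen: "generates R A Y"
    and anti: "\<And>x y. \<lbrakk>x \<in> Y; y \<in> Y\<rbrakk> \<Longrightarrow> p x y \<oplus>\<^bsub>A\<^esub> p y x = \<zero>\<^bsub>A\<^esub>"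
    and alt: "\<And>x. x \<in> Y \<Longrightarrow> p x x = \<zero>\<^bsub>A\<^esub>"
    and jac: "\<And>x y z. \<lbrakk>x \<in> Y; y \<in> Y; z \<in> Y\<rbrakk> \<Longrightarrow> jacobiator x y z = \<zero>\<^bsub>A\<^esub>"
  shows "poisson_algebra R A p"
proof (intro poisson_algebra.intro poisson_algebra_axioms.intro lie_algebra.intro
    lie_algebra_axioms.intro algebra_axioms module_axioms)
  show "p \<in> bilinear_maps R A A"
    using biderivation by (simp add: biderivations_def)
  show "p x x = \<zero>\<^bsub>A\<^esub>" if "x \<in> carrier A" for x
    using gen anti alt that by (rule alternating_from_generators)
  show "p (p x y) z \<oplus>\<^bsub>A\<^esub> p (p y z) x \<oplus>\<^bsub>A\<^esub> p (p z x) y = \<zero>\<^bsub>A\<^esub>"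
    if "x \<in> carrier A" "y \<in> carrier A" "z \<in> carrier A" for x y z
    using jacobi_from_generators[OF gen antisymmetric_from_generators[OF gen anti] jac that]
    by (simp add: jacobiator_def)
qed (rule bideriv_mult_left)

end

section \<open>Poisson triples are tested on generators\<close>

lemma (in ring) commutator_rules:
  assumes "a \<in> carrier R"
  shows "b \<in> carrier R \<Longrightarrow> commutator R a b \<in> carrier R"
    and "\<lbrakk>b \<in> carrier R; c \<in> carrier R\<rbrakk> \<Longrightarrow>
      commutator R (a \<oplus> b) c = commutator R a c \<oplus> commutator R b c"
    and "\<lbrakk>b \<in> carrier R; c \<in> carrier R\<rbrakk> \<Longrightarrow>
      commutator R a (b \<oplus> c) = commutator R a b \<oplus> commutator R a c"
    and "\<lbrakk>b \<in> carrier R; c \<in> carrier R\<rbrakk> \<Longrightarrow>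
      commutator R (a \<otimes> b) c = a \<otimes> commutator R b c \<oplus> commutator R a c \<otimes> b"
    and "\<lbrakk>b \<in> carrier R; c \<in> carrier R\<rbrakk> \<Longrightarrow>
      commutator R a (b \<otimes> c) = b \<otimes> commutator R a c \<oplus> commutator R a b \<otimes> c"
    and "b \<in> carrier R \<Longrightarrow> \<ominus> commutator R b a = commutator R a b"
    and "commutator R \<one> a = \<zero>" and "commutator R a \<zero> = \<zero>" and "commutator R \<zero> a = \<zero>"
  using assms unfolding commutator_def
  by (simp, algebra, algebra, algebra, algebra, algebra, simp_all add: minus_eq r_neg)

lemma (in assoc_algebra) commutator_smult:
  assumes "r \<in> carrier R" "a \<in> carrier A" "b \<in> carrier A"
  shows "commutator A (r \<odot>\<^bsub>A\<^esub> a) b = r \<odot>\<^bsub>A\<^esub> commutator A a b"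
    and "commutator A a (r \<odot>\<^bsub>A\<^esub> b) = r \<odot>\<^bsub>A\<^esub> commutator A a b"
  using assms
  by (simp_all add: commutator_def smult_mult_left smult_mult_right M.minus_eq smult_r_distr smult_r_minus)

text \<open>Both conditions are Leibniz-type identities in each argument. For the first one,
  \<open>\<alpha>{a, c} = [\<alpha> a, \<beta> c]\<close>, multiplicativity in \<open>a\<close> needs \<open>[\<alpha> a, \<beta> c]\<close> to commute with
  \<open>\<alpha> b\<close>, which holds by induction since it is the image of \<open>{a, c}\<close> under \<open>\<alpha>\<close>. The first
  condition for all elements then provides the mixed terms in the Leibniz rule for the second one,
  \<open>\<beta>{a, c} = [\<beta> a, \<beta> c]\<close>; there one argument suffices, as both sides are antisymmetric.\<close>

lemma poisson_triple_from_generators: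
  assumes gen: "generates R A Y" and P: "poisson_algebra R A p"
    and U: "assoc_algebra R U" and \<alpha>: "\<alpha> \<in> alg_homs R A U"
    and \<beta>: "\<beta> \<in> alpha_derivations R A U \<alpha>"
    and \<alpha>\<beta>: "\<And>x y. \<lbrakk>x \<in> Y; y \<in> Y\<rbrakk> \<Longrightarrow> \<alpha> (p x y) = commutator U (\<alpha> x) (\<beta> y)"
    and \<beta>\<beta>: "\<And>x y. \<lbrakk>x \<in> Y; y \<in> Y\<rbrakk> \<Longrightarrow> \<beta> (p x y) = commutator U (\<beta> x) (\<beta> y)"
  shows "poisson_triple R A p U \<alpha> \<beta>"
proof -
  interpret A: poisson_algebra R A p by fact
  interpret A': assoc_algebra R A using A.algebra_axioms by (rule algebra_assoc_algebra)
  interpret U: assoc_algebra R U by fact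
  have A': "assoc_algebra R A" ..
  have skew: "p a b = \<ominus>\<^bsub>A\<^esub> p b a" if a: "a \<in> carrier A" and b: "b \<in> carrier A" for a b
    using bilinear_maps_skew[OF A.module_axioms A.module_axioms A.bracket_bilinear A.bracket_alternating a b]
      linear_mapsD(1)[OF bilinear_mapsD(1)[OF A.bracket_bilinear a] b]
      linear_mapsD(1)[OF bilinear_mapsD(1)[OF A.bracket_bilinear b] a]
      A.M.minus_equality[of "p a b" "p b a"] by simp
  have bid: "p \<in> biderivations R A"
  proof -
    have cl: "p x y \<in> carrier A" if "x \<in> carrier A" "y \<in> carrier A" for x y
      using A.bracket_bilinear that by (auto simp: bilinear_maps_def linear_maps_def)
    have "p a (b \<otimes>\<^bsub>A\<^esub> c) = b \<otimes>\<^bsub>A\<^esub> p a c \<oplus>\<^bsub>A\<^esub> c \<otimes>\<^bsub>A\<^esub> p a b"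
      if "a \<in> carrier A" "b \<in> carrier A" "c \<in> carrier A" for a b c
      using that cl by (simp add: skew[of a "b \<otimes>\<^bsub>A\<^esub> c"] skew[of a b] skew[of a c] A.leibniz
          A.M.minus_add A.r_minus A.M.a_comm)
    thus ?thesis using A.bracket_bilinear A.leibniz by (auto simp: biderivations_def)
  qed
  interpret A: biderivation_algebra R A p
    using bid A.algebra_axioms by (intro biderivation_algebra.intro biderivation_algebra_axioms.intro)
  have Y: "y \<in> carrier A" if "y \<in> Y" for y using gen that by (auto simp: generates_def)
  note a = linear_mapsD[OF alg_homsD(1)[OF \<alpha>]] alg_homsD(2,3)[OF \<alpha>]
    linear_maps_minus(1)[OF A.module_axioms U.module_axioms alg_homsD(1)[OF \<alpha>]]
  note b = linear_mapsD[OF alpha_derivationsD(1)[OF \<beta>]] alpha_derivationsD(2)[OF \<beta>]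
    alpha_derivation_one[OF A' U \<alpha> \<beta>]
    linear_maps_minus(1,2)[OF A.module_axioms U.module_axioms alpha_derivationsD(1)[OF \<beta>]]
  note comm = U.commutator_rules U.commutator_smult
  have acomm: "\<alpha> x \<otimes>\<^bsub>U\<^esub> \<alpha> y = \<alpha> y \<otimes>\<^bsub>U\<^esub> \<alpha> x" if "x \<in> carrier A" "y \<in> carrier A" for x y
    using that a(4)[of x y] a(4)[of y x] by (simp add: A.m_comm)
  have left: "\<alpha> (p u y) = commutator U (\<alpha> u) (\<beta> y)" if y: "y \<in> Y" and u: "u \<in> carrier A" for u y
    using gen A' u
  proof (induction rule: generates_induct)
    case (mult u v)
    have "commutator U (\<alpha> u) (\<beta> y) \<otimes>\<^bsub>U\<^esub> \<alpha> v = \<alpha> v \<otimes>\<^bsub>U\<^esub> commutator U (\<alpha> u) (\<beta> y)"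
      using mult acomm[of "p u y" v] Y[OF y] by simp
    thus ?case
      using mult Y[OF y] a b by (simp add: A.bideriv_mult_left comm)
  qed (use Y[OF y] \<alpha>\<beta> y in \<open>simp_all add: a b comm A.bideriv_one_left A.bideriv_add_left A.bideriv_smult_left\<close>)
  have mixed: "\<alpha> (p u v) = commutator U (\<alpha> u) (\<beta> v)" if u: "u \<in> carrier A" and v: "v \<in> carrier A" for u v
    using gen A' v
  proof (induction rule: generates_induct)
    case (mult v w)
    have "commutator U (\<alpha> u) (\<alpha> v) = \<zero>\<^bsub>U\<^esub>" "commutator U (\<alpha> u) (\<alpha> w) = \<zero>\<^bsub>U\<^esub>"
      using acomm[OF u] mult(1,2) u a(1) by (simp_all add: commutator_def U.minus_eq U.r_neg)
    thus ?case
      using mult u a b by (simp add: A.bideriv_mult_right comm)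
  qed (use left u in \<open>simp_all add: a b comm A.bideriv_one_right A.bideriv_add_right A.bideriv_smult_right\<close>)
  have step: "\<beta> (p u w) = commutator U (\<beta> u) (\<beta> w)"
    if w: "w \<in> carrier A" and base: "\<And>y. y \<in> Y \<Longrightarrow> \<beta> (p y w) = commutator U (\<beta> y) (\<beta> w)"
      and u: "u \<in> carrier A" for u w
    using gen A' u
  proof (induction rule: generates_induct)
    case (mult u v)
    thus ?case
      using w by (simp add: A.bideriv_mult_left a b comm mixed[symmetric] U.a_assoc U.a_comm U.a_lcomm)
  qed (use w base in \<open>simp_all add: a b comm A.bideriv_one_left A.bideriv_add_left A.bideriv_smult_left\<close>)
  have gen_left: "\<beta> (p y w) = commutator U (\<beta> y) (\<beta> w)" if y: "y \<in> Y" and w: "w \<in> carrier A" for y w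
  proof -
    have "\<beta> (p w y) = commutator U (\<beta> w) (\<beta> y)"
      using step[OF Y[OF y] _ w] \<beta>\<beta>[OF _ y] by blast
    thus ?thesis
      using skew[OF Y[OF y] w] Y[OF y] w b comm(6)[of "\<beta> y" "\<beta> w"] by simp
  qed
  have "\<beta> (p u w) = commutator U (\<beta> u) (\<beta> w)" if "u \<in> carrier A" "w \<in> carrier A" for u w
    using step[OF that(2) gen_left that(1)] that(2) by blast
  thus ?thesis
    using mixed U \<alpha> alpha_derivationsD[OF \<beta>]
    by (simp add: poisson_triple_def lie_homs_def commutator_def)
qed

section \<open>The modified Lie-Poisson algebra\<close>

text \<open>Viewing \<open>\<sigma>\<close> as a bilinear map into the regular module makes the facts on bilinear maps between
  modules applicable to it.\<close>

lemma module_regular_module: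
  assumes "cring R"
  shows "module R (regular_module R)"
proof -
  interpret cring R by fact
  have "abelian_group (regular_module R)"
  proof (rule abelian_groupI)
    show "\<exists>y\<in>carrier (regular_module R). y \<oplus>\<^bsub>regular_module R\<^esub> x = \<zero>\<^bsub>regular_module R\<^esub>"
      if "x \<in> carrier (regular_module R)" for x
      using that by (intro bexI[of _ "\<ominus>\<^bsub>R\<^esub> x"]) (auto simp: regular_module_def l_neg)
  qed (auto simp: regular_module_def a_assoc a_comm a_lcomm)
  thus ?thesis
    by (intro moduleI is_cring) (auto simp: regular_module_def l_distr r_distr m_assoc)
qed

context two_cocycle
begin

abbreviation "S \<equiv> sym_algebra R L"
abbreviation "s \<equiv> sym_inj R L"

lemma bracket_rules:
  assumes "x \<in> carrier L" "y \<in> carrier L"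
  shows "bracket x y \<in> carrier L" "bracket x y \<oplus>\<^bsub>L\<^esub> bracket y x = \<zero>\<^bsub>L\<^esub>"
    "bracket x \<zero>\<^bsub>L\<^esub> = \<zero>\<^bsub>L\<^esub>" "bracket \<zero>\<^bsub>L\<^esub> x = \<zero>\<^bsub>L\<^esub>"
    "z \<in> carrier L \<Longrightarrow> bracket (x \<oplus>\<^bsub>L\<^esub> y) z = bracket x z \<oplus>\<^bsub>L\<^esub> bracket y z"
    "z \<in> carrier L \<Longrightarrow> bracket x (y \<oplus>\<^bsub>L\<^esub> z) = bracket x y \<oplus>\<^bsub>L\<^esub> bracket x z"
    "r \<in> carrier R \<Longrightarrow> bracket (r \<odot>\<^bsub>L\<^esub> x) y = r \<odot>\<^bsub>L\<^esub> bracket x y"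
    "r \<in> carrier R \<Longrightarrow> bracket x (r \<odot>\<^bsub>L\<^esub> y) = r \<odot>\<^bsub>L\<^esub> bracket x y"
  using bilinear_mapsD[OF bracket_bilinear] assms
    bilinear_maps_skew[OF module_axioms module_axioms bracket_bilinear bracket_alternating]
    linear_maps_minus(1)[OF module_axioms module_axioms bilinear_mapsD(1)[OF bracket_bilinear], of x]
    linear_maps_minus(1)[OF module_axioms module_axioms bilinear_mapsD(2)[OF bracket_bilinear], of x]
  by (auto dest: linear_mapsD)

lemma cocycle_rules:
  assumes "x \<in> carrier L" "y \<in> carrier L"
  shows "\<sigma> x y \<in> carrier R" "\<sigma> x y \<oplus> \<sigma> y x = \<zero>"
    "\<sigma> x \<zero>\<^bsub>L\<^esub> = \<zero>" "\<sigma> \<zero>\<^bsub>L\<^esub> x = \<zero>"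
    "z \<in> carrier L \<Longrightarrow> \<sigma> (x \<oplus>\<^bsub>L\<^esub> y) z = \<sigma> x z \<oplus> \<sigma> y z"
    "z \<in> carrier L \<Longrightarrow> \<sigma> x (y \<oplus>\<^bsub>L\<^esub> z) = \<sigma> x y \<oplus> \<sigma> x z"
    "r \<in> carrier R \<Longrightarrow> \<sigma> (r \<odot>\<^bsub>L\<^esub> x) y = r \<otimes> \<sigma> x y"
    "r \<in> carrier R \<Longrightarrow> \<sigma> x (r \<odot>\<^bsub>L\<^esub> y) = r \<otimes> \<sigma> x y"
proof -
  note reg = module_regular_module[OF R.is_cring]
  have simps: "carrier (regular_module R) = carrier R" "\<zero>\<^bsub>regular_module R\<^esub> = \<zero>"
    "a \<oplus>\<^bsub>regular_module R\<^esub> b = a \<oplus> b" "a \<odot>\<^bsub>regular_module R\<^esub> b = a \<otimes> b" for a b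
    by (simp_all add: regular_module_def)
  note bl = bilinear_mapsD[OF cocycle_bilinear]
  note l = linear_mapsD[OF bl(1), unfolded simps] and r = linear_mapsD[OF bl(2), unfolded simps]
  show "\<sigma> x y \<in> carrier R"
    "z \<in> carrier L \<Longrightarrow> \<sigma> (x \<oplus>\<^bsub>L\<^esub> y) z = \<sigma> x z \<oplus> \<sigma> y z"
    "z \<in> carrier L \<Longrightarrow> \<sigma> x (y \<oplus>\<^bsub>L\<^esub> z) = \<sigma> x y \<oplus> \<sigma> x z"
    "r \<in> carrier R \<Longrightarrow> \<sigma> (r \<odot>\<^bsub>L\<^esub> x) y = r \<otimes> \<sigma> x y"
    "r \<in> carrier R \<Longrightarrow> \<sigma> x (r \<odot>\<^bsub>L\<^esub> y) = r \<otimes> \<sigma> x y"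
    using assms l r by auto
  show "\<sigma> x y \<oplus> \<sigma> y x = \<zero>"
    using bilinear_maps_skew[OF module_axioms reg cocycle_bilinear _ assms] cocycle_alternating
    by (simp add: simps)
  show "\<sigma> x \<zero>\<^bsub>L\<^esub> = \<zero>"
    using linear_maps_minus(1)[OF module_axioms reg bl(1)[OF assms(1)]] by (simp add: simps)
  show "\<sigma> \<zero>\<^bsub>L\<^esub> x = \<zero>"
    using linear_maps_minus(1)[OF module_axioms reg bl(2)[OF assms(1)]] by (simp add: simps)
qed

text \<open>The prescribed value of \<open>{s x, s y}\<close>.\<close>

definition generator_bracket where "generator_bracket x y = s (bracket x y) \<oplus>\<^bsub>S\<^esub> \<sigma> x y \<odot>\<^bsub>S\<^esub> \<one>\<^bsub>S\<^esub>"

lemma generator_bracket_linear: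
  assumes y: "y \<in> carrier L"
  shows "(\<lambda>x. generator_bracket x y) \<in> linear_maps R L S"
    and "generator_bracket y \<in> linear_maps R L S"
proof -
  interpret S: assoc_algebra R S by (rule sym_assoc_algebra)
  note s = linear_mapsD[OF sym_inj_linear]
  show "(\<lambda>x. generator_bracket x y) \<in> linear_maps R L S" "generator_bracket y \<in> linear_maps R L S"
    using y by (auto intro!: linear_mapsI simp: generator_bracket_def s bracket_rules cocycle_rules
        S.smult_l_distr S.smult_r_distr S.smult_assoc1 S.a_assoc S.a_lcomm)
qed

text \<open>For fixed \<open>y\<close> the prescribed values extend to a derivation \<open>d y\<close>, to become \<open>{\<cdot>, s y}\<close>. For fixed
  \<open>a\<close> the map \<open>y \<mapsto> d y a\<close> is linear, because derivations are determined on generators; so it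
  extends to a derivation \<open>p a\<close>, to become \<open>{a, \<cdot>}\<close>. That \<open>p\<close> is a derivation in its first
  argument too is again checked on generators of the second argument, where it holds for \<open>d y\<close>.\<close>

lemma sym_biderivation_exists:
  obtains p where "p \<in> biderivations R S"
    "\<And>x y. \<lbrakk>x \<in> carrier L; y \<in> carrier L\<rbrakk> \<Longrightarrow> p (s x) (s y) = generator_bracket x y"
proof -
  have S': "assoc_algebra R S" by (rule sym_assoc_algebra)
  interpret S': assoc_algebra R S by fact
  interpret S: algebra R S by (rule sym_algebra_algebra)
  let ?Der = "alpha_derivations R S S (\<lambda>a. a)"
  have id: "(\<lambda>a. a) \<in> alg_homs R S S"
    by (intro alg_homsI linear_mapsI) simp_all
  note s = linear_mapsD[OF sym_inj_linear]
  have "\<exists>d. d \<in> ?Der \<and> (\<forall>x\<in>carrier L. d (s x) = generator_bracket x y)" if "y \<in> carrier L" for y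
    by (rule sym_derivation_exists[OF S' id generator_bracket_linear(1)[OF that]])
      (intro exI conjI ballI)
  then obtain d where d: "\<And>y. y \<in> carrier L \<Longrightarrow> d y \<in> ?Der"
    and ds: "\<And>x y. \<lbrakk>x \<in> carrier L; y \<in> carrier L\<rbrakk> \<Longrightarrow> d y (s x) = generator_bracket x y"
    by metis
  note dD = linear_mapsD[OF alpha_derivationsD(1)[OF d]] alpha_derivationsD(2)[OF d]
    alpha_derivation_one[OF S' S' id d]
  note g = linear_mapsD[OF generator_bracket_linear(2)]
  have d_add: "d (y \<oplus>\<^bsub>L\<^esub> z) a = d y a \<oplus>\<^bsub>S\<^esub> d z a"
    if y: "y \<in> carrier L" and z: "z \<in> carrier L" and a: "a \<in> carrier S" for y z a
    using sym_generates S' a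
  proof (induction rule: generates_induct)
    case (gen u)
    thus ?case using y z by (auto simp: ds g)
  qed (use y z in \<open>simp_all add: dD S'.a_assoc S'.a_lcomm S'.r_distr S'.smult_r_distr\<close>)
  have d_smult: "d (r \<odot>\<^bsub>L\<^esub> y) a = r \<odot>\<^bsub>S\<^esub> d y a"
    if r: "r \<in> carrier R" and y: "y \<in> carrier L" and a: "a \<in> carrier S" for r y a
    using sym_generates S' a
  proof (induction rule: generates_induct)
    case (smult q a)
    thus ?case using r y by (simp add: dD S'.smult_assoc1[symmetric] R.m_comm)
  next
    case (gen u)
    thus ?case using r y by (auto simp: ds g)
  qed (use r y in \<open>simp_all add: dD S'.smult_r_distr S'.smult_mult_right\<close>)
  have "\<exists>e. e \<in> ?Der \<and> (\<forall>y\<in>carrier L. e (s y) = d y a)" if a: "a \<in> carrier S" for a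
  proof -
    have "(\<lambda>y. d y a) \<in> linear_maps R L S"
      using a d_add d_smult dD by (intro linear_mapsI) auto
    thus ?thesis
      by (rule sym_derivation_exists[OF S' id]) (intro exI conjI ballI)
  qed
  then obtain p where p: "\<And>a. a \<in> carrier S \<Longrightarrow> p a \<in> ?Der"
    and ps: "\<And>a y. \<lbrakk>a \<in> carrier S; y \<in> carrier L\<rbrakk> \<Longrightarrow> p a (s y) = d y a"
    by metis
  note pD = linear_mapsD[OF alpha_derivationsD(1)[OF p]] alpha_derivationsD(2)[OF p]
    alpha_derivation_one[OF S' S' id p]
  have p_add: "p (a \<oplus>\<^bsub>S\<^esub> b) c = p a c \<oplus>\<^bsub>S\<^esub> p b c"
    if a: "a \<in> carrier S" and b: "b \<in> carrier S" and c: "c \<in> carrier S" for a b c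
    using sym_generates S' c
  proof (induction rule: generates_induct)
    case (gen u)
    thus ?case using a b by (auto simp: ps dD)
  qed (use a b in \<open>simp_all add: pD S'.a_assoc S'.a_lcomm S'.r_distr S'.smult_r_distr\<close>)
  have p_smult: "p (r \<odot>\<^bsub>S\<^esub> a) c = r \<odot>\<^bsub>S\<^esub> p a c"
    if r: "r \<in> carrier R" and a: "a \<in> carrier S" and c: "c \<in> carrier S" for r a c
    using sym_generates S' c
  proof (induction rule: generates_induct)
    case (smult q b)
    thus ?case using r a by (simp add: pD S'.smult_assoc1[symmetric] R.m_comm)
  next
    case (gen u)
    thus ?case using r a by (auto simp: ps dD)
  qed (use r a in \<open>simp_all add: pD S'.smult_r_distr S'.smult_mult_right\<close>)
  have p_mult: "p (a \<otimes>\<^bsub>S\<^esub> b) c = a \<otimes>\<^bsub>S\<^esub> p b c \<oplus>\<^bsub>S\<^esub> b \<otimes>\<^bsub>S\<^esub> p a c"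
    if a: "a \<in> carrier S" and b: "b \<in> carrier S" and c: "c \<in> carrier S" for a b c
    using sym_generates S' c
  proof (induction rule: generates_induct)
    case (gen u)
    thus ?case using a b by (auto simp: ps dD)
  qed (use a b in \<open>simp_all add: pD S'.a_assoc S'.a_lcomm S'.r_distr S.m_lcomm
        S'.smult_r_distr S'.smult_mult_right\<close>)
  have "p \<in> bilinear_maps R S S"
    unfolding bilinear_maps_def using p_add p_smult pD by (auto intro!: linear_mapsI)
  hence "p \<in> biderivations R S"
    unfolding biderivations_def using p_mult pD(4) by simp
  moreover have "p (s x) (s y) = generator_bracket x y" if "x \<in> carrier L" "y \<in> carrier L" for x y
    using ps ds that s by simp
  ultimately show thesis by (rule that)
qed

lemma biderivations_cong:
  assumes "p \<in> biderivations R S" and "\<And>a b. \<lbrakk>a \<in> carrier S; b \<in> carrier S\<rbrakk> \<Longrightarrow> q a b = p a b"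
  shows "q \<in> biderivations R S"
proof -
  interpret p: biderivation_algebra R S p
    using assms sym_algebra_algebra
    by (intro biderivation_algebra.intro biderivation_algebra_axioms.intro)
  show ?thesis
    by (auto simp: biderivations_def bilinear_maps_def assms(2) p.bideriv_add_left p.bideriv_add_right
      p.bideriv_smult_left p.bideriv_smult_right p.bideriv_mult_left p.bideriv_mult_right intro!: linear_mapsI)
qed

lemma sym_bracket_spec:
  shows "sym_bracket R L bracket \<sigma> \<in> biderivations R S"
    and "\<lbrakk>x \<in> carrier L; y \<in> carrier L\<rbrakk> \<Longrightarrow> sym_bracket R L bracket \<sigma> (s x) (s y) = generator_bracket x y"
proof -
  let ?P = "\<lambda>p. p \<in> carrier S \<rightarrow>\<^sub>E carrier S \<rightarrow>\<^sub>E carrier S \<and> p \<in> biderivations R S \<and>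
      (\<forall>x\<in>carrier L. \<forall>y\<in>carrier L. p (s x) (s y) = generator_bracket x y)"
  note s = linear_mapsD(1)[OF sym_inj_linear]
  have "\<exists>!p. ?P p"
  proof (rule ex_ex1I)
    obtain p where p: "p \<in> biderivations R S"
      and ps: "\<And>x y. \<lbrakk>x \<in> carrier L; y \<in> carrier L\<rbrakk> \<Longrightarrow> p (s x) (s y) = generator_bracket x y"
      using sym_biderivation_exists by blast
    define q where "q = (\<lambda>a\<in>carrier S. \<lambda>b\<in>carrier S. p a b)"
    have q: "q a b = p a b" if "a \<in> carrier S" "b \<in> carrier S" for a b
      using that by (simp add: q_def)
    have "p a b \<in> carrier S" if "a \<in> carrier S" "b \<in> carrier S" for a b
      using p that by (auto simp: biderivations_def bilinear_maps_def linear_maps_def)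
    hence "q \<in> carrier S \<rightarrow>\<^sub>E carrier S \<rightarrow>\<^sub>E carrier S"
      by (auto simp: q_def)
    moreover have "q \<in> biderivations R S"
      using p q by (rule biderivations_cong)
    ultimately have "?P q" using ps q s by simp
    thus "\<exists>p. ?P p" by blast
  next
    fix p q assume p: "?P p" and q: "?P q"
    have eq: "p a b = q a b" if "a \<in> carrier S" "b \<in> carrier S" for a b
      by (rule biderivations_eq_on_generators[OF sym_generates sym_algebra_algebra _ _ _ that])
        (use p q in auto)
    show "p = q"
    proof (rule PiE_ext[where k = "carrier S" and s = "\<lambda>_. carrier S \<rightarrow>\<^sub>E carrier S"])
      fix a assume a: "a \<in> carrier S"
      hence "p a \<in> carrier S \<rightarrow>\<^sub>E carrier S" "q a \<in> carrier S \<rightarrow>\<^sub>E carrier S"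
        using p q by (auto dest: PiE_mem)
      thus "p a = q a" by (rule PiE_ext) (rule eq[OF a])
    qed (use p q in simp_all)
  qed
  hence "?P (THE p. ?P p)" by (rule theI')
  hence *: "?P (sym_bracket R L bracket \<sigma>)"
    by (simp add: sym_bracket_def Let_def generator_bracket_def)
  from * show "sym_bracket R L bracket \<sigma> \<in> biderivations R S" by blast
  from * show "\<lbrakk>x \<in> carrier L; y \<in> carrier L\<rbrakk> \<Longrightarrow> sym_bracket R L bracket \<sigma> (s x) (s y) = generator_bracket x y"
    by blast
qed

text \<open>On generators the jacobiator of the bracket is the sum of the jacobiator of the Lie bracket and of
  the left-hand side of the cocycle identity.\<close>

lemma sym_poisson_algebra: "poisson_algebra R S (sym_bracket R L bracket \<sigma>)"
proof -
  let ?p = "sym_bracket R L bracket \<sigma>"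
  interpret S: algebra R S by (rule sym_algebra_algebra)
  interpret S: biderivation_algebra R S ?p
    using sym_bracket_spec(1)
    by (intro biderivation_algebra.intro biderivation_algebra_axioms.intro S.algebra_axioms)
  note s = linear_mapsD[OF sym_inj_linear]
  have s0: "s \<zero>\<^bsub>L\<^esub> = \<zero>\<^bsub>S\<^esub>"
    by (rule linear_maps_minus(1)[OF module_axioms S.module_axioms sym_inj_linear])
  note br = sym_bracket_spec(2) bracket_rules cocycle_rules
  have gc: "generator_bracket x y \<in> carrier S" if "x \<in> carrier L" "y \<in> carrier L" for x y
    using that by (simp add: generator_bracket_def s br)
  \<comment> \<open>The scalar part of \<open>{s x, s y}\<close> has zero bracket with everything, so only the Lie bracket part
    contributes.\<close>
  have nested: "?p (generator_bracket x y) (s z) = generator_bracket (bracket x y) z"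
    if "x \<in> carrier L" "y \<in> carrier L" "z \<in> carrier L" for x y z
  proof -
    have "?p (generator_bracket x y) (s z) = ?p (s (bracket x y)) (s z) \<oplus>\<^bsub>S\<^esub> \<sigma> x y \<odot>\<^bsub>S\<^esub> ?p \<one>\<^bsub>S\<^esub> (s z)"
      using that by (simp add: generator_bracket_def s br(3-) S.bideriv_add_left S.bideriv_smult_left br(2))
    thus ?thesis using that s br gc by (simp add: S.bideriv_one_left)
  qed
  show ?thesis
  proof (rule S.poisson_algebra_from_generators[OF sym_generates])
    fix u v assume "u \<in> s ` carrier L" "v \<in> s ` carrier L"
    then obtain x y where xy: "x \<in> carrier L" "y \<in> carrier L" "u = s x" "v = s y" by blast
    have "generator_bracket x y \<oplus>\<^bsub>S\<^esub> generator_bracket y x =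
      s (bracket x y \<oplus>\<^bsub>L\<^esub> bracket y x) \<oplus>\<^bsub>S\<^esub> (\<sigma> x y \<oplus> \<sigma> y x) \<odot>\<^bsub>S\<^esub> \<one>\<^bsub>S\<^esub>"
      using xy by (simp only: generator_bracket_def s bracket_rules(1) cocycle_rules(1) S.smult_l_distr
          S.one_closed S.smult_closed S.M.a_assoc S.M.a_lcomm S.M.a_comm S.M.a_closed)
    also have "\<dots> = \<zero>\<^bsub>S\<^esub>" using xy br s0 by simp
    finally show "?p u v \<oplus>\<^bsub>S\<^esub> ?p v u = \<zero>\<^bsub>S\<^esub>" using xy br by simp
  next
    fix u assume "u \<in> s ` carrier L"
    thus "?p u u = \<zero>\<^bsub>S\<^esub>"
      by (auto simp: br(1) generator_bracket_def bracket_alternating cocycle_alternating s0)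
  next
    fix u v w assume "u \<in> s ` carrier L" "v \<in> s ` carrier L" "w \<in> s ` carrier L"
    then obtain x y z where xyz: "x \<in> carrier L" "y \<in> carrier L" "z \<in> carrier L"
      and uvw: "u = s x" "v = s y" "w = s z" by blast
    let ?x = "bracket (bracket x y) z" and ?y = "bracket (bracket y z) x" and ?z = "bracket (bracket z x) y"
    let ?a = "\<sigma> (bracket x y) z" and ?b = "\<sigma> (bracket y z) x" and ?c = "\<sigma> (bracket z x) y"
    have c: "?x \<in> carrier L" "?y \<in> carrier L" "?z \<in> carrier L"
      "?a \<in> carrier R" "?b \<in> carrier R" "?c \<in> carrier R"
      using xyz by (simp_all add: bracket_rules(1) cocycle_rules(1))
    have "S.jacobiator u v w =
        generator_bracket (bracket x y) z \<oplus>\<^bsub>S\<^esub> generator_bracket (bracket y z) x \<oplus>\<^bsub>S\<^esub> generator_bracket (bracket z x) y"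
      using xyz by (simp add: uvw S.jacobiator_def sym_bracket_spec(2) nested)
    also have "\<dots> = s (?x \<oplus>\<^bsub>L\<^esub> ?y \<oplus>\<^bsub>L\<^esub> ?z) \<oplus>\<^bsub>S\<^esub> (?a \<oplus> ?b \<oplus> ?c) \<odot>\<^bsub>S\<^esub> \<one>\<^bsub>S\<^esub>"
      unfolding generator_bracket_def
      using c by (simp only: s S.smult_l_distr M.a_closed R.a_closed
          S.one_closed S.smult_closed S.M.a_assoc S.M.a_lcomm S.M.a_comm S.M.a_closed)
    also have "\<dots> = \<zero>\<^bsub>S\<^esub>"
      using xyz by (simp add: bracket_jacobi cocycle_identity s0)
    finally show "S.jacobiator u v w = \<zero>\<^bsub>S\<^esub>" .
  qed
qed

end

section \<open>The enveloping algebra of the double\<close>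

lemma double_module_simps:
  "carrier (double_module L) = carrier L \<times> carrier L"
  "\<zero>\<^bsub>double_module L\<^esub> = (\<zero>\<^bsub>L\<^esub>, \<zero>\<^bsub>L\<^esub>)"
  "x \<oplus>\<^bsub>double_module L\<^esub> y = (fst x \<oplus>\<^bsub>L\<^esub> fst y, snd x \<oplus>\<^bsub>L\<^esub> snd y)"
  "r \<odot>\<^bsub>double_module L\<^esub> x = (r \<odot>\<^bsub>L\<^esub> fst x, r \<odot>\<^bsub>L\<^esub> snd x)"
  by (simp_all add: double_module_def split_beta)

lemma double_bracket_simp: "double_bracket L br (a, b) (c, d) = (br a d \<oplus>\<^bsub>L\<^esub> br b c, br b d)"
  by (simp add: double_bracket_def)

lemma double_cocycle_simp: "double_cocycle R \<sigma> (a, b) (c, d) = \<sigma> a d \<oplus>\<^bsub>R\<^esub> \<sigma> b c"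
  by (simp add: double_cocycle_def)

lemma (in module) module_double_module: "module R (double_module M)"
proof -
  have "abelian_group (double_module M)"
  proof (rule abelian_groupI)
    fix x assume "x \<in> carrier (double_module M)"
    thus "\<exists>y\<in>carrier (double_module M). y \<oplus>\<^bsub>double_module M\<^esub> x = \<zero>\<^bsub>double_module M\<^esub>"
      by (intro bexI[of _ "(\<ominus>\<^bsub>M\<^esub> fst x, \<ominus>\<^bsub>M\<^esub> snd x)"])
        (auto simp: double_module_simps M.l_neg)
  qed (auto simp: double_module_simps M.a_assoc M.a_comm M.a_lcomm)
  thus ?thesis
    by (intro moduleI R.is_cring)
      (auto simp: double_module_simps smult_l_distr smult_r_distr smult_assoc1)
qed

context two_cocycle
begin

abbreviation "U \<equiv> double_enveloping_algebra R L bracket \<sigma>"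
abbreviation "\<iota> \<equiv> double_enveloping_map R L bracket \<sigma>"
abbreviation "alpha \<equiv> alpha_map R L bracket \<sigma>"
abbreviation "beta \<equiv> beta_map R L bracket \<sigma>"

sublocale double: sridharan_data R "double_module L" "double_bracket L bracket" "double_cocycle R \<sigma>"
  by (intro sridharan_data.intro sridharan_data_axioms.intro module_double_module)
    (auto simp: double_module_simps double_bracket_simp double_cocycle_simp bracket_rules cocycle_rules)

lemmas U_assoc_algebra = double.enveloping_assoc_algebra

lemma enveloping_map_in0_in1:
  shows "(\<lambda>x. \<iota> (in0 L x)) \<in> linear_maps R L U"
    and "(\<lambda>x. \<iota> (in1 L x)) \<in> linear_maps R L U"
    and "\<lbrakk>x \<in> carrier L; y \<in> carrier L\<rbrakk> \<Longrightarrow> \<iota> (x, y) = \<iota> (in0 L x) \<oplus>\<^bsub>U\<^esub> \<iota> (in1 L y)"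
    and "\<iota> (\<zero>\<^bsub>L\<^esub>, \<zero>\<^bsub>L\<^esub>) = \<zero>\<^bsub>U\<^esub>"
proof -
  interpret U: assoc_algebra R U by (rule U_assoc_algebra)
  note i = linear_mapsD[OF double.enveloping_map_linear]
  have closed: "in0 L x \<in> carrier (double_module L)" "in1 L x \<in> carrier (double_module L)"
    if "x \<in> carrier L" for x
    using that by (simp_all add: in0_def in1_def double_module_simps)
  have add: "in0 L (x \<oplus>\<^bsub>L\<^esub> y) = in0 L x \<oplus>\<^bsub>double_module L\<^esub> in0 L y"
    "in1 L (x \<oplus>\<^bsub>L\<^esub> y) = in1 L x \<oplus>\<^bsub>double_module L\<^esub> in1 L y"
    "(x, y) = in0 L x \<oplus>\<^bsub>double_module L\<^esub> in1 L y"
    if "x \<in> carrier L" "y \<in> carrier L" for x y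
    using that by (simp_all add: in0_def in1_def double_module_simps)
  have smult: "in0 L (r \<odot>\<^bsub>L\<^esub> x) = r \<odot>\<^bsub>double_module L\<^esub> in0 L x"
    "in1 L (r \<odot>\<^bsub>L\<^esub> x) = r \<odot>\<^bsub>double_module L\<^esub> in1 L x"
    if "r \<in> carrier R" for r x
    using that by (simp_all add: in0_def in1_def double_module_simps)
  show "(\<lambda>x. \<iota> (in0 L x)) \<in> linear_maps R L U" "(\<lambda>x. \<iota> (in1 L x)) \<in> linear_maps R L U"
    by (intro linear_mapsI; simp only: add smult i closed)+
  show "\<iota> (x, y) = \<iota> (in0 L x) \<oplus>\<^bsub>U\<^esub> \<iota> (in1 L y)" if "x \<in> carrier L" "y \<in> carrier L"
    using that by (simp only: add(3) i closed)
  show "\<iota> (\<zero>\<^bsub>L\<^esub>, \<zero>\<^bsub>L\<^esub>) = \<zero>\<^bsub>U\<^esub>"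
    using linear_maps_minus(1)[OF double.module_axioms U.module_axioms double.enveloping_map_linear]
      closed by (simp add: double_module_simps)
qed

text \<open>The relations of the double read off on the two copies of the module: the first one makes
  the morphism \<open>alpha\<close> exist on the symmetric algebra, the other two are the conditions of a Poisson
  triple on generators.\<close>

lemma enveloping_map_commutators:
  assumes x: "x \<in> carrier L" and y: "y \<in> carrier L"
  shows "commutator U (\<iota> (in0 L x)) (\<iota> (in0 L y)) = \<zero>\<^bsub>U\<^esub>"
    and "commutator U (\<iota> (in0 L x)) (\<iota> (in1 L y)) = \<iota> (in0 L (bracket x y)) \<oplus>\<^bsub>U\<^esub> \<sigma> x y \<odot>\<^bsub>U\<^esub> \<one>\<^bsub>U\<^esub>"
    and "commutator U (\<iota> (in1 L x)) (\<iota> (in1 L y)) = \<iota> (in1 L (bracket x y))"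
proof -
  interpret U: assoc_algebra R U by (rule U_assoc_algebra)
  note i = linear_mapsD(1)[OF enveloping_map_in0_in1(1)] linear_mapsD(1)[OF enveloping_map_in0_in1(2)]
  note com = double.enveloping_map_commutator
  have closed: "in0 L x \<in> carrier (double_module L)" "in1 L x \<in> carrier (double_module L)"
    if "x \<in> carrier L" for x
    using that by (simp_all add: in0_def in1_def double_module_simps)
  have br: "double_bracket L bracket (in0 L x) (in0 L y) = (\<zero>\<^bsub>L\<^esub>, \<zero>\<^bsub>L\<^esub>)"
    "double_bracket L bracket (in0 L x) (in1 L y) = in0 L (bracket x y)"
    "double_bracket L bracket (in1 L x) (in1 L y) = in1 L (bracket x y)"
    "double_cocycle R \<sigma> (in0 L x) (in0 L y) = \<zero>"
    "double_cocycle R \<sigma> (in0 L x) (in1 L y) = \<sigma> x y"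
    "double_cocycle R \<sigma> (in1 L x) (in1 L y) = \<zero>"
    using x y bracket_rules(1)[OF x y] cocycle_rules(1)[OF x y]
      bracket_rules(3,4)[OF x x] bracket_rules(3,4)[OF y y] cocycle_rules(3,4)[OF x x] cocycle_rules(3,4)[OF y y]
      bracket_alternating[of "\<zero>\<^bsub>L\<^esub>"] cocycle_alternating[of "\<zero>\<^bsub>L\<^esub>"]
    by (simp_all add: in0_def in1_def double_bracket_simp double_cocycle_simp)
  show "commutator U (\<iota> (in0 L x)) (\<iota> (in0 L y)) = \<zero>\<^bsub>U\<^esub>"
    using com[OF closed(1)[OF x] closed(1)[OF y]] by (simp add: br enveloping_map_in0_in1(4))
  show "commutator U (\<iota> (in0 L x)) (\<iota> (in1 L y)) = \<iota> (in0 L (bracket x y)) \<oplus>\<^bsub>U\<^esub> \<sigma> x y \<odot>\<^bsub>U\<^esub> \<one>\<^bsub>U\<^esub>"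
    using com[OF closed(1)[OF x] closed(2)[OF y]] by (simp add: br)
  show "commutator U (\<iota> (in1 L x)) (\<iota> (in1 L y)) = \<iota> (in1 L (bracket x y))"
    using com[OF closed(2)[OF x] closed(2)[OF y]] i bracket_rules(1)[OF x y] by (simp add: br)
qed

text \<open>The unique existence that turns the definite description in the definition into its defining
  properties; similarly for the derivation below.\<close>

lemma alpha_spec:
  shows "alpha \<in> alg_homs R S U"
    and "x \<in> carrier L \<Longrightarrow> alpha (s x) = \<iota> (in0 L x)"
proof -
  let ?P = "\<lambda>\<alpha>. \<alpha> \<in> alg_homs R S U \<and> \<alpha> \<in> extensional (carrier S) \<and>
       (\<forall>x\<in>carrier L. \<alpha> (s x) = \<iota> (in0 L x))"
  interpret U: assoc_algebra R U by (rule U_assoc_algebra)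
  interpret S: assoc_algebra R S by (rule sym_assoc_algebra)
  note i = linear_mapsD(1)[OF enveloping_map_in0_in1(1)]
  note s = linear_mapsD(1)[OF sym_inj_linear]
  have comm: "\<iota> (in0 L x) \<otimes>\<^bsub>U\<^esub> \<iota> (in0 L y) = \<iota> (in0 L y) \<otimes>\<^bsub>U\<^esub> \<iota> (in0 L x)"
    if "x \<in> carrier L" "y \<in> carrier L" for x y
    using enveloping_map_commutators(1)[OF that] i that
    by (simp add: commutator_def U.r_right_minus_eq)
  have "\<exists>!\<alpha>. ?P \<alpha>"
  proof (rule ex_ex1I)
    obtain h where h: "h \<in> alg_homs R S U" and hs: "\<And>x. x \<in> carrier L \<Longrightarrow> h (s x) = \<iota> (in0 L x)"
      using sym_lift[OF U_assoc_algebra enveloping_map_in0_in1(1) comm] by blast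
    have "restrict h (carrier S) \<in> alg_homs R S U"
      using linear_mapsD[OF alg_homsD(1)[OF h]] alg_homsD(2,3)[OF h]
      by (intro alg_homsI linear_mapsI) auto
    hence "?P (restrict h (carrier S))" using hs s by simp
    thus "\<exists>\<alpha>. ?P \<alpha>" by (rule exI[of ?P])
  next
    fix f g assume f: "?P f" and g: "?P g"
    show "f = g"
    proof (rule extensionalityI)
      show "f a = g a" if "a \<in> carrier S" for a
        by (rule alg_homs_eq_on_generators[OF sym_generates sym_assoc_algebra _ _ _ that])
          (use f g in auto)
    qed (use f g in blast)+
  qed
  hence "?P (THE \<alpha>. ?P \<alpha>)" by (rule theI')
  hence *: "?P alpha" by (simp add: alpha_map_def Let_def)
  from * show "alpha \<in> alg_homs R S U" by blast
  from * show "x \<in> carrier L \<Longrightarrow> alpha (s x) = \<iota> (in0 L x)" by blast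
qed

lemma beta_spec:
  shows "beta \<in> alpha_derivations R S U alpha"
    and "x \<in> carrier L \<Longrightarrow> beta (s x) = \<iota> (in1 L x)"
proof -
  let ?P = "\<lambda>\<beta>. \<beta> \<in> alpha_derivations R S U alpha \<and> \<beta> \<in> extensional (carrier S) \<and>
       (\<forall>x\<in>carrier L. \<beta> (s x) = \<iota> (in1 L x))"
  interpret U: assoc_algebra R U by (rule U_assoc_algebra)
  interpret S: assoc_algebra R S by (rule sym_assoc_algebra)
  note s = linear_mapsD(1)[OF sym_inj_linear]
  have "\<exists>!\<beta>. ?P \<beta>"
  proof (rule ex_ex1I)
    obtain h where h: "h \<in> alpha_derivations R S U alpha" and hs: "\<And>x. x \<in> carrier L \<Longrightarrow> h (s x) = \<iota> (in1 L x)"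
      by (rule sym_derivation_exists[OF U_assoc_algebra alpha_spec(1) enveloping_map_in0_in1(2)]) (rule that)
    have "restrict h (carrier S) \<in> alpha_derivations R S U alpha"
      unfolding alpha_derivations_def
      using linear_mapsD[OF alpha_derivationsD(1)[OF h]] alpha_derivationsD(2)[OF h]
      by (intro CollectI conjI ballI linear_mapsI) auto
    hence "?P (restrict h (carrier S))" using hs s by simp
    thus "\<exists>\<beta>. ?P \<beta>" by (rule exI[of ?P])
  next
    fix f g assume f: "?P f" and g: "?P g"
    show "f = g"
    proof (rule extensionalityI)
      show "f a = g a" if "a \<in> carrier S" for a
        by (rule alpha_derivations_eq_on_generators
            [OF sym_generates sym_assoc_algebra U_assoc_algebra alpha_spec(1) _ _ _ that])
          (use f g in auto)
    qed (use f g in blast)+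
  qed
  hence "?P (THE \<beta>. ?P \<beta>)" by (rule theI')
  hence *: "?P beta" by (simp add: beta_map_def Let_def)
  from * show "beta \<in> alpha_derivations R S U alpha" by blast
  from * show "x \<in> carrier L \<Longrightarrow> beta (s x) = \<iota> (in1 L x)" by blast
qed

lemma double_enveloping_poisson_triple:
  "poisson_triple R S (sym_bracket R L bracket \<sigma>) U alpha beta"
proof (rule poisson_triple_from_generators[OF sym_generates sym_poisson_algebra U_assoc_algebra
      alpha_spec(1) beta_spec(1)])
  interpret U: assoc_algebra R U by (rule U_assoc_algebra)
  interpret S: assoc_algebra R S by (rule sym_assoc_algebra)
  note s = linear_mapsD(1)[OF sym_inj_linear]
  note a = linear_mapsD[OF alg_homsD(1)[OF alpha_spec(1)]] alg_homsD(3)[OF alpha_spec(1)]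
  note b = linear_mapsD[OF alpha_derivationsD(1)[OF beta_spec(1)]]
    alpha_derivation_one[OF sym_assoc_algebra U_assoc_algebra alpha_spec(1) beta_spec(1)]
  note i = linear_mapsD(1)[OF enveloping_map_in0_in1(1)] linear_mapsD(1)[OF enveloping_map_in0_in1(2)]
  fix u v assume "u \<in> s ` carrier L" "v \<in> s ` carrier L"
  then obtain x y where xy: "x \<in> carrier L" "y \<in> carrier L" "u = s x" "v = s y" by blast
  note c = bracket_rules(1)[OF xy(1,2)] cocycle_rules(1)[OF xy(1,2)]
  show "alpha (sym_bracket R L bracket \<sigma> u v) = commutator U (alpha u) (beta v)"
    using xy c s by (simp add: sym_bracket_spec(2) generator_bracket_def a alpha_spec(2) beta_spec(2)
        enveloping_map_commutators(2))
  show "beta (sym_bracket R L bracket \<sigma> u v) = commutator U (beta u) (beta v)"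
    using xy c s i by (simp add: sym_bracket_spec(2) generator_bracket_def b beta_spec(2)
        enveloping_map_commutators(3))
qed

text \<open>The relations of the double hold in \<open>V\<close> for \<open>g (x\<^sup>0 + y\<^sup>1) = \<alpha>'(s x) + \<beta>'(s y)\<close>: the four
  parts of the commutator are \<open>[\<alpha>', \<alpha>'] = 0\<close> by commutativity of the symmetric algebra,
  \<open>[\<alpha>', \<beta>']\<close> and \<open>[\<beta>', \<alpha>']\<close>, which yield the bracket into the zeroth copy together with the
  cocycle, and \<open>[\<beta>', \<beta>']\<close>, which yields the bracket into the first copy without a scalar since
  \<open>\<beta>' 1 = 0\<close>.\<close>

lemma double_enveloping_universal:
  assumes V: "poisson_triple R S (sym_bracket R L bracket \<sigma>) V \<alpha>' \<beta>'"
  shows "\<exists>!\<gamma>. \<gamma> \<in> alg_homs R U V \<and> \<gamma> \<in> extensional (carrier U) \<and>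
    (\<forall>a\<in>carrier S. \<gamma> (alpha a) = \<alpha>' a) \<and> (\<forall>a\<in>carrier S. \<gamma> (beta a) = \<beta>' a)"
proof -
  have Va: "assoc_algebra R V" and \<alpha>': "\<alpha>' \<in> alg_homs R S V"
    and \<beta>'l: "\<beta>' \<in> linear_maps R S V"
    and \<beta>\<beta>: "\<And>a b. \<lbrakk>a \<in> carrier S; b \<in> carrier S\<rbrakk> \<Longrightarrow>
        \<beta>' (sym_bracket R L bracket \<sigma> a b) = commutator V (\<beta>' a) (\<beta>' b)"
    and \<alpha>\<beta>: "\<And>a b. \<lbrakk>a \<in> carrier S; b \<in> carrier S\<rbrakk> \<Longrightarrow>
        \<alpha>' (sym_bracket R L bracket \<sigma> a b) = commutator V (\<alpha>' a) (\<beta>' b)"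
    and \<beta>': "\<beta>' \<in> alpha_derivations R S V \<alpha>'"
    using V by (auto simp: poisson_triple_def lie_homs_def alpha_derivations_def commutator_def)
  interpret V: assoc_algebra R V by fact
  interpret S: algebra R S by (rule sym_algebra_algebra)
  note s = linear_mapsD[OF sym_inj_linear]
  note a = linear_mapsD[OF alg_homsD(1)[OF \<alpha>']] alg_homsD(2,3)[OF \<alpha>']
  note b = linear_mapsD[OF alpha_derivationsD(1)[OF \<beta>']] alpha_derivationsD(2)[OF \<beta>']
    alpha_derivation_one[OF sym_assoc_algebra Va \<alpha>' \<beta>']
  note A = linear_mapsD[OF alg_homsD(1)[OF alpha_spec(1)]] alg_homsD(2,3)[OF alpha_spec(1)]
  note B = linear_mapsD[OF alpha_derivationsD(1)[OF beta_spec(1)]] alpha_derivationsD(2)[OF beta_spec(1)]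
  note i = linear_mapsD(1)[OF enveloping_map_in0_in1(1)] linear_mapsD(1)[OF enveloping_map_in0_in1(2)]
  define g where "g = (\<lambda>x. \<alpha>' (s (fst x)) \<oplus>\<^bsub>V\<^esub> \<beta>' (s (snd x)))"
  have g_lin: "g \<in> linear_maps R (double_module L) V"
    by (rule linear_mapsI)
      (auto simp: g_def double_module_simps s a b V.smult_r_distr V.a_assoc V.a_lcomm)
  have s0: "s \<zero>\<^bsub>L\<^esub> = \<zero>\<^bsub>S\<^esub>" "\<alpha>' \<zero>\<^bsub>S\<^esub> = \<zero>\<^bsub>V\<^esub>" "\<beta>' \<zero>\<^bsub>S\<^esub> = \<zero>\<^bsub>V\<^esub>"
    using linear_maps_minus(1)[OF module_axioms S.module_axioms sym_inj_linear]
      linear_maps_minus(1)[OF S.module_axioms V.module_axioms alg_homsD(1)[OF \<alpha>']]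
      linear_maps_minus(1)[OF S.module_axioms V.module_axioms \<beta>'l] by blast+
  have rel: "commutator V (g x) (g y) =
      g (double_bracket L bracket x y) \<oplus>\<^bsub>V\<^esub> double_cocycle R \<sigma> x y \<odot>\<^bsub>V\<^esub> \<one>\<^bsub>V\<^esub>"
    if "x \<in> carrier (double_module L)" "y \<in> carrier (double_module L)" for x y
  proof -
    from that obtain x0 x1 y0 y1 where xy: "x = (x0, x1)" "y = (y0, y1)"
      and c: "x0 \<in> carrier L" "x1 \<in> carrier L" "y0 \<in> carrier L" "y1 \<in> carrier L"
      by (auto simp: double_module_simps)
    note sc = s(1)[OF c(1)] s(1)[OF c(2)] s(1)[OF c(3)] s(1)[OF c(4)]
    note k = bracket_rules(1)[OF c(1,4)] bracket_rules(1)[OF c(2,3)] bracket_rules(1)[OF c(2,4)]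
      cocycle_rules(1)[OF c(1,4)] cocycle_rules(1)[OF c(2,3)] cocycle_rules(1)[OF c(2,4)]
      bracket_rules(1)[OF c(3,2)] cocycle_rules(1)[OF c(3,2)]
    have aa: "commutator V (\<alpha>' (s x0)) (\<alpha>' (s y0)) = \<zero>\<^bsub>V\<^esub>"
      using sc a(4)[of "s x0" "s y0"] a(4)[of "s y0" "s x0"] a(1)
      by (simp add: commutator_def S.m_comm[of "s x0"] V.minus_eq V.r_neg)
    have ab: "commutator V (\<alpha>' (s u)) (\<beta>' (s v)) = \<alpha>' (s (bracket u v)) \<oplus>\<^bsub>V\<^esub> \<sigma> u v \<odot>\<^bsub>V\<^esub> \<one>\<^bsub>V\<^esub>"
      if "u \<in> carrier L" "v \<in> carrier L" for u v
      using that s \<alpha>\<beta>[of "s u" "s v"] bracket_rules(1)[OF that] cocycle_rules(1)[OF that]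
      by (simp add: sym_bracket_spec(2) generator_bracket_def a)
    have ba: "commutator V (\<beta>' (s x1)) (\<alpha>' (s y0)) = \<alpha>' (s (bracket x1 y0)) \<oplus>\<^bsub>V\<^esub> \<sigma> x1 y0 \<odot>\<^bsub>V\<^esub> \<one>\<^bsub>V\<^esub>"
    proof -
      have "(\<alpha>' (s (bracket x1 y0)) \<oplus>\<^bsub>V\<^esub> \<sigma> x1 y0 \<odot>\<^bsub>V\<^esub> \<one>\<^bsub>V\<^esub>) \<oplus>\<^bsub>V\<^esub>
            (\<alpha>' (s (bracket y0 x1)) \<oplus>\<^bsub>V\<^esub> \<sigma> y0 x1 \<odot>\<^bsub>V\<^esub> \<one>\<^bsub>V\<^esub>) =
          \<alpha>' (s (bracket x1 y0 \<oplus>\<^bsub>L\<^esub> bracket y0 x1)) \<oplus>\<^bsub>V\<^esub> (\<sigma> x1 y0 \<oplus> \<sigma> y0 x1) \<odot>\<^bsub>V\<^esub> \<one>\<^bsub>V\<^esub>"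
        using k by (simp only: s a V.smult_l_distr V.one_closed V.smult_closed V.a_closed
            V.a_assoc V.a_lcomm)
      also have "\<dots> = \<zero>\<^bsub>V\<^esub>"
        using bracket_rules(2)[OF c(2,3)] cocycle_rules(2)[OF c(2,3)] s0 by simp
      finally show ?thesis
        using ab[OF c(3,2)] sc k V.commutator_rules(6)[of "\<beta>' (s x1)" "\<alpha>' (s y0)"]
          V.minus_equality[of "\<alpha>' (s (bracket x1 y0)) \<oplus>\<^bsub>V\<^esub> \<sigma> x1 y0 \<odot>\<^bsub>V\<^esub> \<one>\<^bsub>V\<^esub>" "\<alpha>' (s (bracket y0 x1)) \<oplus>\<^bsub>V\<^esub> \<sigma> y0 x1 \<odot>\<^bsub>V\<^esub> \<one>\<^bsub>V\<^esub>"]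
        by (simp add: a b s)
    qed
    have bb: "commutator V (\<beta>' (s x1)) (\<beta>' (s y1)) = \<beta>' (s (bracket x1 y1))"
      using c k sc s \<beta>\<beta>[of "s x1" "s y1"]
      by (simp add: sym_bracket_spec(2) generator_bracket_def b)
    have "commutator V (g x) (g y) =
        (commutator V (\<alpha>' (s x0)) (\<alpha>' (s y0)) \<oplus>\<^bsub>V\<^esub> commutator V (\<alpha>' (s x0)) (\<beta>' (s y1))) \<oplus>\<^bsub>V\<^esub>
        (commutator V (\<beta>' (s x1)) (\<alpha>' (s y0)) \<oplus>\<^bsub>V\<^esub> commutator V (\<beta>' (s x1)) (\<beta>' (s y1)))"
      using sc by (simp add: g_def xy V.commutator_rules a b V.a_assoc V.a_lcomm)
    also have "\<dots> = g (double_bracket L bracket x y) \<oplus>\<^bsub>V\<^esub> double_cocycle R \<sigma> x y \<odot>\<^bsub>V\<^esub> \<one>\<^bsub>V\<^esub>"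
      using k c unfolding aa ab[OF c(1,4)] ba bb
      by (simp add: g_def xy double_bracket_simp double_cocycle_simp s a b V.smult_l_distr
          V.a_assoc V.a_lcomm V.a_comm)
    finally show ?thesis .
  qed
  obtain h where h: "h \<in> alg_homs R U V"
    and hg: "\<And>x. x \<in> carrier (double_module L) \<Longrightarrow> h (\<iota> x) = g x"
    using double.enveloping_lift[OF Va g_lin rel] by blast
  define \<gamma> where "\<gamma> = restrict h (carrier U)"
  interpret U: assoc_algebra R U by (rule U_assoc_algebra)
  note hD = linear_mapsD[OF alg_homsD(1)[OF h]] alg_homsD(2,3)[OF h]
  have \<gamma>: "\<gamma> \<in> alg_homs R U V"
    using hD by (intro alg_homsI linear_mapsI) (auto simp: \<gamma>_def)
  note G = linear_mapsD[OF alg_homsD(1)[OF \<gamma>]] alg_homsD(2,3)[OF \<gamma>]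
  have \<gamma>i: "\<gamma> (\<iota> (in0 L x)) = \<alpha>' (s x)" "\<gamma> (\<iota> (in1 L x)) = \<beta>' (s x)" if "x \<in> carrier L" for x
    using that hg[of "in0 L x"] hg[of "in1 L x"] i s a b s0
    by (simp_all add: \<gamma>_def g_def in0_def in1_def double_module_simps)
  have hom: "(\<lambda>a. \<gamma> (alpha a)) \<in> alg_homs R S V"
    by (intro alg_homsI linear_mapsI) (simp_all add: G A)
  have \<gamma>\<alpha>: "\<gamma> (alpha u) = \<alpha>' u" if "u \<in> carrier S" for u
    using sym_generates sym_assoc_algebra hom \<alpha>' _ that
  proof (rule alg_homs_eq_on_generators)
    fix v assume "v \<in> s ` carrier L"
    thus "\<gamma> (alpha v) = \<alpha>' v" by (elim imageE) (simp only: alpha_spec(2) \<gamma>i)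
  qed
  have der: "(\<lambda>a. \<gamma> (beta a)) \<in> alpha_derivations R S V \<alpha>'"
    unfolding alpha_derivations_def
    by (intro CollectI conjI ballI linear_mapsI) (simp_all add: G A B \<gamma>\<alpha>)
  have \<gamma>\<beta>: "\<gamma> (beta u) = \<beta>' u" if "u \<in> carrier S" for u
    using sym_generates sym_assoc_algebra Va \<alpha>' der \<beta>' _ that
  proof (rule alpha_derivations_eq_on_generators)
    fix v assume "v \<in> s ` carrier L"
    thus "\<gamma> (beta v) = \<beta>' v" by (elim imageE) (simp only: beta_spec(2) \<gamma>i)
  qed
  show ?thesis
  proof (rule ex1I[of _ \<gamma>])
    show "\<gamma> \<in> alg_homs R U V \<and> \<gamma> \<in> extensional (carrier U) \<and>
      (\<forall>a\<in>carrier S. \<gamma> (alpha a) = \<alpha>' a) \<and> (\<forall>a\<in>carrier S. \<gamma> (beta a) = \<beta>' a)"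
      using \<gamma> \<gamma>\<alpha> \<gamma>\<beta> by (simp add: \<gamma>_def)
    fix \<delta> assume \<delta>: "\<delta> \<in> alg_homs R U V \<and> \<delta> \<in> extensional (carrier U) \<and>
      (\<forall>a\<in>carrier S. \<delta> (alpha a) = \<alpha>' a) \<and> (\<forall>a\<in>carrier S. \<delta> (beta a) = \<beta>' a)"
    hence D: "\<delta> \<in> alg_homs R U V" by blast
    have eq: "\<delta> u = \<gamma> u" if u: "u \<in> \<iota> ` carrier (double_module L)" for u
    proof -
      from u obtain x y where xy: "x \<in> carrier L" "y \<in> carrier L" "u = \<iota> (x, y)"
        by (auto simp: double_module_simps)
      have "\<delta> (alpha (s x)) = \<gamma> (alpha (s x))" "\<delta> (beta (s y)) = \<gamma> (beta (s y))"
        using \<delta> \<gamma>\<alpha> \<gamma>\<beta> s xy by auto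
      thus ?thesis
        using xy i G(2) linear_mapsD(2)[OF alg_homsD(1)[OF D]]
        by (simp add: enveloping_map_in0_in1(3) alpha_spec(2) beta_spec(2))
    qed
    show "\<delta> = \<gamma>"
    proof (rule extensionalityI)
      show "\<delta> \<in> extensional (carrier U)" using \<delta> by blast
      show "\<gamma> \<in> extensional (carrier U)" by (simp add: \<gamma>_def)
      show "\<delta> u = \<gamma> u" if "u \<in> carrier U" for u
        using double.enveloping_generates U_assoc_algebra D \<gamma> eq that
        by (rule alg_homs_eq_on_generators)
    qed
  qed
qed

end

theorem proposition2p11:
  fixes R :: "'r ring"
    and L :: "('r, 'g) module"
    and bracket :: "'g \<Rightarrow> 'g \<Rightarrow> 'g"
    and \<sigma> :: "'g \<Rightarrow> 'g \<Rightarrow> 'r"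
  assumes "cring R"
    and "lie_algebra R L bracket"
    and "two_cocycle R L bracket \<sigma>"
  shows "poisson_enveloping_algebra TYPE('v) R
           (sym_algebra R L) (sym_bracket R L bracket \<sigma>)
           (double_enveloping_algebra R L bracket \<sigma>)
           (alpha_map R L bracket \<sigma>) (beta_map R L bracket \<sigma>)"
proof -
  interpret two_cocycle R L bracket \<sigma> by fact
  show ?thesis
    unfolding poisson_enveloping_algebra_def
    by (intro conjI allI impI sym_poisson_algebra double_enveloping_poisson_triple
        double_enveloping_universal)
qed

end
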